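(* Let $p$ be a prime, $n$ a natural number and $G=\mathbb{Z}^n\ltimes \mathrm{UT}_n(\mathbb{Z}[1/p])$. Let $\mu$ be a probability measure on $G$ that has finite first moment with respect to word length and such that the group generated by $\operatorname{supp}\mu$ is non-abelian, and suppose that its displacement matrix $D$ is non-zero and column consistent. Let $\Gamma$ be the set of $n\times n$ upper unitriangular matrices $M$ whose entries $M_{ij}$ ($i<j$) lie in $\mathbb{R}$ if $D_{ij}<0$ and in $\mathbb{Q}_p$ if $D_{ij}>0$. Let $(y^{(m)},\varphi^{(m)})$ be the path of the right random walk associated with $\mu$ and let $\varphi^{(\infty)}$ be the almost surely defined element of $\Gamma$ with entries $\varphi^{(\infty)}_{ij}=\lim_{m\to\infty}\varphi^{(m)}_{ij}$ (limit in $\mathbb{R}$ or $\mathbb{Q}_p$ according to the sign of $D_{ij}$). For each natural number $m$ let $t^{(m)}=(\lfloor m\,m_1(\mu_1)\rfloor,\dots,\lfloor m\,m_1(\mu_n)\rfloor)$, let $M_{ij}=\lfloor m\,m_1(\mu_i)\rfloor-\lfloor m\,m_1(\mu_j)\rfloor$, and for $b\in\Gamma$ let $T^{(m)}(b)\in \mathrm{UT}_n(\mathbb{Z}[1/p])$ have entries, for $i<j$, $$T^{(m)}(b)_{ij}=\begin{cases}p^{M_{ij}}\lfloor p^{-M_{ij}}b_{ij}\rfloor & \text{if } D_{ij}<0,\\ p^{M_{ij}}\{p^{-M_{ij}}b_{ij}\} & \text{if } D_{ij}>0.\end{cases}$$ Let $\Pi^{(m)}(b)=(t^{(m)},T^{(m)}(b))\in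 G$. Then, almost surely, the sequence $$\left|\left(\Pi^{(m)}(\varphi^{(\infty)})\right)^{-1}(y^{(m)},\varphi^{(m)})\right|$$ is in $O(m)$ as $m\to\infty$.
   Context: $\mathrm{UT}_n(R)$ is the group of upper unitriangular $n\times n$ matrices over $R$. The product in $G$ is $(x,f)(y,g)=(x+y,\,f\,XgX^{-1})$, where $X=\operatorname{diag}(p^{x_1},\dots,p^{x_n})$. $G$ is a finitely generated discrete group; word length $|\cdot|$ is taken with respect to a finite generating set, and finite first moment means $\int_G|g|\,d\mu(g)<\infty$. For $1\le i\le n$, $\mu_i$ is the pushforward of $\mu$ under $(x,f)\mapsto x_i$, $m_1(\mu_i)=\int_{\mathbb{Z}} z\,d\mu_i(z)$, and the displacement matrix $D$ has entries $D_{ij}=m_1(\mu_i)-m_1(\mu_j)$ for $i<j$. $D$ is non-zero if every entry $D_{ij}$ with $i<j$ is non-zero, and column consistent if, for each $j$, all entries $D_{ij}$ with $i<j$ have the same sign. The right random walk: $(x^{(k)},f^{(k)})_{k\ge1}$ are independent with common law $\mu$, and $(y^{(m)},\varphi^{(m)})=(x^{(1)},f^{(1)})\cdots(x^{(m)},f^{(m)})$. $\lfloor x\rfloor$ is the floor of a real number $x$; for $x\in\mathbb{Q}_p$ with $p$-adic expansion $x=\sum_i\epsilon_ip^i$ (digits $\epsilon_i\in\{0,\dots,p-1\}$), $\{x\}=\sum_{i<0}\epsilon_ip^i\in\mathbb{Z}[1/p]$ is its fractional part. *)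

theory Defs
  imports
    "HOL-Probability.Probability"
    "HOL-Algebra.QuotRing"
    "HOL-Algebra.Elementary_Groups"
    "Jordan_Normal_Form.Matrix"
begin

unbundle no vec_syntax
hide_const (open) Finite_Cartesian_Product.mat Finite_Cartesian_Product.vec
  Finite_Cartesian_Product.row Finite_Cartesian_Product.column
hide_type (open) Finite_Cartesian_Product.vec

section \<open>The field of p-adic numbers\<close>

text \<open>
  The completion of the rationals for the p-adic absolute value: the ring of p-adic Cauchy
  sequences of rationals modulo the ideal of p-adic null sequences.
\<close>

definition padic_val_rat :: "nat \<Rightarrow> rat \<Rightarrow> int" where
  "padic_val_rat p q =
     int (multiplicity (int p) (fst (quotient_of q))) - int (multiplicity (int p) (snd (quotient_of q)))"

definition padic_abs_rat :: "nat \<Rightarrow> rat \<Rightarrow> real" where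
  "padic_abs_rat p q = (if q = 0 then 0 else real p powi (- padic_val_rat p q))"

definition padic_cauchy :: "nat \<Rightarrow> (nat \<Rightarrow> rat) set" where
  "padic_cauchy p =
     {x. \<forall>e>0. \<exists>N. \<forall>k\<ge>N. \<forall>l\<ge>N. padic_abs_rat p (x k - x l) < e}"

definition padic_null :: "nat \<Rightarrow> (nat \<Rightarrow> rat) set" where
  "padic_null p = {x. (\<lambda>k. padic_abs_rat p (x k)) \<longlonglongrightarrow> 0}"

definition padic_cauchy_ring :: "nat \<Rightarrow> (nat \<Rightarrow> rat) ring" where
  "padic_cauchy_ring p =
     \<lparr>carrier = padic_cauchy p,
      mult = (\<lambda>x y k. x k * y k), one = (\<lambda>_. 1),
      zero = (\<lambda>_. 0), add = (\<lambda>x y k. x k + y k)\<rparr>"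

type_synonym padic = "(nat \<Rightarrow> rat) set"

definition Qp :: "nat \<Rightarrow> padic ring" where
  "Qp p = padic_cauchy_ring p Quot padic_null p"

definition padic_of_rat :: "nat \<Rightarrow> rat \<Rightarrow> padic" where
  "padic_of_rat p q = padic_null p +>\<^bsub>padic_cauchy_ring p\<^esub> (\<lambda>_. q)"

definition padic_abs :: "nat \<Rightarrow> padic \<Rightarrow> real" where
  "padic_abs p X = (THE r. \<forall>x\<in>X. (\<lambda>k. padic_abs_rat p (x k)) \<longlonglongrightarrow> r)"

definition padic_tendsto :: "nat \<Rightarrow> (nat \<Rightarrow> padic) \<Rightarrow> padic \<Rightarrow> bool" where
  "padic_tendsto p X L \<longleftrightarrow>
     L \<in> carrier (Qp p) \<and> (\<lambda>k. padic_abs p (X k \<ominus>\<^bsub>Qp p\<^esub> L)) \<longlonglongrightarrow> 0"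

definition padic_expansion :: "nat \<Rightarrow> (int \<Rightarrow> nat) \<Rightarrow> padic \<Rightarrow> bool" where
  "padic_expansion p \<epsilon> X \<longleftrightarrow>
     (\<forall>i. \<epsilon> i < p) \<and> (\<exists>N. \<forall>i<N. \<epsilon> i = 0) \<and>
     padic_tendsto p
       (\<lambda>k. padic_of_rat p (\<Sum>i\<in>{- int k..<int k}. of_nat (\<epsilon> i) * of_nat p powi i)) X"

definition padic_frac :: "nat \<Rightarrow> padic \<Rightarrow> rat" where
  "padic_frac p X =
     (let \<epsilon> = (THE \<epsilon>. padic_expansion p \<epsilon> X)
      in \<Sum>i | i < 0 \<and> \<epsilon> i \<noteq> 0. of_nat (\<epsilon> i) * of_nat p powi i)"


section \<open>The group\<close>

definition Z_inverse :: "nat \<Rightarrow> rat set" where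
  "Z_inverse p = {of_int a / of_nat p ^ k | a k. True}"

definition UT :: "nat \<Rightarrow> 'a::comm_ring_1 set \<Rightarrow> 'a mat set" where
  "UT n R = {f \<in> carrier_mat n n. upper_triangular f \<and> (\<forall>i<n. f $$ (i, i) = 1) \<and>
     (\<forall>i<n. \<forall>j<n. f $$ (i, j) \<in> R)}"

definition diag_powers :: "nat \<Rightarrow> nat \<Rightarrow> int vec \<Rightarrow> rat mat" where
  "diag_powers p n x = mat_diag n (\<lambda>i. of_nat p powi (x $ i))"

type_synonym elt = "int vec \<times> rat mat"

text \<open>Here \<open>diag_powers p n (- x)\<close> is the inverse matrix of \<open>diag_powers p n x\<close>.\<close>

definition semidirect :: "nat \<Rightarrow> nat \<Rightarrow> elt monoid" where
  "semidirect p n =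
     \<lparr>carrier = carrier_vec n \<times> UT n (Z_inverse p),
      mult = (\<lambda>(x, f) (y, g). (x + y, f * (diag_powers p n x * g * diag_powers p n (- x)))),
      one = (0\<^sub>v n, 1\<^sub>m n)\<rparr>"

definition word_length :: "('a, 'b) monoid_scheme \<Rightarrow> 'a set \<Rightarrow> 'a \<Rightarrow> nat" where
  "word_length G S g =
     (LEAST k. \<exists>ws. length ws = k \<and> set ws \<subseteq> S \<union> (\<lambda>s. inv\<^bsub>G\<^esub> s) ` S \<and>
        foldr (\<lambda>a b. a \<otimes>\<^bsub>G\<^esub> b) ws \<one>\<^bsub>G\<^esub> = g)"


section \<open>Displacement\<close>

text \<open>
  The group is countable and discrete, so a probability measure on it is a probability mass
  function. Coordinates are numbered from 0 to n - 1.
\<close>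

definition proj_law :: "elt pmf \<Rightarrow> nat \<Rightarrow> int pmf" where
  "proj_law \<mu> i = map_pmf (\<lambda>(x, f). x $ i) \<mu>"

definition m1 :: "int pmf \<Rightarrow> real" where
  "m1 \<nu> = measure_pmf.expectation \<nu> real_of_int"

definition displacement :: "elt pmf \<Rightarrow> nat \<Rightarrow> nat \<Rightarrow> real" where
  "displacement \<mu> i j = m1 (proj_law \<mu> i) - m1 (proj_law \<mu> j)"

definition displacement_nonzero :: "nat \<Rightarrow> elt pmf \<Rightarrow> bool" where
  "displacement_nonzero n \<mu> \<longleftrightarrow> (\<forall>j<n. \<forall>i<j. displacement \<mu> i j \<noteq> 0)"

definition column_consistent :: "nat \<Rightarrow> elt pmf \<Rightarrow> bool" where
  "column_consistent n \<mu> \<longleftrightarrow>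
     (\<forall>j<n. \<forall>i<j. \<forall>i'<j. sgn (displacement \<mu> i j) = sgn (displacement \<mu> i' j))"


section \<open>The boundary\<close>

text \<open>
  A unitriangular matrix with entries in different fields is represented by the family of its
  entries strictly above the diagonal, with \<open>Inl\<close> marking real and \<open>Inr\<close> p-adic entries.
\<close>

type_synonym bdry = "nat \<times> nat \<Rightarrow> real + padic"

definition strict_upper :: "nat \<Rightarrow> (nat \<times> nat) set" where
  "strict_upper n = {(i, j). i < j \<and> j < n}"

definition Gamma_bdry :: "nat \<Rightarrow> nat \<Rightarrow> elt pmf \<Rightarrow> bdry set" where
  "Gamma_bdry p n \<mu> =
     (\<Pi>\<^sub>E (i, j)\<in>strict_upper n.
        if displacement \<mu> i j < 0 then range Inl else Inr ` carrier (Qp p))"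

definition converges_entrywise :: "nat \<Rightarrow> nat \<Rightarrow> elt pmf \<Rightarrow> (nat \<Rightarrow> rat mat) \<Rightarrow> bdry \<Rightarrow> bool" where
  "converges_entrywise p n \<mu> \<phi> b \<longleftrightarrow>
     (\<forall>(i, j)\<in>strict_upper n.
        if displacement \<mu> i j < 0
        then (\<lambda>m. real_of_rat (\<phi> m $$ (i, j))) \<longlonglongrightarrow> projl (b (i, j))
        else padic_tendsto p (\<lambda>m. padic_of_rat p (\<phi> m $$ (i, j))) (projr (b (i, j))))"

definition limit_point :: "nat \<Rightarrow> nat \<Rightarrow> elt pmf \<Rightarrow> (nat \<Rightarrow> rat mat) \<Rightarrow> bdry" where
  "limit_point p n \<mu> \<phi> = (THE b. b \<in> Gamma_bdry p n \<mu> \<and> converges_entrywise p n \<mu> \<phi> b)"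


section \<open>Random walk and approximation\<close>

text \<open>The increments are indexed from 1; \<open>right_walk G \<xi> 0\<close> is the identity.\<close>

primrec right_walk :: "('a, 'b) monoid_scheme \<Rightarrow> (nat \<Rightarrow> 'w \<Rightarrow> 'a) \<Rightarrow> nat \<Rightarrow> 'w \<Rightarrow> 'a" where
  "right_walk G \<xi> 0 \<omega> = \<one>\<^bsub>G\<^esub>"
| "right_walk G \<xi> (Suc m) \<omega> = right_walk G \<xi> m \<omega> \<otimes>\<^bsub>G\<^esub> \<xi> (Suc m) \<omega>"

definition approx_t :: "nat \<Rightarrow> elt pmf \<Rightarrow> nat \<Rightarrow> int vec" where
  "approx_t n \<mu> m = vec n (\<lambda>i. \<lfloor>real m * m1 (proj_law \<mu> i)\<rfloor>)"

definition approx_exponent :: "elt pmf \<Rightarrow> nat \<Rightarrow> nat \<Rightarrow> nat \<Rightarrow> int" where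
  "approx_exponent \<mu> m i j =
     \<lfloor>real m * m1 (proj_law \<mu> i)\<rfloor> - \<lfloor>real m * m1 (proj_law \<mu> j)\<rfloor>"

definition approx_T :: "nat \<Rightarrow> nat \<Rightarrow> elt pmf \<Rightarrow> nat \<Rightarrow> bdry \<Rightarrow> rat mat" where
  "approx_T p n \<mu> m b = mat n n (\<lambda>(i, j).
     let M = approx_exponent \<mu> m i j in
     if i < j then
       if displacement \<mu> i j < 0
       then of_nat p powi M * of_int \<lfloor>real p powi (- M) * projl (b (i, j))\<rfloor>
       else of_nat p powi M *
         padic_frac p (padic_of_rat p (of_nat p powi (- M)) \<otimes>\<^bsub>Qp p\<^esub> projr (b (i, j)))
     else if i = j then 1 else 0)"

definition approx_Pi :: "nat \<Rightarrow> nat \<Rightarrow> elt pmf \<Rightarrow> nat \<Rightarrow> bdry \<Rightarrow> elt" where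
  "approx_Pi p n \<mu> m b = (approx_t n \<mu> m, approx_T p n \<mu> m b)"

end

theory Submission
  imports Defs
begin

text \<open>
  By the triangle inequality the length in question is at most the sum of the lengths of
  \<open>\<Pi>\<^sup>m\<close> and of the \<open>m\<close>-th position of the walk. The latter is at most the sum of the lengths of
  the increments, hence linear by the strong law of large numbers. For the former, a unitriangular
  matrix is a product of elementary matrices carrying its entries, and an entry \<open>a / p\<^sup>K\<close> with
  \<open>\<bar>a\<bar> < p\<^sup>2\<^sup>K\<close> is built in \<open>O(K)\<close> letters by Horner's scheme in base \<open>p\<close>, multiplication by \<open>p\<close>
  being conjugation by an element of \<open>\<int>\<^sup>n\<close>; all entries of the approximation have this form with
  \<open>K = O(m)\<close>.

  For the convergence, the \<open>m\<close>-th increment of the entry \<open>(i, j)\<close> is a sum of terms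
  \<open>\<phi>\<^sub>i\<^sub>k p\<^bsup>y\<^sub>k - y\<^sub>j\<^esup> f\<^sub>k\<^sub>j\<close> with \<open>i \<le> k < j\<close>. By induction on \<open>j\<close> its absolute value is
  \<open>O(p\<^bsup>\<gamma>m\<^esup>)\<close> for every \<open>\<gamma>\<close> exceeding the drifts of \<open>y\<^sub>l - y\<^sub>j\<close> for all \<open>i \<le> l < j\<close> (with opposite sign in
  the p-adic case); column consistency allows a negative \<open>\<gamma>\<close> in the field where the limit is taken.
\<close>

section \<open>The strong law of large numbers\<close>

text \<open>An entry \<open>(i, k)\<close> with \<open>k < j\<close> feeds the entry
  \<open>(i, j)\<close> but need not converge in the same field, since column \<open>k\<close> may
  have the other sign. Additivity of drifts rescues the induction. Write d_l for the drift of y_l.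
  The entry \<open>(i, k)\<close> grows at a rate of at most 0 or some d_l - d_k with
  \<open>i \<le> l < k\<close>, and the factor p^(y_k - y_j) adds d_k - d_j. The total is d_k - d_j
  or d_l - d_j, and column consistency gives these one common sign. Hence growth is controlled for
  arbitrary rates, positive ones included, and through all \<open>l\<close> between \<open>i\<close>
  and \<open>j\<close>. The exponent \<open>2 * K\<close> arises because an entry of the
  approximation has denominator at most \<open>p ^ K\<close> and, for \<open>K\<close> large against
  \<open>m\<close>, real size below \<open>p ^ K\<close>; Horner's scheme sees only the number of
  digits of the numerator. For p-adic entries the denominator bound comes from convergence: one
  power of \<open>p\<close> clears the denominators of the whole sequence, and this passes to the
  limit.\<close>

primrec running_max :: "(nat \<Rightarrow> real) \<Rightarrow> nat \<Rightarrow> real" where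
  "running_max x 0 = 0"
| "running_max x (Suc n) = max (running_max x n) (\<Sum>k<Suc n. x k)"

text \<open>The empty sum counts among the partial sums, so the maximum is either 0 or contains the
  first summand. Peeling off the first summand instead of the last relates the maximum to that of
  the shifted sequence.\<close>

lemma running_max_shift:
  "running_max x (Suc n) = max 0 (x 0 + running_max (\<lambda>k. x (Suc k)) n)"
proof (induction n)
  case (Suc n)
  have "(\<Sum>k<Suc (Suc n). x k) = x 0 + (\<Sum>k<Suc n. x (Suc k))"
    by (rule sum.lessThan_Suc_shift)
  then show ?case
    using Suc by (simp del: sum.lessThan_Suc)
qed auto

lemma running_max_cong:
  "(\<And>k. k < n \<Longrightarrow> x k = y k) \<Longrightarrow> running_max x n = running_max y n"
  by (induction n) (auto intro!: arg_cong2[of _ _ _ _ max] sum.cong)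

lemma running_max_mono: "m \<le> n \<Longrightarrow> running_max x m \<le> running_max x n"
  by (rule lift_Suc_mono_le[of "running_max x"]) auto

lemma sum_le_running_max: "(\<Sum>k<n. x k) \<le> running_max x n"
  by (cases n) auto

lemma running_max_nonneg: "0 \<le> running_max x n"
  using running_max_mono[of 0 n x] by simp

lemma running_max_le: "(\<And>k. k \<le> n \<Longrightarrow> (\<Sum>i<k. x i) \<le> C) \<Longrightarrow> running_max x n \<le> C"
proof (induction n)
  case 0
  from 0[of 0] show ?case by simp
next
  case (Suc n)
  from Suc.prems[of "Suc n"] Suc.IH Suc.prems show ?case by simp
qed

lemma running_max_le_abs_sum: "running_max x n \<le> (\<Sum>k<n. \<bar>x k\<bar>)"
proof (rule running_max_le)
  fix k assume "k \<le> n"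
  have "(\<Sum>i<k. x i) \<le> (\<Sum>i<k. \<bar>x i\<bar>)" by (rule sum_mono) auto
  also have "\<dots> \<le> (\<Sum>i<n. \<bar>x i\<bar>)" using \<open>k \<le> n\<close> by (intro sum_mono2) auto
  finally show "(\<Sum>i<k. x i) \<le> (\<Sum>i<n. \<bar>x i\<bar>)" .
qed

section \<open>Shifts and tail events of i.i.d. sequences\<close>

context prob_space
begin

text \<open>Used with \<open>h = Suc\<close>: for the shifted sequence, and to pass from increments
  numbered from 1 to sequences numbered from 0.\<close>

lemma indep_vars_reindex_inj:
  assumes h: "inj_on h I" and X: "indep_vars M' X (h ` I)"
  shows "indep_vars (\<lambda>i. M' (h i)) (\<lambda>i. X (h i)) I"
  unfolding indep_vars_def2
proof (intro conjI ballI)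
  fix i assume "i \<in> I"
  then show "random_variable (M' (h i)) (X (h i))"
    using X by (auto simp: indep_vars_def2)
next
  let ?F = "\<lambda>i. {X i -` A \<inter> space M | A. A \<in> sets (M' i)}"
  have F: "indep_sets ?F (h ` I)" using X by (auto simp: indep_vars_def2)
  show "indep_sets (\<lambda>i. ?F (h i)) I"
    unfolding indep_sets_def
  proof (intro conjI ballI allI impI)
    fix i assume "i \<in> I"
    then show "?F (h i) \<subseteq> events" using F unfolding indep_sets_def by blast
  next
    fix J A assume J: "J \<subseteq> I" "J \<noteq> {}" "finite J" and A: "A \<in> (\<Pi> j\<in>J. ?F (h j))"
    define A' where "A' = (\<lambda>k. A (inv_into J h k))"
    have hJ: "inj_on h J" using h J(1) inj_on_subset by blast
    have A': "A' (h j) = A j" if "j \<in> J" for j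
      unfolding A'_def using hJ that by (simp add: inv_into_f_f)
    have "prob (\<Inter>k\<in>h ` J. A' k) = (\<Prod>k\<in>h ` J. prob (A' k))"
      by (rule indep_setsD[OF F]) (use J A A' in auto)
    also have "\<dots> = (\<Prod>j\<in>J. prob (A j))"
      using A' by (simp add: prod.reindex[OF hJ] o_def)
    also have "(\<Inter>k\<in>h ` J. A' k) = (\<Inter>j\<in>J. A j)" using A' by auto
    finally show "prob (\<Inter>j\<in>J. A j) = (\<Prod>j\<in>J. prob (A j))" .
  qed
qed

lemma integrable_iid:
  fixes X :: "nat \<Rightarrow> 'a \<Rightarrow> real"
  assumes "indep_vars (\<lambda>_. borel) X UNIV"
    and "\<And>n. distr M borel (X n) = distr M borel (X 0)"
    and "integrable M (X 0)"
  shows "integrable M (X n)"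
proof -
  have [measurable]: "X k \<in> borel_measurable M" for k
    using assms(1) by (auto simp: indep_vars_def2)
  have "integrable (distr M borel (X 0)) (\<lambda>x. x)"
    using assms(3) by (subst integrable_distr_eq) auto
  then have "integrable (distr M borel (X n)) (\<lambda>x. x)"
    using assms(2)[of n] by simp
  then show ?thesis
    by (subst (asm) integrable_distr_eq) auto
qed

text \<open>Independence makes the law of a block the product of its marginals, and these agree, so
  the blocks \<open>X 0, ..., X (n - 1)\<close> and \<open>X 1, ..., X n\<close> have the same joint
  law. The product characterisation is for nonempty index sets, hence \<open>n > 0\<close>.\<close>

lemma iid_shift_expectation:
  fixes X :: "nat \<Rightarrow> 'a \<Rightarrow> real"
  assumes indep: "indep_vars (\<lambda>_. borel) X UNIV"
    and ident: "\<And>n. distr M borel (X n) = distr M borel (X 0)"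
    and meas: "h \<in> borel_measurable (\<Pi>\<^sub>M k\<in>{..<n::nat}. borel)"
    and n: "n > 0"
  shows "expectation (\<lambda>\<omega>. h (\<lambda>k\<in>{..<n}. X (Suc k) \<omega>)) =
    (expectation (\<lambda>\<omega>. h (\<lambda>k\<in>{..<n}. X k \<omega>)) :: real)"
proof -
  have [measurable]: "X k \<in> borel_measurable M" for k
    using indep by (auto simp: indep_vars_def2)
  note [measurable] = meas
  have ne: "{..<n} \<noteq> {}" using n by auto
  have i1: "indep_vars (\<lambda>_. borel) X {..<n}"
    by (rule indep_vars_subset[OF indep]) auto
  have "indep_vars (\<lambda>_. borel) X (Suc ` {..<n})"
    by (rule indep_vars_subset[OF indep]) auto
  then have i2: "indep_vars (\<lambda>_. borel) (\<lambda>k. X (Suc k)) {..<n}"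
    by (rule indep_vars_reindex_inj[where h = Suc, rotated]) auto
  have d1: "distr M (\<Pi>\<^sub>M k\<in>{..<n}. borel) (\<lambda>\<omega>. \<lambda>k\<in>{..<n}. X k \<omega>)
      = (\<Pi>\<^sub>M k\<in>{..<n}. distr M borel (X k))"
    using i1 ne by (subst (asm) indep_vars_iff_distr_eq_PiM') auto
  have d2: "distr M (\<Pi>\<^sub>M k\<in>{..<n}. borel) (\<lambda>\<omega>. \<lambda>k\<in>{..<n}. X (Suc k) \<omega>)
      = (\<Pi>\<^sub>M k\<in>{..<n}. distr M borel (X (Suc k)))"
    using i2 ne by (subst (asm) indep_vars_iff_distr_eq_PiM') auto
  have "(\<Pi>\<^sub>M k\<in>{..<n}. distr M borel (X (Suc k))) = (\<Pi>\<^sub>M k\<in>{..<n}. distr M borel (X k))"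
  proof (rule PiM_cong)
    fix k show "distr M borel (X (Suc k)) = distr M borel (X k)"
      using ident[of "Suc k"] ident[of k] by simp
  qed auto
  then have eq: "distr M (\<Pi>\<^sub>M k\<in>{..<n}. borel) (\<lambda>\<omega>. \<lambda>k\<in>{..<n}. X (Suc k) \<omega>)
     = distr M (\<Pi>\<^sub>M k\<in>{..<n}. borel) (\<lambda>\<omega>. \<lambda>k\<in>{..<n}. X k \<omega>)"
    using d1 d2 by simp
  have "expectation (\<lambda>\<omega>. h (\<lambda>k\<in>{..<n}. X (Suc k) \<omega>))
      = (\<integral>x. h x \<partial>distr M (\<Pi>\<^sub>M k\<in>{..<n}. borel) (\<lambda>\<omega>. \<lambda>k\<in>{..<n}. X (Suc k) \<omega>))"
    by (subst integral_distr) auto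
  also have "\<dots> = expectation (\<lambda>\<omega>. h (\<lambda>k\<in>{..<n}. X k \<omega>))"
    unfolding eq by (subst integral_distr) auto
  finally show ?thesis .
qed

lemma running_max_measurable:
  assumes "n \<le> N"
  shows "(\<lambda>x. running_max x n) \<in> borel_measurable (\<Pi>\<^sub>M k\<in>{..<N}. borel)"
  using assms
proof (induction n)
  case (Suc n)
  have "(\<lambda>x. (\<Sum>k<Suc n. x k) :: real) \<in> borel_measurable (\<Pi>\<^sub>M k\<in>{..<N}. borel)"
    using Suc.prems by (intro borel_measurable_sum measurable_component_singleton) auto
  with Suc show ?case by (auto intro: borel_measurable_max simp del: sum.lessThan_Suc)
qed simp

text \<open>Dropping the first \<open>N\<close> summands changes all later partial sums by the same
  finite amount, so unboundedness is a tail event. Natural bounds \<open>C\<close> keep the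
  quantifiers countable, as measurability asks.\<close>

lemma unbounded_sums_0_1:
  fixes X :: "nat \<Rightarrow> 'a \<Rightarrow> real"
  assumes indep: "indep_vars (\<lambda>_. borel) X UNIV"
  defines "U \<equiv> {\<omega>\<in>space M. \<forall>C::nat. \<exists>n. (\<Sum>k<n. X k \<omega>) > real C}"
  shows "prob U = 0 \<or> prob U = 1"
proof -
  define A where "A i = sigma_sets (space M) {X i -` B \<inter> space M | B. B \<in> sets borel}" for i
  have A_sub: "A i \<subseteq> Pow (space M)" for i
    unfolding A_def using sigma_sets_into_sp[of "{X i -` B \<inter> space M | B. B \<in> sets borel}" "space M"]
    by blast
  have "U \<in> tail_events A"
    unfolding tail_events_def
  proof
    fix N :: nat
    let ?F = "sigma (space M) (\<Union> (A ` {N..}))"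
    have F: "(\<Union> (A ` {N..})) \<subseteq> Pow (space M)" using A_sub by blast
    have [measurable]: "X (N + k) \<in> borel_measurable ?F" for k
    proof (rule measurableI)
      fix B :: "real set" assume "B \<in> sets borel"
      then have "X (N + k) -` B \<inter> space M \<in> A (N + k)"
        unfolding A_def by (intro sigma_sets.Basic) auto
      then show "X (N + k) -` B \<inter> space ?F \<in> sets ?F"
        using F by (auto intro!: sigma_sets.Basic bexI[of _ "N + k"]
            simp: sets_measure_of space_measure_of)
    qed auto
    have "{\<omega>\<in>space ?F. \<forall>C::nat. \<exists>n. (\<Sum>k<n. X (N + k) \<omega>) > real C} \<in> sets ?F"
      by measurable
    moreover have "{\<omega>\<in>space ?F. \<forall>C::nat. \<exists>n. (\<Sum>k<n. X (N + k) \<omega>) > real C} = U"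
    proof -
      have sp: "(\<Sum>k<N + n. X k \<omega>) = (\<Sum>k<N. X k \<omega>) + (\<Sum>k<n. X (N + k) \<omega>)" for n \<omega>
        by (induction n) auto
      have "(\<forall>C::nat. \<exists>n. (\<Sum>k<n. X (N + k) \<omega>) > real C) \<longleftrightarrow>
        (\<forall>C::nat. \<exists>n. (\<Sum>k<n. X k \<omega>) > real C)" for \<omega>
      proof safe
        fix C :: nat assume a: "\<forall>C::nat. \<exists>n. (\<Sum>k<n. X (N + k) \<omega>) > real C"
        obtain C' :: nat where "real C - (\<Sum>k<N. X k \<omega>) \<le> real C'"
          using real_arch_simple by blast
        moreover obtain n where "(\<Sum>k<n. X (N + k) \<omega>) > real C'" using a by blast
        ultimately have "(\<Sum>k<N + n. X k \<omega>) > real C" unfolding sp by linarith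
        then show "\<exists>n. (\<Sum>k<n. X k \<omega>) > real C" by blast
      next
        fix C :: nat assume a: "\<forall>C::nat. \<exists>n. (\<Sum>k<n. X k \<omega>) > real C"
        obtain C' :: nat where C': "real C + (\<Sum>k<N. \<bar>X k \<omega>\<bar>) \<le> real C'"
          using real_arch_simple by blast
        obtain n where n: "(\<Sum>k<n. X k \<omega>) > real C'" using a by blast
        have s: "(\<Sum>k<N. X k \<omega>) \<le> (\<Sum>k<N. \<bar>X k \<omega>\<bar>)" by (rule sum_mono) auto
        \<comment> \<open>\<open>C'\<close> bounds every sum of at most \<open>N\<close> summands,
          so an index whose sum exceeds \<open>C'\<close> lies past the discarded block.\<close>
        have "n > N"
        proof (rule ccontr)
          assume "\<not> n > N"
          then have "(\<Sum>k<n. \<bar>X k \<omega>\<bar>) \<le> (\<Sum>k<N. \<bar>X k \<omega>\<bar>)" by (intro sum_mono2) auto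
          moreover have "(\<Sum>k<n. X k \<omega>) \<le> (\<Sum>k<n. \<bar>X k \<omega>\<bar>)" by (rule sum_mono) auto
          ultimately show False using n C' by linarith
        qed
        then have "(\<Sum>k<n. X k \<omega>) = (\<Sum>k<N. X k \<omega>) + (\<Sum>k<n - N. X (N + k) \<omega>)"
          using sp[of \<omega> "n - N"] by simp
        then have "(\<Sum>k<n - N. X (N + k) \<omega>) > real C" using s n C' by linarith
        then show "\<exists>n. (\<Sum>k<n. X (N + k) \<omega>) > real C" by blast
      qed
      then show ?thesis unfolding U_def by (simp add: space_measure_of_conv)
    qed
    ultimately show "U \<in> sigma_sets (space M) (\<Union> (A ` {N..}))"
      using F by (simp add: sets_measure_of)
  qed
  moreover have "indep_sets A UNIV"
    using indep unfolding indep_vars_def A_def by auto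
  moreover have "sigma_algebra (space M) (A i)" for i
    unfolding A_def by (rule sigma_algebra_sigma_sets) auto
  ultimately show ?thesis using kolmogorov_0_1_law by blast
qed

text \<open>
  If the walk were unbounded above, hence almost surely so by the zero-one law, then the
  stationarity of the running maxima \<open>M\<^sub>n\<close> together with \<open>M\<^sub>n\<^sub>+\<^sub>1 = max 0 (X\<^sub>0 + M'\<^sub>n)\<close> would give
  \<open>0 \<le> E (M\<^sub>n\<^sub>+\<^sub>1 - M'\<^sub>n) = E (max X\<^sub>0 (- M'\<^sub>n)) \<longrightarrow> E X\<^sub>0\<close>.
\<close>

lemma iid_sums_bounded_above:
  fixes X :: "nat \<Rightarrow> 'a \<Rightarrow> real"
  assumes indep: "indep_vars (\<lambda>_. borel) X UNIV"
    and ident: "\<And>n. distr M borel (X n) = distr M borel (X 0)"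
    and int: "integrable M (X 0)"
    and neg: "expectation (X 0) < 0"
  shows "AE \<omega> in M. \<exists>C. \<forall>n. (\<Sum>k<n. X k \<omega>) \<le> C"
proof -
  define U where "U = {\<omega>\<in>space M. \<forall>C::nat. \<exists>n. (\<Sum>k<n. X k \<omega>) > real C}"
  have meas[measurable]: "X k \<in> borel_measurable M" for k
    using indep by (auto simp: indep_vars_def2)
  have U_sets[measurable]: "U \<in> sets M" unfolding U_def by measurable
  have "prob U \<noteq> 1"
  proof
    assume "prob U = 1"
    then have AE_U: "AE \<omega> in M. \<omega> \<in> U" by (simp add: AE_in_set_eq_1)
    define M1 where "M1 n \<omega> = running_max (\<lambda>k. X k \<omega>) n" for n \<omega>
    define M2 where "M2 n \<omega> = running_max (\<lambda>k. X (Suc k) \<omega>) n" for n \<omega>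
    have M1_meas[measurable]: "M1 n \<in> borel_measurable M" for n
      unfolding M1_def by (induction n) (simp_all del: sum.lessThan_Suc)
    have M2_meas[measurable]: "M2 n \<in> borel_measurable M" for n
      unfolding M2_def by (induction n) (simp_all del: sum.lessThan_Suc)
    have intX: "integrable M (X k)" for k by (rule integrable_iid[OF indep ident int])
    have M1_int: "integrable M (M1 n)" for n
    proof (rule Bochner_Integration.integrable_bound)
      show "integrable M (\<lambda>\<omega>. \<Sum>k<n. \<bar>X k \<omega>\<bar>)" using intX by auto
      show "AE \<omega> in M. norm (M1 n \<omega>) \<le> norm (\<Sum>k<n. \<bar>X k \<omega>\<bar>)"
        unfolding M1_def using running_max_nonneg running_max_le_abs_sum
        by (auto intro!: AE_I2 order_trans[OF running_max_le_abs_sum])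
    qed auto
    have M2_int: "integrable M (M2 n)" for n
    proof (rule Bochner_Integration.integrable_bound)
      show "integrable M (\<lambda>\<omega>. \<Sum>k<n. \<bar>X (Suc k) \<omega>\<bar>)" using intX by auto
      show "AE \<omega> in M. norm (M2 n \<omega>) \<le> norm (\<Sum>k<n. \<bar>X (Suc k) \<omega>\<bar>)"
        unfolding M2_def using running_max_nonneg running_max_le_abs_sum
        by (auto intro!: AE_I2 order_trans[OF running_max_le_abs_sum])
    qed auto
    have E_eq: "expectation (M2 n) = expectation (M1 n)" for n
    proof (cases "n = 0")
      case False
      have "M2 n \<omega> = running_max (\<lambda>k\<in>{..<n}. X (Suc k) \<omega>) n" for \<omega>
        unfolding M2_def by (rule running_max_cong) auto
      moreover have "M1 n \<omega> = running_max (\<lambda>k\<in>{..<n}. X k \<omega>) n" for \<omega>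
        unfolding M1_def by (rule running_max_cong) auto
      ultimately have "M2 n = (\<lambda>\<omega>. running_max (\<lambda>k\<in>{..<n}. X (Suc k) \<omega>) n)"
        "M1 n = (\<lambda>\<omega>. running_max (\<lambda>k\<in>{..<n}. X k \<omega>) n)" by auto
      then show ?thesis
        using iid_shift_expectation[OF indep ident running_max_measurable[OF order_refl], of n] False
        by simp
    qed (simp add: M1_def[abs_def] M2_def[abs_def])
    have E_nonneg: "0 \<le> expectation (\<lambda>\<omega>. max (X 0 \<omega>) (- M2 n \<omega>))" for n
    proof -
      have "max (X 0 \<omega>) (- M2 n \<omega>) = M1 (Suc n) \<omega> - M2 n \<omega>" for \<omega>
        unfolding M1_def running_max_shift M2_def by (auto simp: max_def)
      then have "expectation (\<lambda>\<omega>. max (X 0 \<omega>) (- M2 n \<omega>)) = expectation (M1 (Suc n)) - expectation (M2 n)"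
        using M1_int M2_int by simp
      also have "\<dots> = expectation (M1 (Suc n)) - expectation (M1 n)" by (simp add: E_eq)
      also have "\<dots> \<ge> 0"
        using integral_mono[OF M1_int[of n] M1_int[of "Suc n"]]
        unfolding M1_def using running_max_mono[of n "Suc n"] by fastforce
      finally show ?thesis .
    qed
    have "(\<lambda>n. expectation (\<lambda>\<omega>. max (X 0 \<omega>) (- M2 n \<omega>))) \<longlonglongrightarrow> expectation (X 0)"
    proof (rule integral_dominated_convergence[where w = "\<lambda>\<omega>. \<bar>X 0 \<omega>\<bar>"])
      show "AE \<omega> in M. (\<lambda>n. max (X 0 \<omega>) (- M2 n \<omega>)) \<longlonglongrightarrow> X 0 \<omega>"
        using AE_U
      proof eventually_elim
        case (elim \<omega>)
        \<comment> \<open>Twice \<open>\<bar>X 0 \<omega>\<bar>\<close>, because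
          \<open>X 0 \<omega> + M2 m \<omega> > C\<close> then leaves \<open>M2 m \<omega>\<close>
          above \<open>\<bar>X 0 \<omega>\<bar>\<close>; from there on the maximum is
          \<open>X 0 \<omega>\<close> itself.\<close>
        obtain C :: nat where C: "\<bar>X 0 \<omega>\<bar> + \<bar>X 0 \<omega>\<bar> \<le> real C" using real_arch_simple by blast
        obtain n where n: "(\<Sum>k<n. X k \<omega>) > real C" using elim unfolding U_def by blast
        then have "n \<noteq> 0" by (intro notI) simp
        then obtain m where m: "n = Suc m" by (cases n) auto
        have "real C < M1 (Suc m) \<omega>"
          using n sum_le_running_max[of "\<lambda>k. X k \<omega>" n] unfolding M1_def m by linarith
        also have "M1 (Suc m) \<omega> = max 0 (X 0 \<omega> + M2 m \<omega>)"
          unfolding M1_def M2_def by (rule running_max_shift)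
        finally have "\<bar>X 0 \<omega>\<bar> \<le> M2 m \<omega>" using C by linarith
        then have "\<bar>X 0 \<omega>\<bar> \<le> M2 k \<omega>" if "k \<ge> m" for k
          using running_max_mono[OF that, of "\<lambda>k. X (Suc k) \<omega>"] unfolding M2_def by linarith
        then have "max (X 0 \<omega>) (- M2 k \<omega>) = X 0 \<omega>" if "k \<ge> m" for k
          using that by (force simp: max_def)
        then show ?case
          by (intro tendsto_eventually) (auto simp: eventually_sequentially)
      qed
      \<comment> \<open>Since \<open>M2 n\<close> is nonnegative, the maximum lies between
        \<open>X 0\<close> and its positive part.\<close>
      show "AE \<omega> in M. norm (max (X 0 \<omega>) (- M2 n \<omega>)) \<le> \<bar>X 0 \<omega>\<bar>" for n
      proof (rule AE_I2)
        fix \<omega>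
        show "norm (max (X 0 \<omega>) (- M2 n \<omega>)) \<le> \<bar>X 0 \<omega>\<bar>"
          using running_max_nonneg[of "\<lambda>k. X (Suc k) \<omega>" n] unfolding M2_def
          by (auto simp: max_def abs_if)
      qed
    qed (use int in auto)
    then have "0 \<le> expectation (X 0)"
      by (rule LIMSEQ_le_const) (use E_nonneg in auto)
    with neg show False by simp
  qed
  with unbounded_sums_0_1[OF indep] have "prob U = 0" unfolding U_def by blast
  then have "U \<in> null_sets M" by (simp add: emeasure_eq_measure null_setsI)
  then show ?thesis
    by (rule AE_I') (force simp: U_def not_le)
qed

lemma iid_transform:
  fixes f :: "real \<Rightarrow> real" and X :: "nat \<Rightarrow> 'a \<Rightarrow> real"
  assumes indep: "indep_vars (\<lambda>_. borel) X UNIV"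
    and ident: "\<And>n. distr M borel (X n) = distr M borel (X 0)"
    and [measurable]: "f \<in> borel_measurable borel"
  shows "indep_vars (\<lambda>_. borel) (\<lambda>n \<omega>. f (X n \<omega>)) UNIV"
    and "distr M borel (\<lambda>\<omega>. f (X n \<omega>)) = distr M borel (\<lambda>\<omega>. f (X 0 \<omega>))"
proof -
  show "indep_vars (\<lambda>_. borel) (\<lambda>n \<omega>. f (X n \<omega>)) UNIV"
    by (rule indep_vars_compose2[OF indep]) auto
  have [measurable]: "X k \<in> borel_measurable M" for k
    using indep by (auto simp: indep_vars_def2)
  have "distr M borel (\<lambda>\<omega>. f (X k \<omega>)) = distr (distr M borel (X k)) borel f" for k
    by (subst distr_distr) (auto simp: o_def)
  then show "distr M borel (\<lambda>\<omega>. f (X n \<omega>)) = distr M borel (\<lambda>\<omega>. f (X 0 \<omega>))"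
    using ident[of n] by simp
qed

text \<open>Half of \<open>e\<close> makes the mean of the centred variables negative, so their sums
  stay below some \<open>C\<close>; the other half absorbs \<open>C\<close> for large
  \<open>n\<close>.\<close>

lemma iid_mean_upper:
  fixes X :: "nat \<Rightarrow> 'a \<Rightarrow> real"
  assumes indep: "indep_vars (\<lambda>_. borel) X UNIV"
    and ident: "\<And>n. distr M borel (X n) = distr M borel (X 0)"
    and int: "integrable M (X 0)"
    and e: "0 < e"
  shows "AE \<omega> in M. eventually (\<lambda>n. (\<Sum>k<n. X k \<omega>) \<le> (expectation (X 0) + e) * real n) sequentially"
proof -
  define m where "m = expectation (X 0) + e / 2"
  have "AE \<omega> in M. \<exists>C. \<forall>n. (\<Sum>k<n. X k \<omega> - m) \<le> C"
  proof (rule iid_sums_bounded_above)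
    show "expectation (\<lambda>\<omega>. X 0 \<omega> - m) < 0"
      using int e unfolding m_def by (simp add: prob_space)
  qed (use iid_transform[OF indep ident, of "\<lambda>x. x - m"] int in auto)
  then show ?thesis
  proof eventually_elim
    case (elim \<omega>)
    then obtain C where C: "\<And>n. (\<Sum>k<n. X k \<omega> - m) \<le> C" by blast
    obtain N :: nat where N: "2 * C / e \<le> real N" using real_arch_simple by blast
    have "(\<Sum>k<n. X k \<omega>) \<le> (expectation (X 0) + e) * real n" if "n \<ge> N" for n
    proof -
      have "2 * C / e \<le> real n" using N that by linarith
      then have "C \<le> e / 2 * real n" using e by (simp add: field_simps)
      then show ?thesis using C[of n] unfolding m_def by (simp add: sum_subtractf algebra_simps)
    qed
    then show ?case by (auto simp: eventually_sequentially)
  qed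
qed

text \<open>The one-sided bound is applied to \<open>X\<close> and to \<open>- X\<close>. Only the
  countably many tolerances \<open>1 / (j + 1)\<close> enter, so the exceptional null sets can be
  united.\<close>

theorem strong_law_of_large_numbers:
  fixes X :: "nat \<Rightarrow> 'a \<Rightarrow> real"
  assumes indep: "indep_vars (\<lambda>_. borel) X UNIV"
    and ident: "\<And>n. distr M borel (X n) = distr M borel (X 0)"
    and int: "integrable M (X 0)"
  shows "AE \<omega> in M. \<forall>e>0. eventually (\<lambda>n. \<bar>(\<Sum>k<n. X k \<omega>) - expectation (X 0) * real n\<bar> \<le> e * real n) sequentially"
proof -
  let ?e = "\<lambda>j::nat. 1 / real (Suc j)"
  have "AE \<omega> in M. \<forall>j. eventually (\<lambda>n. (\<Sum>k<n. X k \<omega>) \<le> (expectation (X 0) + ?e j) * real n) sequentially"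
    unfolding AE_all_countable using iid_mean_upper[OF indep ident int] by simp
  moreover have "AE \<omega> in M. \<forall>j. eventually (\<lambda>n. (\<Sum>k<n. - X k \<omega>) \<le> (expectation (\<lambda>\<omega>. - X 0 \<omega>) + ?e j) * real n) sequentially"
    unfolding AE_all_countable
    by (intro allI iid_mean_upper) (use iid_transform[OF indep ident, of uminus] int in auto)
  ultimately show ?thesis
  proof eventually_elim
    case (elim \<omega>)
    show ?case
    proof (intro allI impI)
      fix e :: real assume "e > 0"
      then obtain j where j: "?e j < e" using nat_approx_posE by blast
      have "eventually (\<lambda>n. (\<Sum>k<n. X k \<omega>) \<le> (expectation (X 0) + ?e j) * real n) sequentially"
        "eventually (\<lambda>n. (\<Sum>k<n. - X k \<omega>) \<le> (expectation (\<lambda>\<omega>. - X 0 \<omega>) + ?e j) * real n) sequentially"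
        using elim by blast+
      then show "eventually (\<lambda>n. \<bar>(\<Sum>k<n. X k \<omega>) - expectation (X 0) * real n\<bar> \<le> e * real n) sequentially"
      proof eventually_elim
        case (elim n)
        have "?e j * real n \<le> e * real n" using j by (intro mult_right_mono) auto
        moreover have "expectation (\<lambda>\<omega>. - X 0 \<omega>) = - expectation (X 0)" by simp
        ultimately show ?case using elim
          by (simp add: sum_negf abs_le_iff algebra_simps)
      qed
    qed
  qed
qed

end

section \<open>The p-adic absolute value on the rationals\<close>

text \<open>The definition looks at the reduced fraction; cross-multiplication and additivity of
  multiplicities show that any representation will do.\<close>

lemma padic_val_rat_Fract:
  assumes p: "prime p" and a: "a \<noteq> 0" and b: "b \<noteq> 0"
  shows "padic_val_rat p (Fract a b) = int (multiplicity (int p) a) - int (multiplicity (int p) b)"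
proof -
  obtain c d where q: "quotient_of (Fract a b) = (c, d)" by (cases "quotient_of (Fract a b)")
  have d: "d > 0" using q quotient_of_denom_pos by blast
  have eq: "Fract a b = Fract c d" using quotient_of_div[OF q] by (simp add: Fract_of_int_quotient)
  have "c * b = a * d" using eq b d by (simp add: eq_rat)
  moreover have "c \<noteq> 0" using \<open>c * b = a * d\<close> a d by auto
  moreover have pp: "prime_elem (int p)" using p by simp
  ultimately have "multiplicity (int p) c + multiplicity (int p) b = multiplicity (int p) a + multiplicity (int p) d"
    using prime_elem_multiplicity_mult_distrib[OF pp] a b d by (metis less_irrefl)
  then show ?thesis unfolding padic_val_rat_def q by simp
qed

locale padic_prime =
  fixes p :: nat
  assumes prime_p: "prime p"
begin

abbreviation "v \<equiv> padic_abs_rat p"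

lemma p_gt_1: "1 < p" using prime_p prime_gt_1_nat by blast
lemma real_p_gt_1: "1 < real p" using p_gt_1 by simp
lemma p_pos[simp]: "0 < p" using p_gt_1 by simp
lemma p_ne_0[simp]: "p \<noteq> 0" using p_gt_1 by simp

lemma v_0[simp]: "v 0 = 0" by (simp add: padic_abs_rat_def)

lemma v_Fract:
  "a \<noteq> 0 \<Longrightarrow> b \<noteq> 0 \<Longrightarrow> v (Fract a b) = real p powi (int (multiplicity (int p) b) - int (multiplicity (int p) a))"
  using padic_val_rat_Fract[OF prime_p, of a b] Fract_of_int_quotient[of a b]
  by (auto simp: padic_abs_rat_def)

lemma v_of_int: "a \<noteq> 0 \<Longrightarrow> v (of_int a) = 1 / real p ^ multiplicity (int p) a"
  using v_Fract[of a 1] by (simp add: of_int_rat power_int_minus divide_inverse)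

lemma v_mult: "v (x * y) = v x * v y"
proof (cases "x = 0 \<or> y = 0")
  case False
  obtain a b where x: "x = Fract a b" "b > 0" by (cases x)
  obtain c d where y: "y = Fract c d" "d > 0" by (cases y)
  have nz: "a \<noteq> 0" "c \<noteq> 0" using False x y by (auto simp: rat_number_collapse)
  have pp: "prime_elem (int p)" using prime_p by simp
  have "v (Fract (a * c) (b * d)) = v (Fract a b) * v (Fract c d)"
    using nz x y real_p_gt_1
    by (simp add: v_Fract prime_elem_multiplicity_mult_distrib[OF pp] add_diff_add power_int_add)
  then show ?thesis using x y by simp
qed auto

lemma v_nonneg[simp]: "0 \<le> v x"
  unfolding padic_abs_rat_def by simp

lemma v_1[simp]: "v 1 = 1" using v_of_int[of 1] by simp

lemma v_eq_0[simp]: "v x = 0 \<longleftrightarrow> x = 0"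
  unfolding padic_abs_rat_def by simp

lemma v_p: "v (of_nat p) = 1 / real p"
  using v_of_int[of "int p"] p_gt_1 multiplicity_self[of "int p"] by (simp add: zdvd1_eq)

lemma v_power: "v (x ^ k) = v x ^ k"
  by (induction k) (auto simp: v_mult)

lemma v_inverse: "v (inverse x) = inverse (v x)"
proof (cases "x = 0")
  case False
  then have "v x * v (inverse x) = 1" by (simp flip: v_mult)
  then show ?thesis by (simp add: inverse_unique)
qed simp

lemma v_powi: "v (of_nat p powi k) = real p powi (- k)"
proof -
  have 1: "v (of_nat p ^ n) = inverse (real p ^ n)" for n
    by (simp add: v_power v_p power_one_over divide_inverse power_inverse)
  show ?thesis
    using 1[of "nat k"] 1[of "nat (- k)"]
    by (cases "k \<ge> 0") (auto simp: power_int_def v_inverse v_power power_inverse)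
qed

lemma v_minus: "v (- x) = v x"
proof -
  have "v (- 1) = 1" using v_of_int[of "- 1"] by (simp add: multiplicity_unit_right)
  then show ?thesis using v_mult[of "- 1" x] by simp
qed

lemma v_minus_commute: "v (x - y) = v (y - x)"
  using v_minus[of "x - y"] by simp

text \<open>The dictionary between p-adic smallness and divisibility, on which the arguments about
  digits and denominators rest.\<close>

lemma v_of_int_le: "v (of_int a) \<le> 1 / real p ^ k \<longleftrightarrow> int p ^ k dvd a"
proof (cases "a = 0")
  case False
  have "int p ^ k dvd a \<longleftrightarrow> k \<le> multiplicity (int p) a"
    using False p_gt_1 by (subst power_dvd_iff_le_multiplicity) (auto simp: zdvd1_eq)
  also have "\<dots> \<longleftrightarrow> real p ^ k \<le> real p ^ multiplicity (int p) a"
    using p_gt_1 by (simp add: power_increasing_iff)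
  also have "\<dots> \<longleftrightarrow> v (of_int a) \<le> 1 / real p ^ k"
    using False by (simp add: v_of_int field_simps)
  finally show ?thesis ..
qed simp

text \<open>For integers, \<open>p\<close> to the smaller of the two multiplicities divides the sum.
  Rationals are reduced to this by multiplying with a common denominator, which scales both sides by
  the same factor.\<close>

lemma v_add_le_max: "v (x + y) \<le> max (v x) (v y)"
proof -
  have int: "v (of_int (a + b)) \<le> max (v (of_int a)) (v (of_int b))" for a b
  proof (cases "a = 0 \<or> b = 0")
    case False
    have le: "v (of_int (a + b)) \<le> max (v (of_int a)) (v (of_int b))"
      if ab: "a \<noteq> 0" "b \<noteq> 0" and le: "multiplicity (int p) a \<le> multiplicity (int p) b" for a b
    proof -
      let ?k = "multiplicity (int p) a"
      have "int p ^ ?k dvd a" by (rule multiplicity_dvd)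
      moreover have "int p ^ ?k dvd b" using le multiplicity_dvd' by blast
      ultimately have "v (of_int (a + b)) \<le> 1 / real p ^ ?k"
        unfolding v_of_int_le by simp
      also have "\<dots> = v (of_int a)" using ab by (simp add: v_of_int)
      finally show ?thesis by simp
    qed
    show ?thesis
      using False le[of a b] le[of b a] by (cases "multiplicity (int p) a \<le> multiplicity (int p) b")
        (auto simp: add.commute max.commute)
  qed auto
  obtain a b where x: "x = Fract a b" "b > 0" by (cases x)
  obtain c d where y: "y = Fract c d" "d > 0" by (cases y)
  let ?n = "of_int (b * d) :: rat"
  have n: "?n \<noteq> 0" using x y by simp
  have "x * ?n = of_int (a * d)" "y * ?n = of_int (c * b)"
    using x y by (auto simp: Fract_of_int_quotient)
  then have "v ((x + y) * ?n) \<le> max (v (x * ?n)) (v (y * ?n))"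
    using int[of "a * d" "c * b"] by (simp only: distrib_right of_int_add)
  then have "v (x + y) * v ?n \<le> max (v x) (v y) * v ?n"
    unfolding v_mult by (simp add: max_mult_distrib_right)
  moreover have "v ?n > 0" using n by (metis v_eq_0 v_nonneg order_le_less)
  ultimately show ?thesis by simp
qed

lemma v_add: "v (x + y) \<le> v x + v y"
  using v_add_le_max[of x y] v_nonneg[of x] v_nonneg[of y] by linarith

lemma v_triangle: "v (x - z) \<le> v (x - y) + v (y - z)"
  using v_add[of "x - y" "y - z"] by simp

lemma v_diff: "v (x - y) \<le> v x + v y"
  using v_add[of x "- y"] by (simp add: v_minus)

lemma v_abs_diff: "\<bar>v x - v y\<bar> \<le> v (x - y)"
  using v_add[of "x - y" y] v_add[of "y - x" x] v_minus_commute[of x y] by auto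

section \<open>Cauchy sequences and null sequences\<close>

abbreviation "R \<equiv> padic_cauchy_ring p"
abbreviation "N \<equiv> padic_null p"

lemma cauchyD: "x \<in> padic_cauchy p \<Longrightarrow> e > 0 \<Longrightarrow> \<exists>M. \<forall>k\<ge>M. \<forall>l\<ge>M. v (x k - x l) < e"
  unfolding padic_cauchy_def by blast

lemma const_cauchy: "(\<lambda>_. q) \<in> padic_cauchy p"
  unfolding padic_cauchy_def by simp

lemma cauchy_bounded:
  assumes "x \<in> padic_cauchy p" obtains C where "C > 0" "\<And>k. v (x k) \<le> C"
proof -
  obtain M where M: "\<And>k l. k \<ge> M \<Longrightarrow> l \<ge> M \<Longrightarrow> v (x k - x l) < 1"
    using cauchyD[OF assms, of 1] by auto
  have "v (x k) \<le> (\<Sum>l\<le>M. v (x l)) + 1" for k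
  proof (cases "k \<le> M")
    case True
    have "v (x k) \<le> (\<Sum>l\<le>M. v (x l))"
      using True by (intro member_le_sum) auto
    then show ?thesis by simp
  next
    case False
    have "v (x k) \<le> v (x k - x M) + v (x M)" using v_add[of "x k - x M" "x M"] by simp
    also have "v (x M) \<le> (\<Sum>l\<le>M. v (x l))" by (intro member_le_sum) auto
    also have "v (x k - x M) < 1" using M[of k M] False by simp
    finally show ?thesis by simp
  qed
  moreover have "(\<Sum>l\<le>M. v (x l)) + 1 > 0" by (intro add_nonneg_pos sum_nonneg) auto
  ultimately show ?thesis using that by blast
qed

lemma cauchy_add:
  assumes "x \<in> padic_cauchy p" "y \<in> padic_cauchy p"
  shows "(\<lambda>k. x k + y k) \<in> padic_cauchy p"
  unfolding padic_cauchy_def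
proof (intro CollectI allI impI)
  fix e :: real assume "e > 0"
  then obtain M1 M2 where
    "\<forall>k\<ge>M1. \<forall>l\<ge>M1. v (x k - x l) < e / 2" "\<forall>k\<ge>M2. \<forall>l\<ge>M2. v (y k - y l) < e / 2"
    using cauchyD[OF assms(1), of "e / 2"] cauchyD[OF assms(2), of "e / 2"] by auto
  then have "v (x k - x l) + v (y k - y l) < e / 2 + e / 2" if "k \<ge> max M1 M2" "l \<ge> max M1 M2" for k l
    using that by (intro add_strict_mono) auto
  moreover have "v (x k + y k - (x l + y l)) \<le> v (x k - x l) + v (y k - y l)" for k l
    using v_add[of "x k - x l" "y k - y l"] by (simp add: algebra_simps)
  ultimately have "v (x k + y k - (x l + y l)) < e" if "k \<ge> max M1 M2" "l \<ge> max M1 M2" for k l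
    using that by (metis field_sum_of_halves order_le_less_trans)
  then show "\<exists>M. \<forall>k\<ge>M. \<forall>l\<ge>M. v (x k + y k - (x l + y l)) < e" by blast
qed

lemma cauchy_mult:
  assumes "x \<in> padic_cauchy p" "y \<in> padic_cauchy p"
  shows "(\<lambda>k. x k * y k) \<in> padic_cauchy p"
  unfolding padic_cauchy_def
proof (intro CollectI allI impI)
  obtain C where C: "C > 0" "\<And>k. v (x k) \<le> C" using cauchy_bounded[OF assms(1)] by blast
  obtain D where D: "D > 0" "\<And>k. v (y k) \<le> D" using cauchy_bounded[OF assms(2)] by blast
  fix e :: real assume e: "e > 0"
  obtain M1 M2 where M: "\<forall>k\<ge>M1. \<forall>l\<ge>M1. v (x k - x l) < e / (2 * D)"
    "\<forall>k\<ge>M2. \<forall>l\<ge>M2. v (y k - y l) < e / (2 * C)"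
    using cauchyD[OF assms(1), of "e / (2 * D)"] cauchyD[OF assms(2), of "e / (2 * C)"] e C D by auto
  have "v (x k * y k - x l * y l) < e" if "k \<ge> max M1 M2" "l \<ge> max M1 M2" for k l
  proof -
    have "x k * y k - x l * y l = x k * (y k - y l) + (x k - x l) * y l" by (simp add: algebra_simps)
    then have "v (x k * y k - x l * y l) \<le> v (x k) * v (y k - y l) + v (x k - x l) * v (y l)"
      using v_add by (metis v_mult)
    also have "\<dots> \<le> C * v (y k - y l) + v (x k - x l) * D"
      using C D by (intro add_mono mult_mono) (auto intro: less_imp_le)
    also have "\<dots> < C * (e / (2 * C)) + e / (2 * D) * D"
      using M that C D by (intro add_strict_mono mult_strict_left_mono mult_strict_right_mono) auto
    also have "\<dots> = e" using C D by simp
    finally show ?thesis .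
  qed
  then show "\<exists>M. \<forall>k\<ge>M. \<forall>l\<ge>M. v (x k * y k - x l * y l) < e" by blast
qed

lemma cauchy_uminus: "x \<in> padic_cauchy p \<Longrightarrow> (\<lambda>k. - x k) \<in> padic_cauchy p"
  using cauchy_mult[OF const_cauchy[of "- 1"]] by simp

lemma cauchy_diff:
  "x \<in> padic_cauchy p \<Longrightarrow> y \<in> padic_cauchy p \<Longrightarrow> (\<lambda>k. x k - y k) \<in> padic_cauchy p"
  using cauchy_add[of x "\<lambda>k. - y k"] cauchy_uminus[of y] by simp

lemma nullD: "x \<in> N \<Longrightarrow> (\<lambda>k. v (x k)) \<longlonglongrightarrow> 0"
  unfolding padic_null_def by simp

lemma null_cauchy: "x \<in> N \<Longrightarrow> x \<in> padic_cauchy p"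
  unfolding padic_cauchy_def
proof (intro CollectI allI impI)
  fix e :: real assume "x \<in> N" "e > 0"
  then have "eventually (\<lambda>k. v (x k) < e / 2) sequentially"
    using order_tendstoD(2)[OF nullD, of x "e / 2"] by simp
  then obtain M where "\<forall>k\<ge>M. v (x k) < e / 2" by (auto simp: eventually_sequentially)
  then have "v (x k - x l) < e" if "k \<ge> M" "l \<ge> M" for k l
    using that v_diff[of "x k" "x l"] add_strict_mono[of "v (x k)" "e / 2" "v (x l)" "e / 2"] by auto
  then show "\<exists>M. \<forall>k\<ge>M. \<forall>l\<ge>M. v (x k - x l) < e" by blast
qed

lemma null_add: "x \<in> N \<Longrightarrow> y \<in> N \<Longrightarrow> (\<lambda>k. x k + y k) \<in> N"
proof -
  assume "x \<in> N" "y \<in> N"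
  then have "(\<lambda>k. v (x k) + v (y k)) \<longlonglongrightarrow> 0" using tendsto_add[OF nullD nullD] by fastforce
  then show ?thesis unfolding padic_null_def
    by - (rule CollectI, rule Lim_null_comparison[rotated], assumption, auto simp: v_add)
qed

lemma null_mult: "x \<in> padic_cauchy p \<Longrightarrow> y \<in> N \<Longrightarrow> (\<lambda>k. x k * y k) \<in> N"
proof -
  assume x: "x \<in> padic_cauchy p" and y: "y \<in> N"
  obtain C where C: "C > 0" "\<And>k. v (x k) \<le> C" using cauchy_bounded[OF x] by blast
  have "(\<lambda>k. C * v (y k)) \<longlonglongrightarrow> 0" using tendsto_mult_right_zero[OF nullD[OF y]] by simp
  then show ?thesis unfolding padic_null_def
    by - (rule CollectI, rule Lim_null_comparison[rotated], assumption, auto simp: v_mult intro!: always_eventually mult_right_mono C)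
qed

lemma cring_R: "cring R"
proof (rule cringI)
  show "abelian_group R"
  proof (rule abelian_groupI)
    fix x assume "x \<in> carrier R"
    then show "\<exists>y\<in>carrier R. y \<oplus>\<^bsub>R\<^esub> x = \<zero>\<^bsub>R\<^esub>"
      using cauchy_uminus by (intro bexI[of _ "\<lambda>k. - x k"]) (auto simp: padic_cauchy_ring_def)
  qed (auto simp: padic_cauchy_ring_def cauchy_add const_cauchy algebra_simps)
  show "comm_monoid R"
    by (rule comm_monoidI) (auto simp: padic_cauchy_ring_def cauchy_mult const_cauchy algebra_simps)
qed (auto simp: padic_cauchy_ring_def algebra_simps)

sublocale R: cring R by (rule cring_R)

lemma R_simps [simp]:
  "carrier R = padic_cauchy p" "x \<oplus>\<^bsub>R\<^esub> y = (\<lambda>k. x k + y k)" "x \<otimes>\<^bsub>R\<^esub> y = (\<lambda>k. x k * y k)"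
  "\<zero>\<^bsub>R\<^esub> = (\<lambda>_. 0)" "\<one>\<^bsub>R\<^esub> = (\<lambda>_. 1)"
  by (auto simp: padic_cauchy_ring_def)

lemma R_uminus: "x \<in> padic_cauchy p \<Longrightarrow> \<ominus>\<^bsub>R\<^esub> x = (\<lambda>k. - x k)"
  by (rule R.minus_equality) (auto simp: cauchy_uminus)

lemma ideal_N: "ideal N R"
proof (rule idealI)
  show "subgroup N (add_monoid R)"
  proof (rule subgroup.intro)
    show "N \<subseteq> carrier (add_monoid R)" using null_cauchy by auto
    show "\<one>\<^bsub>add_monoid R\<^esub> \<in> N" by (simp add: padic_null_def)
    fix x y assume x: "x \<in> N" and "y \<in> N"
    then show "x \<otimes>\<^bsub>add_monoid R\<^esub> y \<in> N" using null_add by simp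
    have "inv\<^bsub>add_monoid R\<^esub> x = (\<lambda>k. - x k)" using R_uminus[OF null_cauchy[OF x]] by (simp add: a_inv_def)
    then show "inv\<^bsub>add_monoid R\<^esub> x \<in> N" using x by (simp add: padic_null_def v_minus)
  qed
next
  fix a x assume "a \<in> N" "x \<in> carrier R"
  then show "x \<otimes>\<^bsub>R\<^esub> a \<in> N" "a \<otimes>\<^bsub>R\<^esub> x \<in> N"
    using null_mult[of x a] by (simp_all add: mult.commute)
qed (rule R.ring_axioms)

sublocale N: ideal N R by (rule ideal_N)

section \<open>Distances and limits in terms of representing sequences\<close>

definition cls :: "(nat \<Rightarrow> rat) \<Rightarrow> padic" where
  "cls x = N +>\<^bsub>R\<^esub> x"

sublocale Qp: cring "Qp p"
  unfolding Qp_def by (rule N.quotient_is_cring[OF cring_R])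

lemma cls_hom: "ring_hom_cring R (Qp p) cls"
  unfolding Qp_def cls_def
  by (rule N.rcos_ring_hom_cring[OF cring_R])

interpretation cls: ring_hom_cring R "Qp p" cls by (rule cls_hom)

lemma carrier_Qp: "carrier (Qp p) = cls ` padic_cauchy p"
  unfolding Qp_def cls_def FactRing_def A_RCOSETS_def' by auto

lemma cls_closed [simp]: "x \<in> padic_cauchy p \<Longrightarrow> cls x \<in> carrier (Qp p)"
  by (auto simp: carrier_Qp)

lemma cls_mem: "x \<in> padic_cauchy p \<Longrightarrow> y \<in> cls x \<longleftrightarrow> (\<lambda>k. y k - x k) \<in> N"
proof -
  assume x: "x \<in> padic_cauchy p"
  have "y \<in> cls x \<longleftrightarrow> (\<exists>h\<in>N. y = (\<lambda>k. h k + x k))"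
    unfolding cls_def a_r_coset_def' by auto
  also have "\<dots> \<longleftrightarrow> (\<lambda>k. y k - x k) \<in> N"
  proof
    assume "(\<lambda>k. y k - x k) \<in> N"
    then show "\<exists>h\<in>N. y = (\<lambda>k. h k + x k)" by (intro bexI[of _ "\<lambda>k. y k - x k"]) auto
  qed auto
  finally show ?thesis .
qed

lemma padic_of_rat_cls: "padic_of_rat p q = cls (\<lambda>_. q)"
  unfolding padic_of_rat_def cls_def ..

lemma cls_diff:
  "x \<in> padic_cauchy p \<Longrightarrow> y \<in> padic_cauchy p \<Longrightarrow> cls x \<ominus>\<^bsub>Qp p\<^esub> cls y = cls (\<lambda>k. x k - y k)"
  using cls.hom_add[of x "\<ominus>\<^bsub>R\<^esub> y"] cls.hom_a_inv[of y]
  by (simp add: a_minus_def R_uminus cauchy_uminus)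

lemma cls_mult:
  "x \<in> padic_cauchy p \<Longrightarrow> y \<in> padic_cauchy p \<Longrightarrow> cls x \<otimes>\<^bsub>Qp p\<^esub> cls y = cls (\<lambda>k. x k * y k)"
  using cls.hom_mult[of x y] by simp

lemma cauchy_convergent_v:
  assumes "x \<in> padic_cauchy p" shows "convergent (\<lambda>k. v (x k))"
proof (rule Cauchy_convergent, rule metric_CauchyI)
  fix e :: real assume "e > 0"
  then obtain M where "\<forall>k\<ge>M. \<forall>l\<ge>M. v (x k - x l) < e" using cauchyD[OF assms] by blast
  then show "\<exists>M. \<forall>k\<ge>M. \<forall>l\<ge>M. dist (v (x k)) (v (x l)) < e"
    using v_abs_diff unfolding dist_real_def by (meson le_less_trans)
qed

text \<open>Representatives differ by a null sequence, hence their absolute values have the same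
  limit; the class contains \<open>x\<close> itself, which makes the described number
  unique.\<close>

lemma padic_abs_cls:
  assumes x: "x \<in> padic_cauchy p"
  shows "(\<lambda>k. v (x k)) \<longlonglongrightarrow> padic_abs p (cls x)"
proof -
  obtain r where r: "(\<lambda>k. v (x k)) \<longlonglongrightarrow> r"
    using cauchy_convergent_v[OF x] by (auto simp: convergent_def)
  have "padic_abs p (cls x) = r"
    unfolding padic_abs_def
  proof (rule the_equality)
    show "\<forall>y\<in>cls x. (\<lambda>k. v (y k)) \<longlonglongrightarrow> r"
    proof
      fix y assume "y \<in> cls x"
      then have "(\<lambda>k. v (y k - x k)) \<longlonglongrightarrow> 0" using cls_mem[OF x] nullD by blast
      then have "(\<lambda>k. v (y k) - v (x k)) \<longlonglongrightarrow> 0"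
        by (rule Lim_null_comparison[rotated]) (auto simp: v_abs_diff)
      from tendsto_add[OF this r] show "(\<lambda>k. v (y k)) \<longlonglongrightarrow> r" by simp
    qed
    have "x \<in> cls x" by (simp add: cls_mem[OF x] padic_null_def)
    then show "s = r" if "\<forall>y\<in>cls x. (\<lambda>k. v (y k)) \<longlonglongrightarrow> s" for s
      using that r LIMSEQ_unique by blast
  qed
  with r show ?thesis by simp
qed

lemma padic_abs_of_rat_diff:
  assumes x: "x \<in> padic_cauchy p"
  shows "(\<lambda>k. v (q - x k)) \<longlonglongrightarrow> padic_abs p (padic_of_rat p q \<ominus>\<^bsub>Qp p\<^esub> cls x)"
  unfolding padic_of_rat_cls cls_diff[OF const_cauchy x]
  by (rule padic_abs_cls) (intro cauchy_diff const_cauchy x)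

text \<open>The distance of \<open>x k\<close> to the class is the limit over \<open>j\<close> of
  \<open>v (x k - x j)\<close>, which the Cauchy condition makes small.\<close>

lemma padic_tendsto_cls:
  assumes x: "x \<in> padic_cauchy p"
  shows "padic_tendsto p (\<lambda>k. padic_of_rat p (x k)) (cls x)"
  unfolding padic_tendsto_def
proof
  show "(\<lambda>k. padic_abs p (padic_of_rat p (x k) \<ominus>\<^bsub>Qp p\<^esub> cls x)) \<longlonglongrightarrow> 0"
  proof (rule LIMSEQ_I)
    fix e :: real assume e: "e > 0"
    then obtain M where M: "\<forall>k\<ge>M. \<forall>l\<ge>M. v (x k - x l) < e / 2"
      using cauchyD[OF x, of "e / 2"] by auto
    have "norm (padic_abs p (padic_of_rat p (x k) \<ominus>\<^bsub>Qp p\<^esub> cls x) - 0) < e" if "k \<ge> M" for k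
    proof -
      let ?a = "padic_abs p (padic_of_rat p (x k) \<ominus>\<^bsub>Qp p\<^esub> cls x)"
      have l: "(\<lambda>j. v (x k - x j)) \<longlonglongrightarrow> ?a" by (rule padic_abs_of_rat_diff[OF x])
      have "?a \<le> e / 2"
        by (rule LIMSEQ_le_const2[OF l]) (use M that in \<open>auto intro!: exI[of _ M] less_imp_le\<close>)
      moreover have "?a \<ge> 0" by (rule LIMSEQ_le_const[OF l]) auto
      ultimately show ?thesis using e by simp
    qed
    then show "\<exists>M. \<forall>k\<ge>M. norm (padic_abs p (padic_of_rat p (x k) \<ominus>\<^bsub>Qp p\<^esub> cls x) - 0) < e" by blast
  qed
qed (simp add: x)

text \<open>Serves both the uniqueness of limits and that of digits. The triangle inequality is used
  with the members of a representing sequence as midpoints and then passed to the limit.\<close>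

lemma padic_tendsto_same_limit:
  assumes "padic_tendsto p (\<lambda>k. padic_of_rat p (a k)) L" "padic_tendsto p (\<lambda>k. padic_of_rat p (b k)) L"
  shows "(\<lambda>k. v (a k - b k)) \<longlonglongrightarrow> 0"
proof -
  obtain x where x: "x \<in> padic_cauchy p" "L = cls x"
    using assms(1) by (auto simp: padic_tendsto_def carrier_Qp)
  let ?d = "\<lambda>q. padic_abs p (padic_of_rat p q \<ominus>\<^bsub>Qp p\<^esub> cls x)"
  have "v (q - r) \<le> ?d q + ?d r" for q r
  proof (rule LIMSEQ_le_const)
    show "(\<lambda>k. v (q - x k) + v (r - x k)) \<longlonglongrightarrow> ?d q + ?d r"
      by (intro tendsto_add padic_abs_of_rat_diff x)
    show "\<exists>N. \<forall>k\<ge>N. v (q - r) \<le> v (q - x k) + v (r - x k)"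
      using v_triangle v_minus_commute by metis
  qed
  moreover have "(\<lambda>k. ?d (a k) + ?d (b k)) \<longlonglongrightarrow> 0"
    using tendsto_add[of "\<lambda>k. ?d (a k)" 0 _ "\<lambda>k. ?d (b k)" 0] assms unfolding padic_tendsto_def x(2) by simp
  ultimately show ?thesis
    by - (rule Lim_null_comparison[rotated], assumption, auto)
qed

lemma padic_tendsto_unique:
  assumes "padic_tendsto p (\<lambda>k. padic_of_rat p (a k)) L" "padic_tendsto p (\<lambda>k. padic_of_rat p (a k)) L'"
  shows "L = L'"
proof -
  have *: "(\<lambda>k. a k - x k) \<in> N" if "x \<in> padic_cauchy p" "padic_tendsto p (\<lambda>k. padic_of_rat p (a k)) (cls x)" for x
    unfolding padic_null_def
    using padic_tendsto_same_limit[OF that(2) padic_tendsto_cls[OF that(1)]] by simp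
  obtain x y where xy: "x \<in> padic_cauchy p" "L = cls x" "y \<in> padic_cauchy p" "L' = cls y"
    using assms by (auto simp: padic_tendsto_def carrier_Qp)
  have "(\<lambda>k. - 1 * (a k - x k)) \<in> N" by (rule null_mult[OF const_cauchy *]) (use xy assms in auto)
  from null_add[OF this *[of y]] have d: "(\<lambda>k. x k - y k) \<in> N" using xy assms by simp
  have "z \<in> cls x \<longleftrightarrow> z \<in> cls y" for z
  proof -
    have "(\<lambda>k. z k - x k) \<in> N \<Longrightarrow> (\<lambda>k. z k - y k) \<in> N"
      using null_add[OF _ d, of "\<lambda>k. z k - x k"] by simp
    moreover have "(\<lambda>k. z k - y k) \<in> N \<Longrightarrow> (\<lambda>k. z k - x k) \<in> N"
      using null_add[OF _ null_mult[OF const_cauchy[of "- 1"] d], of "\<lambda>k. z k - y k"] by simp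
    ultimately show ?thesis using xy cls_mem by blast
  qed
  then show ?thesis using xy by blast
qed

end

context padic_prime begin

section \<open>Digit expansions\<close>

lemma v_p_power_times_le: "v (of_nat p ^ K * x) = v x / real p ^ K"
  by (simp add: v_mult v_power v_p power_divide)

text \<open>Multiplication by \<open>p ^ K\<close> turns truncated expansions into natural numbers
  in base \<open>p\<close>, so that residues can be compared. For \<open>k \<ge> K\<close> the
  window contains all negative positions that can carry a digit.\<close>

lemma expansion_scaled_partial_sum:
  assumes k: "k \<ge> K" and zero: "\<And>i. i < - int K \<Longrightarrow> \<epsilon> i = 0"
  shows "of_nat p ^ K * (\<Sum>i\<in>{- int k..<int k}. of_nat (\<epsilon> i) * of_nat p powi i :: rat) =
    of_nat (\<Sum>j<k + K. \<epsilon> (int j - int K) * p ^ j)"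
proof -
  have "(\<Sum>i\<in>{- int k..<int k}. of_nat (\<epsilon> i) * of_nat p powi i :: rat) =
      (\<Sum>i\<in>{- int K..<int k}. of_nat (\<epsilon> i) * of_nat p powi i)"
    using k zero by (intro sum.mono_neutral_right) auto
  also have "\<dots> = (\<Sum>j<k + K. of_nat (\<epsilon> (int j - int K)) * of_nat p powi (int j - int K))"
    using k by (intro sum.reindex_bij_witness[of _ "\<lambda>j. int j - int K" "\<lambda>i. nat (i + int K)"]) auto
  also have "of_nat p ^ K * \<dots> = (\<Sum>j<k + K. of_nat (\<epsilon> (int j - int K) * p ^ j))"
    unfolding sum_distrib_left
    by (intro sum.cong refl) (simp add: power_int_diff field_simps)
  finally show ?thesis by simp
qed

lemma digit_sum_less: "(\<And>j. d j < p) \<Longrightarrow> (\<Sum>j<r. d j * p ^ j) < p ^ r"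
proof (induction r)
  case (Suc r)
  have "d r * p ^ r + p ^ r \<le> p * p ^ r"
    using Suc.prems[of r] by (metis Suc_leI add.commute mult_Suc mult_le_mono1)
  then show ?case using Suc by simp
qed simp

lemma digit_sum_mod:
  assumes "\<And>j. d j < p" and "r \<le> m"
  shows "(\<Sum>j<m. d j * p ^ j) mod p ^ r = (\<Sum>j<r. d j * p ^ j)"
  using assms(2)
proof (induction m rule: dec_induct)
  case base
  then show ?case using digit_sum_less[OF assms(1)] by simp
next
  case (step m)
  have "p ^ r dvd d m * p ^ m" using step by (simp add: le_imp_power_dvd)
  then show ?case using step by (simp add: mod_add_right_eq[symmetric] dvd_imp_mod_0)
qed

text \<open>Gives the definite description in \<open>padic_frac\<close> its meaning. Truncations of
  two expansions are p-adically close, so after scaling they are congruent modulo every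
  \<open>p ^ r\<close>, and a residue modulo \<open>p ^ r\<close> determines the lowest
  \<open>r\<close> digits.\<close>

lemma padic_expansion_unique:
  assumes "padic_expansion p \<epsilon> X" "padic_expansion p \<delta> X"
  shows "\<epsilon> = \<delta>"
proof -
  obtain N1 N2 where N: "\<forall>i<N1. \<epsilon> i = 0" "\<forall>i<N2. \<delta> i = 0"
    using assms unfolding padic_expansion_def by blast
  define K where "K = nat (- N1) + nat (- N2)"
  have z: "\<epsilon> i = 0" "\<delta> i = 0" if "i < - int K" for i
  proof -
    have "i < N1" "i < N2" using that unfolding K_def by linarith+
    then show "\<epsilon> i = 0" "\<delta> i = 0" using N by blast+
  qed
  have less: "\<epsilon> i < p" "\<delta> i < p" for i
    using assms unfolding padic_expansion_def by blast+
  let ?P = "\<lambda>\<epsilon> k. \<Sum>i\<in>{- int k..<int k}. of_nat (\<epsilon> i) * of_nat p powi i :: rat"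
  let ?d = "\<lambda>\<epsilon> j. \<epsilon> (int j - int K)"
  have lim: "(\<lambda>k. v (?P \<epsilon> k - ?P \<delta> k)) \<longlonglongrightarrow> 0"
    using assms unfolding padic_expansion_def by (intro padic_tendsto_same_limit) auto
  have eq: "(\<Sum>j<r. ?d \<epsilon> j * p ^ j) = (\<Sum>j<r. ?d \<delta> j * p ^ j)" for r
  proof -
    \<comment> \<open>Scaling by \<open>p ^ K\<close> divides the absolute value by
      \<open>p ^ K\<close>, so this threshold becomes \<open>1 / p ^ r\<close>.\<close>
    have "eventually (\<lambda>k. v (?P \<epsilon> k - ?P \<delta> k) < real p ^ K / real p ^ r) sequentially"
      using order_tendstoD(2)[OF lim] by simp
    then obtain M where M: "\<forall>k\<ge>M. v (?P \<epsilon> k - ?P \<delta> k) < real p ^ K / real p ^ r"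
      by (auto simp: eventually_sequentially)
    define k where "k = max M (max K r)"
    let ?S = "\<lambda>\<epsilon>. \<Sum>j<k + K. ?d \<epsilon> j * p ^ j"
    have "of_nat p ^ K * (?P \<epsilon> k - ?P \<delta> k) = of_int (int (?S \<epsilon>) - int (?S \<delta>))"
      using expansion_scaled_partial_sum[of K k \<epsilon>] expansion_scaled_partial_sum[of K k \<delta>] z
      unfolding right_diff_distrib k_def by simp
    moreover have "v (of_nat p ^ K * (?P \<epsilon> k - ?P \<delta> k)) < 1 / real p ^ r"
      using M unfolding v_p_power_times_le k_def by (simp add: field_simps)
    ultimately have "v (of_int (int (?S \<epsilon>) - int (?S \<delta>))) < 1 / real p ^ r" by (simp only:)
    then have "int p ^ r dvd int (?S \<epsilon>) - int (?S \<delta>)"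
      unfolding v_of_int_le[symmetric] by (rule less_imp_le)
    then have "int (?S \<epsilon> mod p ^ r) = int (?S \<delta> mod p ^ r)"
      by (simp add: mod_eq_dvd_iff zmod_int)
    then have "?S \<epsilon> mod p ^ r = ?S \<delta> mod p ^ r" by (simp only: of_nat_eq_iff)
    moreover have "r \<le> k + K" unfolding k_def by simp
    ultimately show ?thesis
      using digit_sum_mod[of "?d \<epsilon>" r "k + K"] digit_sum_mod[of "?d \<delta>" r "k + K"] less by simp
  qed
  show ?thesis
  proof
    fix i
    show "\<epsilon> i = \<delta> i"
    proof (cases "i < - int K")
      case False
      define j where "j = nat (i + int K)"
      have "?d \<epsilon> j * p ^ j = ?d \<delta> j * p ^ j" using eq[of j] eq[of "Suc j"] by simp
      then show ?thesis using False unfolding j_def by simp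
    qed (use z in simp)
  qed
qed

text \<open>The integers \<open>p ^ K * q m\<close> become stationary modulo each
  \<open>p ^ r\<close>. Their eventual residues are coherent, and the digits are read off from
  them.\<close>

lemma padic_expansion_exists:
  assumes q: "q \<in> padic_cauchy p" and int: "\<And>m. of_nat p ^ K * q m \<in> \<int>"
  obtains \<epsilon> where "padic_expansion p \<epsilon> (cls q)" "\<And>i. i < - int K \<Longrightarrow> \<epsilon> i = 0"
proof -
  have "\<forall>m. \<exists>z. of_nat p ^ K * q m = of_int z"
    using int unfolding Ints_def by blast
  from choice[OF this] obtain a where a: "\<And>m. of_nat p ^ K * q m = of_int (a m)" by blast
  have "\<exists>M. \<forall>k\<ge>M. \<forall>l\<ge>M. int p ^ r dvd a k - a l" for r
  proof -
    obtain M where M: "\<forall>k\<ge>M. \<forall>l\<ge>M. v (q k - q l) < real p ^ K / real p ^ r"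
      using cauchyD[OF q, of "real p ^ K / real p ^ r"] by auto
    have "int p ^ r dvd a k - a l" if "k \<ge> M" "l \<ge> M" for k l
    proof -
      have "v (of_nat p ^ K * (q k - q l)) < 1 / real p ^ r"
        using M that unfolding v_p_power_times_le by (simp add: field_simps)
      also have "of_nat p ^ K * (q k - q l) = of_int (a k - a l)"
        using a by (simp add: right_diff_distrib)
      finally show ?thesis unfolding v_of_int_le[symmetric] by (rule less_imp_le)
    qed
    then show ?thesis by blast
  qed
  then have "\<forall>r. \<exists>M. \<forall>k\<ge>M. \<forall>l\<ge>M. int p ^ r dvd a k - a l" by blast
  from choice[OF this] obtain M
    where M: "\<And>r k l. k \<ge> M r \<Longrightarrow> l \<ge> M r \<Longrightarrow> int p ^ r dvd a k - a l" by blast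
  \<comment> \<open>\<open>M r\<close> is a time after which the residue modulo \<open>p ^ r\<close>
    no longer changes, so \<open>R r\<close> is the residue of the scaled limit.\<close>
  define R where "R r = nat (a (M r) mod int p ^ r)" for r
  have R: "int (R r) = a (M r) mod int p ^ r" for r unfolding R_def by simp
  have R_less: "R r < p ^ r" for r
  proof -
    have "int (R r) < int (p ^ r)" unfolding R by simp
    then show ?thesis by linarith
  qed
  have R_cong: "int p ^ r dvd int (R r) - a m" if "m \<ge> M r" for r m
  proof -
    have "int (R r) mod int p ^ r = a (M r) mod int p ^ r" unfolding R by simp
    then have 1: "int p ^ r dvd int (R r) - a (M r)" by (simp add: mod_eq_dvd_iff)
    have 2: "int p ^ r dvd a (M r) - a m" using M[of r "M r" m] that by simp
    show ?thesis using dvd_add[OF 1 2] by simp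
  qed
  have R_mod: "R (Suc r) mod p ^ r = R r" for r
  proof -
    let ?m = "max (M r) (M (Suc r))"
    have 1: "int p ^ r dvd int (R r) - a ?m" by (rule R_cong) simp
    have "int p ^ Suc r dvd int (R (Suc r)) - a ?m" by (rule R_cong) simp
    then have 2: "int p ^ r dvd int (R (Suc r)) - a ?m" by (rule power_le_dvd) simp
    have "int p ^ r dvd int (R (Suc r)) - int (R r)" using dvd_diff[OF 2 1] by simp
    then have "int (R (Suc r) mod p ^ r) = int (R r mod p ^ r)"
      by (simp add: zmod_int mod_eq_dvd_iff)
    then show ?thesis using R_less by simp
  qed
  define d where "d j = R (Suc j) div p ^ j" for j
  have d_less: "d j < p" for j
    unfolding d_def using R_less[of "Suc j"] by (simp add: less_mult_imp_div_less)
  have R_sum: "R r = (\<Sum>j<r. d j * p ^ j)" for r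
  proof (induction r)
    case 0 then show ?case using R_less[of 0] by simp
  next
    case (Suc r)
    have "R (Suc r) = R (Suc r) div p ^ r * p ^ r + R (Suc r) mod p ^ r"
      by (rule div_mult_mod_eq[symmetric])
    then show ?case unfolding R_mod using Suc by (simp add: d_def)
  qed
  \<comment> \<open>Position \<open>i\<close> of the limit corresponds to position
    \<open>i + K\<close> of the scaled integers.\<close>
  define \<epsilon> where "\<epsilon> i = (if i < - int K then 0 else d (nat (i + int K)))" for i
  have z: "\<epsilon> i = 0" if "i < - int K" for i using that by (simp add: \<epsilon>_def)
  have P: "of_nat p ^ K * (\<Sum>i\<in>{- int k..<int k}. of_nat (\<epsilon> i) * of_nat p powi i :: rat) = of_nat (R (k + K))"
    if "k \<ge> K" for k
  proof -
    have "\<epsilon> (int j - int K) = d j" for j by (simp add: \<epsilon>_def)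
    then show ?thesis
      using expansion_scaled_partial_sum[of K k \<epsilon>, OF that z] by (simp only: R_sum[of "k + K"])
  qed
  have "padic_tendsto p (\<lambda>k. padic_of_rat p (\<Sum>i\<in>{- int k..<int k}. of_nat (\<epsilon> i) * of_nat p powi i)) (cls q)"
    (is "padic_tendsto p (\<lambda>k. padic_of_rat p (?P k)) _")
    unfolding padic_tendsto_def
  proof
    have ev: "eventually (\<lambda>k. norm (padic_abs p (padic_of_rat p (?P k) \<ominus>\<^bsub>Qp p\<^esub> cls q)) \<le> (1 / real p) ^ k) sequentially"
      using eventually_ge_at_top[of K]
    proof eventually_elim
      case (elim k)
      have l: "(\<lambda>m. v (?P k - q m)) \<longlonglongrightarrow> padic_abs p (padic_of_rat p (?P k) \<ominus>\<^bsub>Qp p\<^esub> cls q)"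
        by (rule padic_abs_of_rat_diff[OF q])
      have "v (?P k - q m) \<le> (1 / real p) ^ k" if m: "m \<ge> M (k + K)" for m
      proof -
        have "of_nat p ^ K * (?P k - q m) = of_int (int (R (k + K)) - a m)"
          using P[OF elim] a[of m] by (simp add: right_diff_distrib)
        moreover have "v (of_int (int (R (k + K)) - a m)) \<le> 1 / real p ^ (k + K)"
          unfolding v_of_int_le by (rule R_cong[OF m])
        ultimately have "v (?P k - q m) / real p ^ K \<le> 1 / real p ^ (k + K)"
          by (simp only: v_p_power_times_le[symmetric])
        then show ?thesis by (simp add: field_simps power_add)
      qed
      then have "padic_abs p (padic_of_rat p (?P k) \<ominus>\<^bsub>Qp p\<^esub> cls q) \<le> (1 / real p) ^ k"
        by (intro LIMSEQ_le_const2[OF l]) blast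
      moreover have "padic_abs p (padic_of_rat p (?P k) \<ominus>\<^bsub>Qp p\<^esub> cls q) \<ge> 0"
        by (rule LIMSEQ_le_const[OF l]) auto
      ultimately show ?case by simp
    qed
    have "(\<lambda>k. (1 / real p) ^ k) \<longlonglongrightarrow> 0" using real_p_gt_1 by (intro LIMSEQ_realpow_zero) auto
    then show "(\<lambda>k. padic_abs p (padic_of_rat p (?P k) \<ominus>\<^bsub>Qp p\<^esub> cls q)) \<longlonglongrightarrow> 0"
      by (rule Lim_null_comparison[OF ev])
  qed (simp add: q)
  then have "padic_expansion p \<epsilon> (cls q)"
    unfolding padic_expansion_def using d_less z by (auto simp: \<epsilon>_def)
  then show ?thesis using z that by blast
qed

text \<open>A bound on the denominators of the sequence passes to the fractional part of its limit,
  since no digit sits below position \<open>- K\<close>. The numerator bound is what the word length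
  estimate consumes.\<close>

lemma padic_frac_cls:
  assumes q: "q \<in> padic_cauchy p" and int: "\<And>m. of_nat p ^ K * q m \<in> \<int>"
  obtains a :: nat where "a < p ^ K" "padic_frac p (cls q) = of_nat a / of_nat p ^ K"
proof -
  obtain \<epsilon> where \<epsilon>: "padic_expansion p \<epsilon> (cls q)" and z: "\<And>i. i < - int K \<Longrightarrow> \<epsilon> i = 0"
    using padic_expansion_exists[OF assms] by blast
  have the: "(THE \<epsilon>. padic_expansion p \<epsilon> (cls q)) = \<epsilon>"
    using \<epsilon> padic_expansion_unique by blast
  have less: "\<epsilon> i < p" for i using \<epsilon> unfolding padic_expansion_def by blast
  let ?a = "\<Sum>j<K. \<epsilon> (int j - int K) * p ^ j"
  have sub: "{i. i < 0 \<and> \<epsilon> i \<noteq> 0} \<subseteq> {- int K..<0}"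
  proof
    fix i assume "i \<in> {i. i < 0 \<and> \<epsilon> i \<noteq> 0}"
    then show "i \<in> {- int K..<0}" using z[of i] by fastforce
  qed
  have "padic_frac p (cls q) = (\<Sum>i | i < 0 \<and> \<epsilon> i \<noteq> 0. of_nat (\<epsilon> i) * of_nat p powi i)"
    unfolding padic_frac_def the Let_def ..
  also have "\<dots> = (\<Sum>i\<in>{- int K..<0}. of_nat (\<epsilon> i) * of_nat p powi i)"
    using sub by (intro sum.mono_neutral_left) auto
  also have "\<dots> = (\<Sum>j<K. of_nat (\<epsilon> (int j - int K)) * of_nat p powi (int j - int K))"
    by (intro sum.reindex_bij_witness[of _ "\<lambda>j. int j - int K" "\<lambda>i. nat (i + int K)"]) auto
  also have "\<dots> = (\<Sum>j<K. of_nat (\<epsilon> (int j - int K) * p ^ j)) / of_nat p ^ K"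
    unfolding sum_divide_distrib by (intro sum.cong refl) (simp add: power_int_diff)
  finally have "padic_frac p (cls q) = of_nat ?a / of_nat p ^ K" by simp
  moreover have "?a < p ^ K" using digit_sum_less[of "\<lambda>j. \<epsilon> (int j - int K)"] less by simp
  ultimately show ?thesis using that by blast
qed

end

section \<open>The group\<close>

lemma index_mult_mat_sum:
  "A \<in> carrier_mat n n \<Longrightarrow> B \<in> carrier_mat n n \<Longrightarrow> i < n \<Longrightarrow> j < n \<Longrightarrow>
    (A * B) $$ (i, j) = (\<Sum>k<n. A $$ (i, k) * B $$ (k, j))"
  by (auto simp: scalar_prod_def atLeast0LessThan)

locale padic_group = padic_prime +
  fixes n :: nat
begin

abbreviation "Zi \<equiv> Z_inverse p"
abbreviation "G \<equiv> semidirect p n"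

lemma Zi_iff: "x \<in> Zi \<longleftrightarrow> (\<exists>k. of_nat p ^ k * x \<in> \<int>)"
proof
  assume "x \<in> Zi"
  then obtain a k where "x = of_int a / of_nat p ^ k" unfolding Z_inverse_def by blast
  then have "of_nat p ^ k * x = of_int a" by simp
  then show "\<exists>k. of_nat p ^ k * x \<in> \<int>" by (metis Ints_of_int)
next
  assume "\<exists>k. of_nat p ^ k * x \<in> \<int>"
  then obtain k a where "of_nat p ^ k * x = of_int a" unfolding Ints_def by blast
  then have "x = of_int a / of_nat p ^ k" by (simp add: field_simps)
  then show "x \<in> Zi" unfolding Z_inverse_def by blast
qed

lemma Zi_of_int [simp]: "of_int a \<in> Zi" unfolding Zi_iff by (intro exI[of _ 0]) simp
lemma Zi_of_nat [simp]: "of_nat a \<in> Zi" using Zi_of_int[of "int a"] by simp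
lemma Zi_0 [simp]: "0 \<in> Zi" using Zi_of_int[of 0] by simp
lemma Zi_1 [simp]: "1 \<in> Zi" using Zi_of_int[of 1] by simp

lemma Zi_mult: assumes "x \<in> Zi" "y \<in> Zi" shows "x * y \<in> Zi"
proof -
  obtain k l where k: "of_nat p ^ k * x \<in> \<int>" "of_nat p ^ l * y \<in> \<int>"
    using assms unfolding Zi_iff by blast
  have "of_nat p ^ (k + l) * (x * y) = (of_nat p ^ k * x) * (of_nat p ^ l * y)"
    by (simp add: power_add ac_simps)
  then show ?thesis unfolding Zi_iff using Ints_mult[OF k] by metis
qed

lemma Zi_add: assumes "x \<in> Zi" "y \<in> Zi" shows "x + y \<in> Zi"
proof -
  obtain k l where k: "of_nat p ^ k * x \<in> \<int>" "of_nat p ^ l * y \<in> \<int>"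
    using assms unfolding Zi_iff by blast
  have "of_nat p ^ (k + l) * (x + y) = of_nat p ^ l * (of_nat p ^ k * x) + of_nat p ^ k * (of_nat p ^ l * y)"
    by (simp add: power_add algebra_simps)
  also have "\<dots> \<in> \<int>" by (intro Ints_add Ints_mult[OF _ k(1)] Ints_mult[OF _ k(2)]) auto
  finally show ?thesis unfolding Zi_iff by blast
qed

lemma Zi_uminus: "x \<in> Zi \<Longrightarrow> - x \<in> Zi"
  using Zi_mult[of "of_int (- 1)" x] Zi_of_int[of "- 1"] by simp

lemma Zi_sum: "(\<And>i. i \<in> A \<Longrightarrow> f i \<in> Zi) \<Longrightarrow> sum f A \<in> Zi"
  by (induction A rule: infinite_finite_induct) (auto intro: Zi_add)

lemma Zi_powi [simp]: "of_nat p powi k \<in> Zi"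
proof (cases "k \<ge> 0")
  case True
  then have "of_nat p powi k = (of_int (int p ^ nat k) :: rat)" by (simp add: power_int_def)
  then show ?thesis using Zi_of_int by metis
next
  case False
  then have "of_nat p ^ nat (- k) * of_nat p powi k = (1 :: rat)"
    by (simp add: power_int_def power_inverse)
  then show ?thesis unfolding Zi_iff by (metis Ints_1)
qed

text \<open>Conjugation by \<open>diag_powers p n x\<close> in coordinates (see
  \<open>diag_conj\<close>). The entrywise form turns the laws of the action into computations with
  exponents.\<close>

definition tw :: "int vec \<Rightarrow> rat mat \<Rightarrow> rat mat" where
  "tw x f = mat n n (\<lambda>(i, j). of_nat p powi (x $ i - x $ j) * f $$ (i, j))"

lemma UT_carrier_mat: "f \<in> UT n Zi \<Longrightarrow> f \<in> carrier_mat n n"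
  unfolding UT_def by simp

lemma UT_diag: "f \<in> UT n Zi \<Longrightarrow> i < n \<Longrightarrow> f $$ (i, i) = 1"
  unfolding UT_def by simp

lemma UT_lower: "f \<in> UT n Zi \<Longrightarrow> j < i \<Longrightarrow> i < n \<Longrightarrow> f $$ (i, j) = 0"
  unfolding UT_def by (auto simp: upper_triangular_def)

lemma UT_Zi: "f \<in> UT n Zi \<Longrightarrow> i < n \<Longrightarrow> j < n \<Longrightarrow> f $$ (i, j) \<in> Zi"
  unfolding UT_def by simp

lemma UT_I:
  assumes "f \<in> carrier_mat n n" "\<And>i. i < n \<Longrightarrow> f $$ (i, i) = 1"
    "\<And>i j. j < i \<Longrightarrow> i < n \<Longrightarrow> f $$ (i, j) = 0" "\<And>i j. i < n \<Longrightarrow> j < n \<Longrightarrow> f $$ (i, j) \<in> Zi"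
  shows "f \<in> UT n Zi"
  using assms unfolding UT_def by (auto simp: upper_triangular_def)

lemma tw_carrier [simp]: "tw x f \<in> carrier_mat n n" unfolding tw_def by simp

lemma tw_index: "i < n \<Longrightarrow> j < n \<Longrightarrow> tw x f $$ (i, j) = of_nat p powi (x $ i - x $ j) * f $$ (i, j)"
  unfolding tw_def by simp

lemma diag_conj:
  assumes f: "f \<in> carrier_mat n n" and x: "x \<in> carrier_vec n"
  shows "diag_powers p n x * f * diag_powers p n (- x) = tw x f"
proof (rule eq_matI)
  fix i j assume ij: "i < dim_row (tw x f)" "j < dim_col (tw x f)"
  then have ij: "i < n" "j < n" by (auto simp: tw_def)
  have xj: "(- x) $ j = - (x $ j)" using x ij by simp
  have "of_nat p powi (x $ i - x $ j) = (of_nat p powi (x $ i) * of_nat p powi (- (x $ j)) :: rat)"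
    by (subst power_int_add[symmetric]) auto
  then show "(diag_powers p n x * f * diag_powers p n (- x)) $$ (i, j) = tw x f $$ (i, j)"
    using ij unfolding diag_powers_def tw_def mat_diag_mult_left[OF f]
    by (simp add: mat_diag_mult_right[of _ n] xj)
qed (use f in \<open>auto simp: tw_def diag_powers_def mat_diag_def\<close>)

lemma G_carrier: "carrier G = carrier_vec n \<times> UT n Zi"
  unfolding semidirect_def by simp

lemma G_one: "\<one>\<^bsub>G\<^esub> = (0\<^sub>v n, 1\<^sub>m n)"
  unfolding semidirect_def by simp

lemma G_mult: "x \<in> carrier_vec n \<Longrightarrow> g \<in> carrier_mat n n \<Longrightarrow> (x, f) \<otimes>\<^bsub>G\<^esub> (y, g) = (x + y, f * tw x g)"
  unfolding semidirect_def by (simp add: diag_conj)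

lemma UT_one: "1\<^sub>m n \<in> UT n Zi"
  by (rule UT_I) auto

lemma UT_mult:
  assumes f: "f \<in> UT n Zi" and g: "g \<in> UT n Zi"
  shows "f * g \<in> UT n Zi"
proof (rule UT_I)
  note c = UT_carrier_mat[OF f] UT_carrier_mat[OF g]
  show "f * g \<in> carrier_mat n n" using c by simp
  note ix = index_mult_mat_sum[OF c]
  show "(f * g) $$ (i, j) \<in> Zi" if "i < n" "j < n" for i j
    unfolding ix[OF that] using UT_Zi f g that by (intro Zi_sum Zi_mult) auto
  show "(f * g) $$ (i, j) = 0" if "j < i" "i < n" for i j
  proof -
    have "f $$ (i, k) * g $$ (k, j) = 0" if "k < n" for k
      using UT_lower[OF f, of k i] UT_lower[OF g, of j k] \<open>j < i\<close> \<open>i < n\<close> that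
      by (cases "k < i") auto
    then have "(\<Sum>k<n. f $$ (i, k) * g $$ (k, j)) = 0" by (intro sum.neutral) auto
    then show ?thesis using that by (subst ix) auto
  qed
  show "(f * g) $$ (i, i) = 1" if "i < n" for i
  proof -
    have "f $$ (i, k) * g $$ (k, i) = (if k = i then 1 else 0)" if "k < n" for k
      using UT_lower[OF f, of k i] UT_lower[OF g, of i k] UT_diag[OF f] UT_diag[OF g] \<open>i < n\<close> that
      by (cases k i rule: linorder_cases) auto
    then show ?thesis using that by (subst ix) auto
  qed
qed

lemma UT_tw: "f \<in> UT n Zi \<Longrightarrow> tw x f \<in> UT n Zi"
  by (rule UT_I) (auto simp: tw_index UT_diag UT_lower UT_Zi intro!: Zi_mult)

lemma tw_mult:
  assumes "f \<in> carrier_mat n n" "g \<in> carrier_mat n n"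
  shows "tw x (f * g) = tw x f * tw x g"
proof (rule eq_matI)
  fix i j assume "i < dim_row (tw x f * tw x g)" "j < dim_col (tw x f * tw x g)"
  then have ij: "i < n" "j < n" by (auto simp: tw_def)
  have e: "of_nat p powi (x $ i - x $ j) =
      (of_nat p powi (x $ i - x $ k) * of_nat p powi (x $ k - x $ j) :: rat)" for k
    by (subst power_int_add[symmetric]) auto
  have "tw x (f * g) $$ (i, j) =
      (\<Sum>k<n. of_nat p powi (x $ i - x $ j) * (f $$ (i, k) * g $$ (k, j)))"
    using ij by (simp add: index_mult_mat_sum[of _ n] assms tw_index sum_distrib_left del: index_mult_mat)
  also have "\<dots> = (\<Sum>k<n. tw x f $$ (i, k) * tw x g $$ (k, j))"
  proof (rule sum.cong)
    fix k assume "k \<in> {..<n}"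
    then show "of_nat p powi (x $ i - x $ j) * (f $$ (i, k) * g $$ (k, j)) = tw x f $$ (i, k) * tw x g $$ (k, j)"
      using ij unfolding e[of k] by (simp add: tw_index)
  qed simp
  also have "\<dots> = (tw x f * tw x g) $$ (i, j)"
    using ij by (simp add: index_mult_mat_sum[of _ n] del: index_mult_mat)
  finally show "tw x (f * g) $$ (i, j) = (tw x f * tw x g) $$ (i, j)" .
qed (auto simp: tw_def)

lemma tw_tw: "x \<in> carrier_vec n \<Longrightarrow> y \<in> carrier_vec n \<Longrightarrow> tw (x + y) f = tw x (tw y f)"
  by (rule eq_matI) (auto simp: tw_index tw_def power_int_diff power_int_add field_simps)

lemma tw_0: "f \<in> carrier_mat n n \<Longrightarrow> tw (0\<^sub>v n) f = f"
  by (rule eq_matI) (auto simp: tw_def)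

lemma tw_1: "tw x (1\<^sub>m n) = 1\<^sub>m n"
  by (rule eq_matI) (auto simp: tw_def)

lemma monoid_G: "monoid G"
proof (rule monoidI)
  fix g h k assume "g \<in> carrier G" "h \<in> carrier G" "k \<in> carrier G"
  then obtain x f y u z w where *: "g = (x, f)" "h = (y, u)" "k = (z, w)"
    "x \<in> carrier_vec n" "y \<in> carrier_vec n" "z \<in> carrier_vec n"
    "f \<in> carrier_mat n n" "u \<in> carrier_mat n n" "w \<in> carrier_mat n n"
    unfolding G_carrier by (metis UT_carrier_mat mem_Times_iff prod.collapse)
  then show "g \<otimes>\<^bsub>G\<^esub> h \<otimes>\<^bsub>G\<^esub> k = g \<otimes>\<^bsub>G\<^esub> (h \<otimes>\<^bsub>G\<^esub> k)"
    by (simp add: G_mult tw_mult tw_tw assoc_mult_mat[of _ n n _ n _ n])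
next
  fix g h assume "g \<in> carrier G" "h \<in> carrier G"
  then show "g \<otimes>\<^bsub>G\<^esub> h \<in> carrier G"
    by (auto simp: G_carrier G_mult UT_carrier_mat UT_mult UT_tw)
next
  fix g assume "g \<in> carrier G"
  then show "\<one>\<^bsub>G\<^esub> \<otimes>\<^bsub>G\<^esub> g = g" "g \<otimes>\<^bsub>G\<^esub> \<one>\<^bsub>G\<^esub> = g"
    by (auto simp: G_carrier G_one G_mult tw_0 tw_1 UT_carrier_mat
        left_mult_one_mat[of _ n n] right_mult_one_mat[of _ n n])
qed (auto simp: G_carrier G_one UT_one)

section \<open>Elementary matrices and translations\<close>

definition E :: "nat \<Rightarrow> nat \<Rightarrow> rat \<Rightarrow> rat mat" where
  "E i j c = mat n n (\<lambda>(a, b). if a = b then 1 else if a = i \<and> b = j then c else 0)"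

definition el :: "nat \<Rightarrow> nat \<Rightarrow> rat \<Rightarrow> elt" where "el i j c = (0\<^sub>v n, E i j c)"

definition tr :: "int vec \<Rightarrow> elt" where "tr x = (x, 1\<^sub>m n)"

lemma E_carrier [simp]: "E i j c \<in> carrier_mat n n" unfolding E_def by simp

lemma E_UT: "i < j \<Longrightarrow> j < n \<Longrightarrow> c \<in> Zi \<Longrightarrow> E i j c \<in> UT n Zi"
  by (rule UT_I) (auto simp: E_def)

lemma mult_E:
  assumes f: "f \<in> carrier_mat n n" and ij: "i < j" "j < n" and ab: "a < n" "b < n"
  shows "(f * E i j c) $$ (a, b) = f $$ (a, b) + (if b = j then f $$ (a, i) * c else 0)"
proof -
  have "(f * E i j c) $$ (a, b) = (\<Sum>k<n. f $$ (a, k) * E i j c $$ (k, b))"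
    by (rule index_mult_mat_sum[OF f E_carrier ab])
  also have "\<dots> = (\<Sum>k<n. (if k = b then f $$ (a, k) else 0) +
      (if k = i then (if b = j then f $$ (a, k) * c else 0) else 0))"
    using ij ab by (intro sum.cong) (auto simp: E_def)
  also have "\<dots> = f $$ (a, b) + (if b = j then f $$ (a, i) * c else 0)"
    using ij ab by (simp add: sum.distrib)
  finally show ?thesis .
qed

lemma E_mult_E: "i < j \<Longrightarrow> j < n \<Longrightarrow> E i j c * E i j d = E i j (c + d)"
proof (rule eq_matI)
  fix a b assume ij: "i < j" "j < n" and "a < dim_row (E i j (c + d))" "b < dim_col (E i j (c + d))"
  then have ab: "a < n" "b < n" by (auto simp: E_def)
  show "(E i j c * E i j d) $$ (a, b) = E i j (c + d) $$ (a, b)"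
    unfolding mult_E[OF E_carrier ij ab] using ij ab by (auto simp: E_def)
qed (auto simp: E_def)

lemma E_0: "E i j 0 = 1\<^sub>m n"
  by (rule eq_matI) (auto simp: E_def)

lemma tw_E: "i < j \<Longrightarrow> j < n \<Longrightarrow> tw x (E i j c) = E i j (of_nat p powi (x $ i - x $ j) * c)"
  by (rule eq_matI) (auto simp: tw_def E_def)

lemma el_carrier: "i < j \<Longrightarrow> j < n \<Longrightarrow> c \<in> Zi \<Longrightarrow> el i j c \<in> carrier G"
  by (simp add: el_def G_carrier E_UT)

lemma tr_carrier: "x \<in> carrier_vec n \<Longrightarrow> tr x \<in> carrier G"
  by (simp add: tr_def G_carrier UT_one)

lemma el_0: "el i j 0 = \<one>\<^bsub>G\<^esub>" by (simp add: el_def E_0 G_one)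

lemma el_add: "i < j \<Longrightarrow> j < n \<Longrightarrow> el i j c \<otimes>\<^bsub>G\<^esub> el i j d = el i j (c + d)"
  by (simp add: el_def G_mult tw_0 E_mult_E)

lemma tr_0: "tr (0\<^sub>v n) = \<one>\<^bsub>G\<^esub>" by (simp add: tr_def G_one)

lemma tr_add: "x \<in> carrier_vec n \<Longrightarrow> y \<in> carrier_vec n \<Longrightarrow> tr x \<otimes>\<^bsub>G\<^esub> tr y = tr (x + y)"
  by (simp add: tr_def G_mult tw_1)

lemma UT_tr: "f \<in> UT n Zi \<Longrightarrow> x \<in> carrier_vec n \<Longrightarrow> (0\<^sub>v n, f) \<otimes>\<^bsub>G\<^esub> tr x = (x, f)"
  by (simp add: tr_def G_mult tw_1 UT_carrier_mat right_mult_one_mat[of _ n n])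

lemma UT_el: "f \<in> UT n Zi \<Longrightarrow> (0\<^sub>v n, f) \<otimes>\<^bsub>G\<^esub> el i j c = (0\<^sub>v n, f * E i j c)"
  by (simp add: el_def G_mult tw_0)

lemma tr_el_tr:
  assumes "x \<in> carrier_vec n" "i < j" "j < n" "c \<in> Zi"
  shows "tr x \<otimes>\<^bsub>G\<^esub> el i j c \<otimes>\<^bsub>G\<^esub> tr (- x) = el i j (of_nat p powi (x $ i - x $ j) * c)"
  using assms by (simp add: tr_def el_def G_mult tw_E tw_1 left_mult_one_mat[of _ n n] right_mult_one_mat[of _ n n])

text \<open>
  A unitriangular matrix is filled in column by column from the right, each column from the top;
  then every step is a multiplication on the right by an elementary matrix carrying the new entry
  unchanged, because column \<open>i\<close> is still trivial when the entry \<open>(i, j)\<close> is inserted.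
\<close>

definition fill :: "rat mat \<Rightarrow> nat \<Rightarrow> rat mat" where
  "fill f t = mat n n (\<lambda>(a, b). if a = b then 1 else if (n - 1 - b) * n + a < t then f $$ (a, b) else 0)"

lemma fill_UT: "f \<in> UT n Zi \<Longrightarrow> fill f t \<in> UT n Zi"
  by (rule UT_I) (auto simp: fill_def UT_lower UT_Zi)

lemma fill_0: "fill f 0 = 1\<^sub>m n"
  by (rule eq_matI) (auto simp: fill_def)

lemma fill_all: assumes f: "f \<in> UT n Zi" shows "fill f (n * n) = f"
proof (rule eq_matI)
  fix a b assume "a < dim_row f" "b < dim_col f"
  then have ab: "a < n" "b < n" using UT_carrier_mat[OF f] by auto
  then have "(n - 1 - b) * n + a < (n - 1 - b) * n + n" by simp
  also have "\<dots> = Suc (n - 1 - b) * n" by simp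
  also have "\<dots> \<le> n * n" using ab by (intro mult_le_mono1) auto
  finally show "fill f (n * n) $$ (a, b) = f $$ (a, b)" using ab UT_diag[OF f] by (simp add: fill_def)
qed (use UT_carrier_mat[OF f] in \<open>auto simp: fill_def\<close>)

text \<open>The first alternative arises because the enumeration also visits positions on and below
  the diagonal, where nothing changes.\<close>

lemma fill_step:
  assumes f: "f \<in> UT n Zi" and t: "t < n * n"
  shows "fill f (Suc t) = fill f t \<or>
    (\<exists>i j. i < j \<and> j < n \<and> fill f (Suc t) = fill f t * E i j (f $$ (i, j)))"
proof -
  \<comment> \<open>Inverts the enumeration: time \<open>t = (n - 1 - j) * n + i\<close> belongs to
    row \<open>i\<close> of column \<open>j\<close>.\<close>
  define i j where "i = t mod n" and "j = n - 1 - t div n"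
  have n: "n > 0" using t by (cases n) auto
  have div: "t div n < n" using t by (simp add: less_mult_imp_div_less)
  have ij: "i < n" "j < n" using n div by (auto simp: i_def j_def)
  have t_eq: "t = (n - 1 - j) * n + i" using div by (simp add: i_def j_def)
  have uniq: "(n - 1 - b) * n + a = t \<longleftrightarrow> a = i \<and> b = j" if "a < n" "b < n" for a b
  proof
    assume *: "(n - 1 - b) * n + a = t"
    then have "n - 1 - b = t div n" "a = t mod n" using that(1) by auto
    then show "a = i \<and> b = j" using that unfolding i_def j_def by auto
  qed (use t_eq in simp)
  have step: "fill f (Suc t) $$ (a, b) =
      (if a = b then 1 else if a = i \<and> b = j then f $$ (a, b) else fill f t $$ (a, b))"
    if "a < n" "b < n" for a b
    using uniq[OF that] that by (auto simp: fill_def less_Suc_eq)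
  show ?thesis
  proof (cases "i < j")
    case True
    \<comment> \<open>Column \<open>i\<close> lies to the left of column \<open>j\<close> and is
      filled in later, so it is still a unit column; the right factor therefore adds
      \<open>f $$ (i, j)\<close> in row \<open>i\<close> of column \<open>j\<close> only.\<close>
    have col: "fill f t $$ (a, i) = (if a = i then 1 else 0)" if "a < n" for a
    proof -
      have "(n - 1 - j) * n + i < (n - 1 - j) * n + n" using ij by simp
      also have "\<dots> = Suc (n - 1 - j) * n" by simp
      also have "\<dots> \<le> (n - 1 - i) * n" using True ij by (intro mult_le_mono1) auto
      finally show ?thesis using that ij unfolding t_eq by (auto simp: fill_def)
    qed
    have "fill f (Suc t) = fill f t * E i j (f $$ (i, j))"
    proof (rule eq_matI)
      fix a b assume "a < dim_row (fill f t * E i j (f $$ (i, j)))" "b < dim_col (fill f t * E i j (f $$ (i, j)))"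
      then have ab: "a < n" "b < n" by (auto simp: fill_def E_def)
      have "fill f t $$ (i, j) = 0" using True ij uniq[of i j] by (auto simp: fill_def)
      moreover have "fill f t $$ (a, a) = 1" using ab by (simp add: fill_def)
      ultimately show "fill f (Suc t) $$ (a, b) = (fill f t * E i j (f $$ (i, j))) $$ (a, b)"
        using True ab ij by (auto simp: step mult_E[OF UT_carrier_mat[OF fill_UT[OF f]]] col simp del: index_mult_mat)
    qed (auto simp: fill_def E_def)
    then show ?thesis using True ij by blast
  next
    case False
    have "fill f (Suc t) = fill f t"
    proof (rule eq_matI)
      fix a b assume "a < dim_row (fill f t)" "b < dim_col (fill f t)"
      then have ab: "a < n" "b < n" by (auto simp: fill_def)
      show "fill f (Suc t) $$ (a, b) = fill f t $$ (a, b)"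
        unfolding step[OF ab] using False ab UT_lower[OF f, of b a] by (auto simp: fill_def)
    qed (auto simp: fill_def)
    then show ?thesis by blast
  qed
qed

text \<open>The counter in \<open>P\<close> bounds the number of factors used, at most
  \<open>n * n\<close> in all, so that the induction also yields bounds on word length.\<close>

lemma UT_induct [consumes 1, case_names one skip mult]:
  assumes f: "f \<in> UT n Zi" and "P 0 (1\<^sub>m n)" and "\<And>t g. g \<in> UT n Zi \<Longrightarrow> P t g \<Longrightarrow> P (Suc t) g"
    and "\<And>t g i j. g \<in> UT n Zi \<Longrightarrow> i < j \<Longrightarrow> j < n \<Longrightarrow> P t g \<Longrightarrow> P (Suc t) (g * E i j (f $$ (i, j)))"
  shows "P (n * n) f"
proof -
  have "t \<le> n * n \<Longrightarrow> P t (fill f t)" for t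
  proof (induction t)
    case 0
    then show ?case using assms(2) by (simp add: fill_0)
  next
    case (Suc t)
    then have "P t (fill f t)" by simp
    then show ?case using fill_step[OF f, of t] assms(3,4)[OF fill_UT[OF f]] Suc.prems
      by (metis Suc_le_lessD)
  qed
  from this[of "n * n"] show ?thesis using fill_all[OF f] by simp
qed

text \<open>No unitriangular matrix has to be inverted: each element is a product of elementary
  elements and a translation, whose inverses come from negating the parameter, and units are closed
  under products.\<close>

lemma group_G: "group G"
proof (rule group.intro[OF monoid_G], rule group_axioms.intro, rule subsetI)
  interpret monoid G by (rule monoid_G)
  have el: "el i j c \<in> Units G" if "i < j" "j < n" "c \<in> Zi" for i j c
    unfolding Units_def using el_add[of i j c "- c"] el_add[of i j "- c" c] el_carrier that Zi_uminus
    by (auto simp: el_0 intro!: bexI[of _ "el i j (- c)"])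
  have tr: "tr x \<in> Units G" if "x \<in> carrier_vec n" for x
    unfolding Units_def using tr_add[of x "- x"] tr_add[of "- x" x] that tr_carrier
    by (auto simp: tr_0 uminus_l_inv_vec uminus_r_inv_vec intro!: bexI[of _ "tr (- x)"])
  fix g assume "g \<in> carrier G"
  then obtain x f where g: "g = (x, f)" "x \<in> carrier_vec n" "f \<in> UT n Zi"
    by (auto simp: G_carrier)
  have "(0\<^sub>v n, f) \<in> Units G"
    using g(3)
  proof (induction rule: UT_induct)
    case one
    have "\<one>\<^bsub>G\<^esub> \<in> Units G" by (rule Units_one_closed)
    then show ?case by (simp add: G_one)
  next
    case (mult t h i j)
    then show ?case
      using Units_m_closed[OF mult(4) el[of i j "f $$ (i, j)"]] UT_Zi[OF g(3)] by (simp add: UT_el)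
  qed
  from Units_m_closed[OF this tr[OF g(2)]] show "g \<in> Units G" using g by (simp add: UT_tr)
qed

sublocale G: group G by (rule group_G)

end

section \<open>Word length\<close>

definition symmetrize :: "('a, 'b) monoid_scheme \<Rightarrow> 'a set \<Rightarrow> 'a set" where
  "symmetrize G S = S \<union> (\<lambda>s. inv\<^bsub>G\<^esub> s) ` S"

abbreviation word_prod :: "('a, 'b) monoid_scheme \<Rightarrow> 'a list \<Rightarrow> 'a" where
  "word_prod G ws \<equiv> foldr (\<lambda>a b. a \<otimes>\<^bsub>G\<^esub> b) ws \<one>\<^bsub>G\<^esub>"

locale generated_group = group G for G :: "('a, 'b) monoid_scheme" (structure) +
  fixes S :: "'a set"
  assumes S_subset: "S \<subseteq> carrier G" and generate_S: "generate G S = carrier G"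
begin

abbreviation "wl \<equiv> word_length G S"
abbreviation "T \<equiv> symmetrize G S"

lemma T_subset: "T \<subseteq> carrier G"
  using S_subset by (auto simp: symmetrize_def)

lemma T_inv: "s \<in> T \<Longrightarrow> inv s \<in> T"
  using S_subset by (auto simp: symmetrize_def)

lemma word_prod_closed: "set ws \<subseteq> T \<Longrightarrow> word_prod G ws \<in> carrier G"
  using T_subset by (induction ws) auto

lemma word_prod_append:
  "set us \<subseteq> T \<Longrightarrow> set ws \<subseteq> T \<Longrightarrow> word_prod G (us @ ws) = word_prod G us \<otimes> word_prod G ws"
proof (induction us)
  case Nil
  then show ?case using word_prod_closed by simp
next
  case (Cons a us)
  then show ?case using word_prod_closed[of us] word_prod_closed[of ws] T_subset
    by (auto simp: m_assoc simp del: foldr_append)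
qed

lemma word_prod_inv: "set ws \<subseteq> T \<Longrightarrow> word_prod G (map (\<lambda>s. inv s) (rev ws)) = inv (word_prod G ws)"
proof (induction ws)
  case (Cons a ws)
  have a: "a \<in> T" "a \<in> carrier G" using Cons.prems T_subset by auto
  have "word_prod G (map (\<lambda>s. inv s) (rev (a # ws)))
      = word_prod G (map (\<lambda>s. inv s) (rev ws)) \<otimes> word_prod G [inv a]"
    using Cons.prems T_inv word_prod_append[of "map (\<lambda>s. inv s) (rev ws)" "[inv a]"] by auto
  also have "\<dots> = inv (word_prod G ws) \<otimes> inv a" using Cons a by simp
  also have "\<dots> = inv (a \<otimes> word_prod G ws)"
    using a word_prod_closed[of ws] Cons.prems by (simp add: inv_mult_group)
  finally show ?case by simp
qed simp

lemma word_exists: "g \<in> carrier G \<Longrightarrow> \<exists>ws. set ws \<subseteq> T \<and> word_prod G ws = g"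
  unfolding generate_S[symmetric]
proof (induction rule: generate.induct)
  case one
  show ?case by (rule exI[of _ "[]"]) simp
next
  case (incl h)
  then show ?case using S_subset by (intro exI[of _ "[h]"]) (auto simp: symmetrize_def)
next
  case (inv h)
  then show ?case using S_subset by (intro exI[of _ "[inv h]"]) (auto simp: symmetrize_def)
next
  case (eng h1 h2)
  then obtain us ws where "set us \<subseteq> T" "word_prod G us = h1" "set ws \<subseteq> T" "word_prod G ws = h2"
    by blast
  then show ?case using word_prod_append by (intro exI[of _ "us @ ws"]) auto
qed

text \<open>Since \<open>S\<close> generates the group, some word exists and the
  \<open>LEAST\<close> in \<open>word_length\<close> is attained.\<close>

lemma wl_word:
  assumes "g \<in> carrier G"
  obtains ws where "length ws = wl g" "set ws \<subseteq> T" "word_prod G ws = g"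
proof -
  from word_exists[OF assms]
  have "\<exists>k ws. length ws = k \<and> set ws \<subseteq> S \<union> (\<lambda>s. inv s) ` S \<and> word_prod G ws = g"
    unfolding symmetrize_def by blast
  from LeastI_ex[OF this] show ?thesis
    using that unfolding word_length_def symmetrize_def by blast
qed

lemma wl_le: "set ws \<subseteq> T \<Longrightarrow> wl (word_prod G ws) \<le> length ws"
  unfolding word_length_def symmetrize_def by (rule Least_le) blast

lemma wl_one: "wl \<one> = 0"
  using wl_le[of "[]"] by simp

lemma wl_mult:
  assumes "g \<in> carrier G" "h \<in> carrier G"
  shows "wl (g \<otimes> h) \<le> wl g + wl h"
proof -
  obtain us where us: "length us = wl g" "set us \<subseteq> T" "word_prod G us = g"
    using wl_word[OF assms(1)] .
  obtain ws where ws: "length ws = wl h" "set ws \<subseteq> T" "word_prod G ws = h"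
    using wl_word[OF assms(2)] .
  show ?thesis using wl_le[of "us @ ws"] word_prod_append[of us ws] us ws by (simp del: foldr_append)
qed

lemma wl_inv: assumes "g \<in> carrier G" shows "wl (inv g) \<le> wl g"
proof -
  obtain us where us: "length us = wl g" "set us \<subseteq> T" "word_prod G us = g"
    using wl_word[OF assms] .
  have "set (map (\<lambda>s. inv s) (rev us)) \<subseteq> T" using us T_inv by auto
  from wl_le[OF this] show ?thesis using word_prod_inv[of us] us by simp
qed

end

locale padic_generated = padic_group p n + generated_group "semidirect p n" S
  for p n :: nat and S :: "elt set"
begin

text \<open>One induction step per base-\<open>p\<close> digit: for \<open>a = r + p * q\<close> the
  digit \<open>r\<close> costs at most \<open>p\<close> copies of \<open>el i j 1\<close>, and
  \<open>p * q\<close> is obtained from \<open>q\<close> through conjugation by \<open>tr e\<close>,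
  since \<open>e $ i - e $ j = 1\<close>.\<close>

lemma wl_el_nat_le:
  assumes ij: "i < j" "j < n" and a: "a < p ^ K"
  defines "e \<equiv> unit_vec n i :: int vec"
  shows "wl (el i j (of_nat a)) \<le> K * (p * wl (el i j 1) + wl (tr e) + wl (tr (- e)))"
  using a
proof (induction K arbitrary: a)
  case 0
  then show ?case using wl_one by (simp add: el_0)
next
  case (Suc K)
  note c = el_carrier[OF ij]
  have e: "e \<in> carrier_vec n" "- e \<in> carrier_vec n" "e $ i - e $ j = 1"
    using ij by (auto simp: e_def)
  have small: "wl (el i j (of_nat r)) \<le> r * wl (el i j 1)" for r
  proof (induction r)
    case 0
    then show ?case using wl_one by (simp add: el_0)
  next
    case (Suc r)
    have "el i j (of_nat (Suc r)) = el i j (of_nat r) \<otimes>\<^bsub>G\<^esub> el i j 1"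
      by (simp add: el_add[OF ij] add.commute)
    then show ?case using Suc wl_mult[OF c c, of "of_nat r" 1] by simp
  qed
  let ?q = "a div p" and ?r = "a mod p"
  have "?q < p ^ K" using Suc.prems by (simp add: less_mult_imp_div_less mult.commute)
  note IH = Suc.IH[OF this]
  have "el i j (of_nat a) = el i j (of_nat ?r) \<otimes>\<^bsub>G\<^esub> el i j (of_nat p * of_nat ?q)"
    unfolding el_add[OF ij] of_nat_mult[symmetric] of_nat_add[symmetric] by simp
  also have "el i j (of_nat p * of_nat ?q) = tr e \<otimes>\<^bsub>G\<^esub> el i j (of_nat ?q) \<otimes>\<^bsub>G\<^esub> tr (- e)"
    using tr_el_tr[OF e(1) ij, of "of_nat ?q"] e(3) by simp
  finally have eq: "el i j (of_nat a) =
    el i j (of_nat ?r) \<otimes>\<^bsub>G\<^esub> (tr e \<otimes>\<^bsub>G\<^esub> el i j (of_nat ?q) \<otimes>\<^bsub>G\<^esub> tr (- e))" .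
  note cl = c[of "of_nat ?r"] c[of "of_nat ?q"] tr_carrier[OF e(1)] tr_carrier[OF e(2)]
  have 1: "wl (el i j (of_nat a)) \<le>
     wl (el i j (of_nat ?r)) + wl (tr e \<otimes>\<^bsub>G\<^esub> el i j (of_nat ?q) \<otimes>\<^bsub>G\<^esub> tr (- e))"
    unfolding eq using cl by (intro wl_mult) auto
  have 2: "wl (tr e \<otimes>\<^bsub>G\<^esub> el i j (of_nat ?q) \<otimes>\<^bsub>G\<^esub> tr (- e)) \<le>
     wl (tr e \<otimes>\<^bsub>G\<^esub> el i j (of_nat ?q)) + wl (tr (- e))"
    using cl by (intro wl_mult) auto
  have 3: "wl (tr e \<otimes>\<^bsub>G\<^esub> el i j (of_nat ?q)) \<le> wl (tr e) + wl (el i j (of_nat ?q))"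
    using cl by (intro wl_mult) auto
  have 4: "wl (el i j (of_nat ?r)) \<le> p * wl (el i j 1)"
    using order_trans[OF small[of ?r] mult_le_mono1[of ?r p]] by simp
  from 1 2 3 4 IH show ?case by simp
qed

lemma wl_tr_coord:
  fixes z :: int
  assumes i: "i < n"
  shows "wl (tr (z \<cdot>\<^sub>v unit_vec n i)) \<le> nat \<bar>z\<bar> * wl (tr (unit_vec n i))"
proof -
  let ?e = "unit_vec n i :: int vec"
  have nat: "wl (tr (int k \<cdot>\<^sub>v ?e)) \<le> k * wl (tr ?e)" for k
  proof (induction k)
    case 0
    have "(0 :: int) \<cdot>\<^sub>v ?e = 0\<^sub>v n" by auto
    then show ?case using wl_one by (simp add: tr_0)
  next
    case (Suc k)
    have "int (Suc k) \<cdot>\<^sub>v ?e = int k \<cdot>\<^sub>v ?e + ?e" by (auto simp: algebra_simps)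
    then have "tr (int (Suc k) \<cdot>\<^sub>v ?e) = tr (int k \<cdot>\<^sub>v ?e) \<otimes>\<^bsub>G\<^esub> tr ?e"
      using tr_add[of "int k \<cdot>\<^sub>v ?e" ?e] by simp
    then show ?case using Suc wl_mult[of "tr (int k \<cdot>\<^sub>v ?e)" "tr ?e"] by (simp add: tr_carrier)
  qed
  show ?thesis
  proof (cases "z \<ge> 0")
    case True
    then show ?thesis using nat[of "nat z"] by simp
  next
    case False
    let ?k = "nat (- z)"
    have "z \<cdot>\<^sub>v ?e + int ?k \<cdot>\<^sub>v ?e = 0\<^sub>v n" using False by (auto simp: algebra_simps)
    then have "tr (z \<cdot>\<^sub>v ?e) \<otimes>\<^bsub>G\<^esub> tr (int ?k \<cdot>\<^sub>v ?e) = \<one>\<^bsub>G\<^esub>"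
      using tr_add[of "z \<cdot>\<^sub>v ?e" "int ?k \<cdot>\<^sub>v ?e"] by (simp add: tr_0)
    then have "tr (z \<cdot>\<^sub>v ?e) = inv\<^bsub>G\<^esub> tr (int ?k \<cdot>\<^sub>v ?e)"
      by (intro G.inv_equality[symmetric]) (auto simp: tr_carrier)
    then show ?thesis using wl_inv[OF tr_carrier, of "int ?k \<cdot>\<^sub>v ?e"] nat[of ?k] False by simp
  qed
qed

lemma wl_tr_le:
  assumes x: "x \<in> carrier_vec n" and K: "\<And>i. i < n \<Longrightarrow> \<bar>x $ i\<bar> \<le> int K"
  shows "wl (tr x) \<le> K * (\<Sum>i<n. wl (tr (unit_vec n i)))"
proof -
  define r where "r m = vec n (\<lambda>i. if i < m then x $ i else 0)" for m
  have r: "r m \<in> carrier_vec n" for m unfolding r_def by simp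
  have "m \<le> n \<Longrightarrow> wl (tr (r m)) \<le> K * (\<Sum>i<m. wl (tr (unit_vec n i)))" for m
  proof (induction m)
    case 0
    have "r 0 = 0\<^sub>v n" by (auto simp: r_def)
    then show ?case using wl_one by (simp add: tr_0)
  next
    case (Suc m)
    have "r (Suc m) = r m + (x $ m) \<cdot>\<^sub>v unit_vec n m"
      using Suc.prems by (intro eq_vecI) (auto simp: r_def less_Suc_eq)
    then have "tr (r (Suc m)) = tr (r m) \<otimes>\<^bsub>G\<^esub> tr ((x $ m) \<cdot>\<^sub>v unit_vec n m)"
      using tr_add[OF r[of m], of "(x $ m) \<cdot>\<^sub>v unit_vec n m"] by simp
    then have 1: "wl (tr (r (Suc m))) \<le> wl (tr (r m)) + wl (tr ((x $ m) \<cdot>\<^sub>v unit_vec n m))"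
      using wl_mult[of "tr (r m)" "tr ((x $ m) \<cdot>\<^sub>v unit_vec n m)"] r by (simp add: tr_carrier)
    have "nat \<bar>x $ m\<bar> \<le> K" using K[of m] Suc.prems by simp
    then have 2: "wl (tr ((x $ m) \<cdot>\<^sub>v unit_vec n m)) \<le> K * wl (tr (unit_vec n m))"
      using order_trans[OF wl_tr_coord[of m "x $ m"] mult_le_mono1] Suc.prems by simp
    show ?case using 1 2 Suc by (simp add: distrib_left)
  qed
  moreover have "r n = x" using x by (auto simp: r_def)
  ultimately show ?thesis by fastforce
qed

text \<open>The numerator has at most \<open>2 * K\<close> digits at cost \<open>C1\<close> each,
  and conjugation by \<open>- K\<close> times the unit vector divides by \<open>p ^ K\<close> at
  cost \<open>K * C2\<close> on either side. Negative numerators are handled as inverses.\<close>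

lemma wl_el_int_le:
  assumes ij: "i < j" "j < n"
  obtains C where "\<And>a K. \<bar>a\<bar> < int p ^ (2 * K) \<Longrightarrow> wl (el i j (of_int a / of_nat p ^ K)) \<le> C * K"
proof -
  let ?e = "unit_vec n i :: int vec"
  define C1 where "C1 = p * wl (el i j 1) + wl (tr ?e) + wl (tr (- ?e))"
  define C2 where "C2 = wl (tr ?e)"
  have "wl (el i j (of_int a / of_nat p ^ K)) \<le> (2 * C1 + 2 * C2) * K" if "\<bar>a\<bar> < int p ^ (2 * K)" for a K
  proof -
    note c = el_carrier[OF ij]
    have pos: "wl (el i j (of_nat b)) \<le> 2 * K * C1" if "b < p ^ (2 * K)" for b
      using wl_el_nat_le[OF ij that] unfolding C1_def .
    have 1: "wl (el i j (of_int a)) \<le> 2 * K * C1"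
    proof (cases "a \<ge> 0")
      case True
      then have "nat a < p ^ (2 * K)" using \<open>\<bar>a\<bar> < int p ^ (2 * K)\<close> by (simp add: nat_less_iff)
      from pos[OF this] True show ?thesis by simp
    next
      case False
      then have "nat (- a) < p ^ (2 * K)" using \<open>\<bar>a\<bar> < int p ^ (2 * K)\<close> by (simp add: nat_less_iff)
      from pos[OF this] False have p: "wl (el i j (- of_int a)) \<le> 2 * K * C1" by simp
      have "el i j (of_int a) = inv\<^bsub>G\<^esub> (el i j (- of_int a))"
        using c[of "of_int a"] c[of "of_int (- a)"] Zi_of_int[of "- a"]
        by (intro G.inv_equality[symmetric]) (auto simp: el_add[OF ij] el_0)
      then show ?thesis using wl_inv[OF c, of "of_int (- a)"] p Zi_of_int[of "- a"] by simp
    qed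
    let ?x = "(- int K) \<cdot>\<^sub>v ?e"
    have x: "?x \<in> carrier_vec n" by simp
    have mx: "- ?x = int K \<cdot>\<^sub>v ?e" by auto
    have d: "?x $ i - ?x $ j = - int K" using ij by simp
    have "tr ?x \<otimes>\<^bsub>G\<^esub> el i j (of_int a) \<otimes>\<^bsub>G\<^esub> tr (- ?x) = el i j (of_int a / of_nat p ^ K)"
      using tr_el_tr[OF x ij, of "of_int a"] unfolding d by (simp add: power_int_minus field_simps)
    moreover have "wl (tr ?x \<otimes>\<^bsub>G\<^esub> el i j (of_int a) \<otimes>\<^bsub>G\<^esub> tr (- ?x)) \<le>
        wl (tr ?x) + wl (el i j (of_int a)) + wl (tr (- ?x))"
    proof -
      have cl: "tr ?x \<in> carrier G" "el i j (of_int a) \<in> carrier G" "tr (- ?x) \<in> carrier G"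
        using x by (auto intro!: tr_carrier c)
      have "wl (tr ?x \<otimes>\<^bsub>G\<^esub> el i j (of_int a) \<otimes>\<^bsub>G\<^esub> tr (- ?x)) \<le>
        wl (tr ?x \<otimes>\<^bsub>G\<^esub> el i j (of_int a)) + wl (tr (- ?x))"
        using cl by (intro wl_mult) auto
      also have "\<dots> \<le> wl (tr ?x) + wl (el i j (of_int a)) + wl (tr (- ?x))"
        using wl_mult[OF cl(1,2)] by simp
      finally show ?thesis .
    qed
    moreover have "wl (tr ?x) \<le> K * C2" "wl (tr (- ?x)) \<le> K * C2"
      using wl_tr_coord[of i "- int K"] wl_tr_coord[of i "int K"] ij unfolding mx C2_def by auto
    ultimately show ?thesis using 1 by (simp add: algebra_simps)
  qed
  then show ?thesis by (rule that)
qed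

text \<open>The constant must precede \<open>K\<close> and serve all positions. Each of at most
  \<open>n * n\<close> elementary factors is charged with \<open>C1\<close>, the sum of the
  positional constants; \<open>C2\<close> pays for the translation.\<close>

lemma wl_upper_bound:
  obtains C where "\<And>x f K. (x, f) \<in> carrier G \<Longrightarrow> (\<And>i. i < n \<Longrightarrow> \<bar>x $ i\<bar> \<le> int K) \<Longrightarrow>
    (\<And>i j. i < j \<Longrightarrow> j < n \<Longrightarrow> \<exists>a. f $$ (i, j) = of_int a / of_nat p ^ K \<and> \<bar>a\<bar> < int p ^ (2 * K)) \<Longrightarrow>
    wl (x, f) \<le> C * K"
proof -
  have "\<exists>C. \<forall>a K. i < j \<longrightarrow> j < n \<longrightarrow> \<bar>a\<bar> < int p ^ (2 * K) \<longrightarrow> wl (el i j (of_int a / of_nat p ^ K)) \<le> C * K" for i j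
    using wl_el_int_le[of i j] by metis
  then have "\<forall>ij. \<exists>C. \<forall>a K. fst ij < snd ij \<longrightarrow> snd ij < n \<longrightarrow> \<bar>a\<bar> < int p ^ (2 * K) \<longrightarrow>
      wl (el (fst ij) (snd ij) (of_int a / of_nat p ^ K)) \<le> C * K" by blast
  from choice[OF this] obtain c where c0: "\<forall>ij. \<forall>a K. fst ij < snd ij \<longrightarrow> snd ij < n \<longrightarrow>
      \<bar>a\<bar> < int p ^ (2 * K) \<longrightarrow> wl (el (fst ij) (snd ij) (of_int a / of_nat p ^ K)) \<le> c ij * K"
    by blast
  have c: "wl (el i j (of_int a / of_nat p ^ K)) \<le> c (i, j) * K"
    if "i < j" "j < n" "\<bar>a\<bar> < int p ^ (2 * K)" for i j a K
    using c0[rule_format, of "(i, j)" a K] that by simp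
  define C1 where "C1 = (\<Sum>ij\<in>{..<n} \<times> {..<n}. c ij)"
  define C2 where "C2 = (\<Sum>i<n. wl (tr (unit_vec n i)))"
  have le: "c (i, j) \<le> C1" if "i < n" "j < n" for i j
    unfolding C1_def using that by (intro member_le_sum) auto
  have "wl (x, f) \<le> (n * n * C1 + C2) * K"
    if g: "(x, f) \<in> carrier G" and x: "\<And>i. i < n \<Longrightarrow> \<bar>x $ i\<bar> \<le> int K"
      and f: "\<And>i j. i < j \<Longrightarrow> j < n \<Longrightarrow> \<exists>a. f $$ (i, j) = of_int a / of_nat p ^ K \<and> \<bar>a\<bar> < int p ^ (2 * K)"
    for x f K
  proof -
    have xf: "x \<in> carrier_vec n" "f \<in> UT n Zi" using g by (auto simp: G_carrier)
    have cf: "(0\<^sub>v n, g) \<in> carrier G" if "g \<in> UT n Zi" for g using that by (simp add: G_carrier)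
    have "wl (0\<^sub>v n, f) \<le> n * n * (C1 * K)"
      using xf(2)
    proof (induction rule: UT_induct)
      case one
      show ?case using wl_one unfolding G_one by simp
    next
      case (mult t h i j)
      obtain a where a: "f $$ (i, j) = of_int a / of_nat p ^ K" "\<bar>a\<bar> < int p ^ (2 * K)"
        using f mult by blast
      have "wl (el i j (f $$ (i, j))) \<le> C1 * K"
        using c[OF mult(2,3) a(2)] mult_le_mono1[OF le[of i j], of K] mult(2,3) unfolding a(1) by linarith
      moreover have "wl (0\<^sub>v n, h * E i j (f $$ (i, j))) \<le> wl (0\<^sub>v n, h) + wl (el i j (f $$ (i, j)))"
        unfolding UT_el[OF mult(1), symmetric]
        by (intro wl_mult cf mult el_carrier UT_Zi[OF xf(2)]) (use mult in auto)
      ultimately show ?case using mult(4) by simp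
    qed simp
    moreover have "wl (tr x) \<le> K * C2" unfolding C2_def by (rule wl_tr_le[OF xf(1) x])
    moreover have "wl (x, f) \<le> wl (0\<^sub>v n, f) + wl (tr x)"
      unfolding UT_tr[OF xf(2,1), symmetric] by (intro wl_mult cf tr_carrier xf)
    ultimately show ?thesis by (simp add: algebra_simps)
  qed
  then show ?thesis by (rule that)
qed

end

section \<open>Growth of matrix entries along a walk with drift\<close>

text \<open>
  The real and the p-adic absolute value are treated simultaneously; they satisfy the following
  assumptions with \<open>s = 1\<close> and \<open>s = -1\<close>, respectively.
\<close>

locale padic_absval = padic_generated p n S for p n S +
  fixes w :: "rat \<Rightarrow> real" and s :: real
  assumes finite_S: "finite S"
    and w_0: "w 0 = 0" and w_1: "w 1 = 1"
    and w_mult: "w (x * y) = w x * w y"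
    and w_add: "w (x + y) \<le> w x + w y"
    and w_nonneg: "0 \<le> w x"
    and w_minus: "w (- x) = w x"
    and w_powi: "w (of_nat p powi k) = real p powr (s * of_int k)"
begin

lemma w_sum_le: "w (\<Sum>k\<in>A. f k) \<le> (\<Sum>k\<in>A. w (f k))"
proof (induction A rule: infinite_finite_induct)
  case (insert x F)
  then show ?case using w_add[of "f x" "\<Sum>k\<in>F. f k"] by simp
qed (auto simp: w_0)

text \<open>Read backwards, a lower bound for word length: prefixing a letter multiplies the bound
  on the entries by at most \<open>M\<close>. The lemma converts sublinear length of an increment
  into subexponential size of its entries.\<close>

lemma entry_lower_bound:
  obtains K where "K > 0"
    "\<And>g i j. g \<in> carrier G \<Longrightarrow> i < n \<Longrightarrow> j < n \<Longrightarrow> w (snd g $$ (i, j)) \<le> real p powr (K * real (wl g))"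
proof -
  define q where "q t i j = (\<Sum>k<n. w (snd t $$ (i, k)) * w (of_nat p powi (fst t $ k - fst t $ j)))"
    for t :: elt and i j
  \<comment> \<open>The summand 2 makes \<open>M\<close> exceed 1, so that its logarithm to base
    \<open>p\<close>, the constant \<open>K\<close>, is positive.\<close>
  define M where "M = 2 + (\<Sum>t\<in>T. \<Sum>i<n. \<Sum>j<n. q t i j)"
  have fin: "finite T" using finite_S by (simp add: symmetrize_def)
  have q_nonneg: "0 \<le> q t i j" for t i j
    unfolding q_def by (intro sum_nonneg mult_nonneg_nonneg w_nonneg)
  have q_le: "q t i j \<le> M" if "t \<in> T" "i < n" "j < n" for t i j
  proof -
    have "q t i j \<le> (\<Sum>j<n. q t i j)" using that q_nonneg by (intro member_le_sum) auto
    also have "\<dots> \<le> (\<Sum>i<n. \<Sum>j<n. q t i j)"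
      using that q_nonneg by (intro member_le_sum[of i "{..<n}" "\<lambda>i. \<Sum>j<n. q t i j"] sum_nonneg) auto
    also have "\<dots> \<le> (\<Sum>t\<in>T. \<Sum>i<n. \<Sum>j<n. q t i j)"
      using that q_nonneg fin
      by (intro member_le_sum[of t T "\<lambda>t. \<Sum>i<n. \<Sum>j<n. q t i j"] sum_nonneg) auto
    finally show ?thesis unfolding M_def by simp
  qed
  have "0 \<le> (\<Sum>t\<in>T. \<Sum>i<n. \<Sum>j<n. q t i j)" by (intro sum_nonneg q_nonneg)
  then have M: "M > 1" unfolding M_def by simp
  have word: "set ws \<subseteq> T \<Longrightarrow> i < n \<Longrightarrow> j < n \<Longrightarrow> w (snd (word_prod G ws) $$ (i, j)) \<le> M ^ length ws" for ws i j
  proof (induction ws arbitrary: i j)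
    case Nil
    then show ?case by (simp add: G_one w_0 w_1)
  next
    case (Cons t ws)
    obtain z h where t: "t = (z, h)" by (cases t)
    obtain x f where xf: "word_prod G ws = (x, f)" by (cases "word_prod G ws")
    have "(z, h) \<in> carrier G" "(x, f) \<in> carrier G"
      using Cons.prems T_subset word_prod_closed[of ws] unfolding t xf[symmetric] by auto
    then have c: "z \<in> carrier_vec n" "h \<in> carrier_mat n n" "f \<in> carrier_mat n n"
      by (auto simp: G_carrier UT_carrier_mat)
    have IH: "w (f $$ (k, j)) \<le> M ^ length ws" if "k < n" for k
      using Cons.IH[of k j] Cons.prems that xf by simp
    have "snd (word_prod G (t # ws)) $$ (i, j) = (h * tw z f) $$ (i, j)"
      unfolding t using c xf by (simp add: G_mult)
    also have "\<dots> = (\<Sum>k<n. h $$ (i, k) * (of_nat p powi (z $ k - z $ j) * f $$ (k, j)))"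
      using c Cons.prems by (simp add: index_mult_mat_sum[of _ n] tw_index del: index_mult_mat)
    also have "w \<dots> \<le> (\<Sum>k<n. w (h $$ (i, k)) * w (of_nat p powi (z $ k - z $ j)) * w (f $$ (k, j)))"
      by (rule order_trans[OF w_sum_le]) (simp add: w_mult mult.assoc)
    also have "\<dots> \<le> (\<Sum>k<n. w (h $$ (i, k)) * w (of_nat p powi (z $ k - z $ j)) * M ^ length ws)"
      using IH by (intro sum_mono mult_left_mono mult_nonneg_nonneg w_nonneg) auto
    also have "\<dots> = q t i j * M ^ length ws"
      unfolding q_def t by (simp add: sum_distrib_right)
    also have "\<dots> \<le> M * M ^ length ws"
      using q_le[of t i j] Cons.prems M by (intro mult_right_mono) auto
    finally show ?case by simp
  qed
  show ?thesis
  proof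
    show "log (real p) M > 0" using M real_p_gt_1 by simp
    fix g i j assume g: "g \<in> carrier G" and ij: "i < n" "j < n"
    obtain ws where ws: "length ws = wl g" "set ws \<subseteq> T" "word_prod G ws = g" using wl_word[OF g] .
    have "w (snd g $$ (i, j)) \<le> M ^ wl g" using word[OF ws(2) ij] ws by simp
    also have "\<dots> = M powr real (wl g)" using M by (simp add: powr_realpow)
    also have "\<dots> = (real p powr log (real p) M) powr real (wl g)" using M real_p_gt_1 by simp
    also have "\<dots> = real p powr (log (real p) M * real (wl g))" by (simp add: powr_powr)
    finally show "w (snd g $$ (i, j)) \<le> real p powr (log (real p) M * real (wl g))" .
  qed
qed

section \<open>Sequences of exponential growth rate at most \<open>\<gamma>\<close>\<close>

definition exp_bounded :: "real \<Rightarrow> (nat \<Rightarrow> real) \<Rightarrow> bool" where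
  "exp_bounded \<gamma> u \<longleftrightarrow> (\<exists>C\<ge>0. \<forall>m. u m \<le> C * real p powr (\<gamma> * real m))"

text \<open>The constant absorbs the finite initial segment; asymptotic estimates from the strong
  law thus become estimates for all \<open>m\<close>.\<close>

lemma exp_bounded_eventually:
  assumes "eventually (\<lambda>m. u m \<le> real p powr (\<gamma> * real m)) sequentially"
  shows "exp_bounded \<gamma> u"
proof -
  obtain M where M: "\<forall>m\<ge>M. u m \<le> real p powr (\<gamma> * real m)"
    using assms by (auto simp: eventually_sequentially)
  define C where "C = 1 + (\<Sum>m<M. \<bar>u m\<bar> / real p powr (\<gamma> * real m))"
  have C: "C \<ge> 1" unfolding C_def by (simp add: sum_nonneg)
  have "u m \<le> C * real p powr (\<gamma> * real m)" for m
  proof (cases "m < M")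
    case True
    have "\<bar>u m\<bar> / real p powr (\<gamma> * real m) \<le> (\<Sum>m<M. \<bar>u m\<bar> / real p powr (\<gamma> * real m))"
      using True by (intro member_le_sum) auto
    then have "\<bar>u m\<bar> / real p powr (\<gamma> * real m) \<le> C" unfolding C_def by simp
    then show ?thesis by (simp add: divide_le_eq)
  next
    case False
    then have "u m \<le> 1 * real p powr (\<gamma> * real m)" using M by simp
    also have "\<dots> \<le> C * real p powr (\<gamma> * real m)" using C by (intro mult_right_mono) auto
    finally show ?thesis .
  qed
  then show ?thesis unfolding exp_bounded_def using C by (intro exI[of _ C]) auto
qed

lemma exp_bounded_mult:
  assumes "exp_bounded \<gamma> u" "exp_bounded \<delta> h" "\<And>m. 0 \<le> u m" "\<And>m. 0 \<le> h m"
  shows "exp_bounded (\<gamma> + \<delta>) (\<lambda>m. u m * h m)"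
proof -
  obtain C D where C: "C \<ge> 0" "\<And>m. u m \<le> C * real p powr (\<gamma> * real m)"
    and D: "D \<ge> 0" "\<And>m. h m \<le> D * real p powr (\<delta> * real m)"
    using assms(1,2) unfolding exp_bounded_def by blast
  have "u m * h m \<le> (C * D) * real p powr ((\<gamma> + \<delta>) * real m)" for m
  proof -
    have "u m * h m \<le> (C * real p powr (\<gamma> * real m)) * (D * real p powr (\<delta> * real m))"
      using C D assms(3,4) by (intro mult_mono) auto
    also have "\<dots> = (C * D) * real p powr ((\<gamma> + \<delta>) * real m)"
      by (simp add: distrib_right powr_add)
    finally show ?thesis .
  qed
  then show ?thesis unfolding exp_bounded_def using C D by (intro exI[of _ "C * D"]) auto
qed

lemma exp_bounded_sum:
  assumes "finite A" "\<And>k. k \<in> A \<Longrightarrow> exp_bounded \<gamma> (u k)"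
  shows "exp_bounded \<gamma> (\<lambda>m. \<Sum>k\<in>A. u k m)"
  using assms
proof (induction A rule: finite_induct)
  case empty
  then show ?case unfolding exp_bounded_def by (intro exI[of _ 0]) auto
next
  case (insert x F)
  then obtain C D where C: "C \<ge> 0" "\<And>m. u x m \<le> C * real p powr (\<gamma> * real m)"
    and D: "D \<ge> 0" "\<And>m. (\<Sum>k\<in>F. u k m) \<le> D * real p powr (\<gamma> * real m)"
    unfolding exp_bounded_def by (metis insertCI)
  have "(\<Sum>k\<in>insert x F. u k m) \<le> (C + D) * real p powr (\<gamma> * real m)" for m
    using add_mono[OF C(2)[of m] D(2)[of m]] insert by (simp add: distrib_right)
  then show ?case unfolding exp_bounded_def using C D by (intro exI[of _ "C + D"]) auto
qed

lemma exp_bounded_le: "exp_bounded \<gamma> h \<Longrightarrow> (\<And>m. u m \<le> h m) \<Longrightarrow> exp_bounded \<gamma> u"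
  unfolding exp_bounded_def by (meson order_trans)

lemma exp_bounded_partial_sums:
  assumes \<gamma>: "\<gamma> > 0" and d: "exp_bounded \<gamma> d" and u: "u 0 = 0" "\<And>m. u (Suc m) \<le> u m + d m"
  shows "exp_bounded \<gamma> u"
proof -
  obtain C where C: "C \<ge> 0" "\<And>m. d m \<le> C * real p powr (\<gamma> * real m)"
    using d unfolding exp_bounded_def by blast
  define q where "q = real p powr \<gamma>"
  have q: "q > 1" unfolding q_def using \<gamma> real_p_gt_1 by simp
  \<comment> \<open>Solves \<open>D * q = D + C\<close>, which is exactly what the induction step
    requires.\<close>
  define D where "D = C / (q - 1)"
  have D: "D \<ge> 0" "D * q = D + C" unfolding D_def using C q by (auto simp: field_simps)
  have "u m \<le> D * real p powr (\<gamma> * real m)" for m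
  proof (induction m)
    case 0
    show ?case using u D by simp
  next
    case (Suc m)
    have "u (Suc m) \<le> (D + C) * real p powr (\<gamma> * real m)"
      using u(2)[of m] Suc C(2)[of m] by (simp add: distrib_right)
    also have "\<dots> = D * real p powr (\<gamma> * real (Suc m))"
      unfolding D(2)[symmetric] q_def by (simp add: distrib_left powr_add ac_simps)
    finally show ?case .
  qed
  then show ?thesis unfolding exp_bounded_def using D by blast
qed

lemma exp_decay_Cauchy:
  assumes \<gamma>: "\<gamma> < 0" and d: "exp_bounded \<gamma> (\<lambda>m. w (u (Suc m) - u m))" and e: "e > 0"
  shows "\<exists>M. \<forall>k\<ge>M. \<forall>l\<ge>M. w (u k - u l) < e"
proof -
  obtain C where C: "C \<ge> 0" "\<And>m. w (u (Suc m) - u m) \<le> C * real p powr (\<gamma> * real m)"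
    using d unfolding exp_bounded_def by blast
  define q where "q = real p powr \<gamma>"
  have q: "0 < q" "q < 1" unfolding q_def using \<gamma> real_p_gt_1 by (auto intro: powr_less_one)
  have qm: "real p powr (\<gamma> * real m) = q ^ m" for m
    unfolding q_def using real_p_gt_1 by (simp add: powr_powr[symmetric] powr_realpow)
  \<comment> \<open>The exact geometric sum, with its factor \<open>1 - q ^ k\<close>, lets the
    induction on \<open>k\<close> close; bounding that factor by 1 afterwards makes the estimate
    uniform in \<open>k\<close>.\<close>
  have tail: "w (u (m + k) - u m) \<le> C / (1 - q) * q ^ m * (1 - q ^ k)" for m k
  proof (induction k)
    case 0
    then show ?case by (simp add: w_0)
  next
    case (Suc k)
    have "w (u (m + Suc k) - u m) \<le> w (u (Suc (m + k)) - u (m + k)) + w (u (m + k) - u m)"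
      using w_add[of "u (Suc (m + k)) - u (m + k)" "u (m + k) - u m"] by simp
    also have "\<dots> \<le> C * q ^ (m + k) + C / (1 - q) * q ^ m * (1 - q ^ k)"
      using C(2)[of "m + k"] Suc unfolding qm by (intro add_mono) auto
    also have "C * q ^ (m + k) = C / (1 - q) * q ^ m * (q ^ k * (1 - q))"
      using q by (simp add: power_add)
    also have "C / (1 - q) * q ^ m * (q ^ k * (1 - q)) + C / (1 - q) * q ^ m * (1 - q ^ k)
        = C / (1 - q) * q ^ m * (1 - q ^ Suc k)"
      by (simp only: distrib_left[symmetric]) (simp add: algebra_simps)
    finally show ?case .
  qed
  have tail': "w (u k - u m) \<le> C / (1 - q) * q ^ m" if "k \<ge> m" for k m
  proof -
    have "C / (1 - q) * q ^ m * (1 - q ^ (k - m)) \<le> C / (1 - q) * q ^ m * 1"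
      using C q by (intro mult_left_mono) auto
    then show ?thesis using tail[of m "k - m"] that by simp
  qed
  have "(\<lambda>m. C / (1 - q) * q ^ m) \<longlonglongrightarrow> C / (1 - q) * 0"
    using q by (intro tendsto_mult_left LIMSEQ_realpow_zero) auto
  then have "eventually (\<lambda>m. C / (1 - q) * q ^ m < e / 2) sequentially"
    using e by (intro order_tendstoD(2)) auto
  then obtain M where M: "C / (1 - q) * q ^ M < e / 2" by (auto simp: eventually_sequentially)
  have "w (u k - u l) < e" if "k \<ge> M" "l \<ge> M" for k l
  proof -
    have "w (u k - u l) \<le> w (u k - u M) + w (u l - u M)"
      using w_add[of "u k - u M" "- (u l - u M)"] unfolding w_minus by simp
    then show ?thesis using tail'[OF that(1)] tail'[OF that(2)] M by linarith
  qed
  then show ?thesis by blast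
qed

text \<open>Strong induction on the column with \<open>\<gamma>\<close> generalised, because the
  entries further left are needed at another rate. Increments are estimated rather than entries,
  since an entry with a nonzero limit does not decay.\<close>

lemma walk_increment_decay:
  fixes g W :: "nat \<Rightarrow> elt" and d :: "nat \<Rightarrow> real"
  assumes g: "\<And>m. g (Suc m) \<in> carrier G"
    and W: "W 0 = \<one>\<^bsub>G\<^esub>" "\<And>m. W (Suc m) = W m \<otimes>\<^bsub>G\<^esub> g (Suc m)"
    and drift: "\<And>i e. i < n \<Longrightarrow> e > 0 \<Longrightarrow>
      eventually (\<lambda>m. \<bar>of_int (fst (W m) $ i) - d i * real m\<bar> \<le> e * real m) sequentially"
    and small: "\<And>e. e > 0 \<Longrightarrow> eventually (\<lambda>m. real (wl (g (Suc m))) \<le> e * real m) sequentially"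
    and ij: "i < j" "j < n" and \<gamma>: "\<And>l. i \<le> l \<Longrightarrow> l < j \<Longrightarrow> s * (d l - d j) < \<gamma>"
    and s: "\<bar>s\<bar> = 1"
  shows "exp_bounded \<gamma> (\<lambda>m. w (snd (W (Suc m)) $$ (i, j) - snd (W m) $$ (i, j)))"
  using ij \<gamma>
proof (induction j arbitrary: \<gamma> rule: less_induct)
  case (less j)
  note ij = less.prems(1,2) and \<gamma> = less.prems(3)
  have W_carrier: "W m \<in> carrier G" for m
    by (induction m) (auto simp: W g)
  then have W_UT: "snd (W m) \<in> UT n Zi" and W_vec: "fst (W m) \<in> carrier_vec n" for m
    using G_carrier by (auto simp: mem_Times_iff)
  have g_UT: "snd (g (Suc m)) \<in> UT n Zi" for m
    using g[of m] G_carrier by (auto simp: mem_Times_iff)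
  let ?\<phi> = "\<lambda>m k. snd (W m) $$ (i, k)"
  let ?x = "\<lambda>m k. fst (W m) $ k"
  let ?g = "\<lambda>m k. snd (g (Suc m)) $$ (k, j)"
  \<comment> \<open>Triangularity removes the terms with \<open>k < i\<close> or
    \<open>k > j\<close>. The term \<open>k = j\<close> is the old entry, because the increment has
    diagonal 1 and the twist there is \<open>p ^ 0\<close>.\<close>
  have incr: "?\<phi> (Suc m) j - ?\<phi> m j =
      (\<Sum>k\<in>{i..<j}. ?\<phi> m k * (of_nat p powi (?x m k - ?x m j) * ?g m k))" for m
  proof -
    have "snd (W (Suc m)) = snd (W m) * tw (fst (W m)) (snd (g (Suc m)))"
      unfolding W(2) using G_mult[OF W_vec UT_carrier_mat[OF g_UT]] by (metis prod.collapse snd_conv)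
    then have "?\<phi> (Suc m) j = (\<Sum>k<n. ?\<phi> m k * (of_nat p powi (?x m k - ?x m j) * ?g m k))"
      using ij UT_carrier_mat[OF W_UT]
      by (simp add: index_mult_mat_sum[of _ n] tw_index del: index_mult_mat)
    also have "\<dots> = (\<Sum>k\<in>{i..j}. ?\<phi> m k * (of_nat p powi (?x m k - ?x m j) * ?g m k))"
      using ij UT_lower[OF W_UT, of _ i m] UT_lower[OF g_UT, of j _ m]
      by (intro sum.mono_neutral_right) (auto simp: not_le)
    also have "{i..j} = insert j {i..<j}" using ij by auto
    finally show ?thesis using UT_diag[OF g_UT ij(2)] by simp
  qed
  define E' where "E' = Max ((\<lambda>l. s * (d l - d j)) ` {i..<j})"
  have E'_le: "s * (d l - d j) \<le> E'" if "l \<in> {i..<j}" for l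
    unfolding E'_def using that by (intro Max_ge) auto
  have "E' \<in> (\<lambda>l. s * (d l - d j)) ` {i..<j}" unfolding E'_def using ij by (intro Max_in) auto
  then have "E' < \<gamma>" using \<gamma> by auto
  \<comment> \<open>Of the four parts of the gap, one pays for the fluctuation of the coordinates,
    one for the entries of the increment, and one keeps the rate \<open>\<beta>\<close> below
    strictly above the drifts.\<close>
  define \<epsilon> where "\<epsilon> = (\<gamma> - E') / 4"
  have \<epsilon>: "\<epsilon> > 0" using \<open>E' < \<gamma>\<close> by (simp add: \<epsilon>_def)
  have e_lt: "s * (d l - d j) + 3 * \<epsilon> < \<gamma>" if "l \<in> {i..<j}" for l
    using E'_le[OF that] \<open>E' < \<gamma>\<close> unfolding \<epsilon>_def by (simp add: field_simps)
  obtain K where K: "K > 0" "\<And>g i j. g \<in> carrier G \<Longrightarrow> i < n \<Longrightarrow> j < n \<Longrightarrow>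
      w (snd g $$ (i, j)) \<le> real p powr (K * real (wl g))"
    using entry_lower_bound by blast
  have summand: "exp_bounded \<gamma> (\<lambda>m. w (?\<phi> m k) * (w (of_nat p powi (?x m k - ?x m j)) * w (?g m k)))"
    if k: "k \<in> {i..<j}" for k
  proof -
    \<comment> \<open>The rate left for the entry \<open>(i, k)\<close>. It is positive because
      \<open>k\<close> is itself among the indices that \<open>\<gamma>\<close> dominates, and it
      exceeds \<open>s * (d l - d k)\<close> for \<open>i \<le> l < k\<close> because the
      differences of drifts telescope.\<close>
    define \<beta> where "\<beta> = \<gamma> - s * (d k - d j) - 2 * \<epsilon>"
    have \<beta>: "\<beta> > 0" using e_lt[OF k] \<epsilon> unfolding \<beta>_def by simp
    have 1: "exp_bounded \<beta> (\<lambda>m. w (?\<phi> m k))"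
    proof (cases "k = i")
      case True
      have "w (?\<phi> m k) = 1" for m using UT_diag[OF W_UT, of i m] True ij by (simp add: w_1)
      moreover have "real p powr (\<beta> * real m) \<ge> 1" for m
        using \<beta> real_p_gt_1 by (intro ge_one_powr_ge_zero) auto
      ultimately show ?thesis by (intro exp_bounded_eventually) simp
    next
      case False
      then have ik: "i < k" "k < j" "k < n" using k ij by auto
      have lt: "s * (d l - d k) < \<beta>" if "i \<le> l" "l < k" for l
      proof -
        have "s * (d l - d k) = s * (d l - d j) - s * (d k - d j)" by (simp add: algebra_simps)
        then show ?thesis using e_lt[of l] that ik \<epsilon> unfolding \<beta>_def by simp
      qed
      have "exp_bounded \<beta> (\<lambda>m. w (?\<phi> (Suc m) k - ?\<phi> m k))"
        by (rule less.IH[OF ik(2,1,3) lt])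
      then show ?thesis
      proof (rule exp_bounded_partial_sums[OF \<beta>])
        show "w (?\<phi> 0 k) = 0" using ik by (simp add: W(1) G_one w_0)
        show "w (?\<phi> (Suc m) k) \<le> w (?\<phi> m k) + w (?\<phi> (Suc m) k - ?\<phi> m k)" for m
          using w_add[of "?\<phi> m k" "?\<phi> (Suc m) k - ?\<phi> m k"] by simp
      qed
    qed
    \<comment> \<open>Each of the two coordinates may deviate from its drift by
      \<open>\<epsilon> / 2\<close> per step.\<close>
    have 2: "exp_bounded (s * (d k - d j) + \<epsilon>) (\<lambda>m. w (of_nat p powi (?x m k - ?x m j)))"
    proof (rule exp_bounded_eventually)
      have "k < n" using k ij by simp
      from drift[OF this half_gt_zero[OF \<epsilon>]] drift[OF ij(2) half_gt_zero[OF \<epsilon>]]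
      show "eventually (\<lambda>m. w (of_nat p powi (?x m k - ?x m j)) \<le>
          real p powr ((s * (d k - d j) + \<epsilon>) * real m)) sequentially"
      proof eventually_elim
        case (elim m)
        define a where "a = of_int (?x m k) - d k * real m"
        define b where "b = of_int (?x m j) - d j * real m"
        have ab: "\<bar>a\<bar> \<le> \<epsilon> / 2 * real m" "\<bar>b\<bar> \<le> \<epsilon> / 2 * real m" using elim by (auto simp: a_def b_def)
        have "s * (a - b) \<le> \<bar>s\<bar> * \<bar>a - b\<bar>" by (metis abs_ge_self abs_mult)
        also have "\<dots> \<le> \<epsilon> * real m" using ab abs_triangle_ineq4[of a b] by (simp add: s)
        finally have "s * (of_int (?x m k) - of_int (?x m j)) \<le> (s * (d k - d j) + \<epsilon>) * real m"
          unfolding a_def b_def by (simp add: algebra_simps)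
        then show ?case unfolding w_powi using real_p_gt_1 by simp
      qed
    qed
    have 3: "exp_bounded \<epsilon> (\<lambda>m. w (?g m k))"
    proof (rule exp_bounded_eventually)
      have "\<epsilon> / K > 0" using \<epsilon> K by simp
      from small[OF this]
      show "eventually (\<lambda>m. w (?g m k) \<le> real p powr (\<epsilon> * real m)) sequentially"
      proof eventually_elim
        case (elim m)
        have "w (?g m k) \<le> real p powr (K * real (wl (g (Suc m))))"
          using K(2)[OF g] k ij by simp
        also have "K * real (wl (g (Suc m))) \<le> \<epsilon> * real m"
          using elim K by (simp add: field_simps)
        then have "real p powr (K * real (wl (g (Suc m)))) \<le> real p powr (\<epsilon> * real m)"
          using real_p_gt_1 by simp
        finally show ?case .
      qed
    qed
    have "exp_bounded (\<beta> + (s * (d k - d j) + \<epsilon> + \<epsilon>))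
        (\<lambda>m. w (?\<phi> m k) * (w (of_nat p powi (?x m k - ?x m j)) * w (?g m k)))"
      by (intro exp_bounded_mult 1 2 3 w_nonneg mult_nonneg_nonneg)
    then show ?thesis by (simp add: \<beta>_def)
  qed
  have "exp_bounded \<gamma> (\<lambda>m. \<Sum>k\<in>{i..<j}. w (?\<phi> m k) * (w (of_nat p powi (?x m k - ?x m j)) * w (?g m k)))"
    by (rule exp_bounded_sum) (use summand in auto)
  then show ?case
  proof (rule exp_bounded_le)
    show "w (?\<phi> (Suc m) j - ?\<phi> m j) \<le>
      (\<Sum>k\<in>{i..<j}. w (?\<phi> m k) * (w (of_nat p powi (?x m k - ?x m j)) * w (?g m k)))" for m
      unfolding incr using w_sum_le by (simp add: w_mult[symmetric])
  qed
qed

text \<open>The finitely many drifts involved are negative, so their maximum \<open>E'\<close> is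
  negative too, and \<open>E' / 2\<close> is a decaying rate above all of them.\<close>

lemma walk_entry_Cauchy:
  fixes g W :: "nat \<Rightarrow> elt" and d :: "nat \<Rightarrow> real"
  assumes "\<And>m. g (Suc m) \<in> carrier G"
    and "W 0 = \<one>\<^bsub>G\<^esub>" "\<And>m. W (Suc m) = W m \<otimes>\<^bsub>G\<^esub> g (Suc m)"
    and "\<And>i e. i < n \<Longrightarrow> e > 0 \<Longrightarrow>
      eventually (\<lambda>m. \<bar>of_int (fst (W m) $ i) - d i * real m\<bar> \<le> e * real m) sequentially"
    and "\<And>e. e > 0 \<Longrightarrow> eventually (\<lambda>m. real (wl (g (Suc m))) \<le> e * real m) sequentially"
    and ij: "i < j" "j < n" and neg: "\<And>l. l < j \<Longrightarrow> s * (d l - d j) < 0"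
    and "\<bar>s\<bar> = 1" and e: "e > 0"
  shows "\<exists>M. \<forall>k\<ge>M. \<forall>l\<ge>M. w (snd (W k) $$ (i, j) - snd (W l) $$ (i, j)) < e"
proof -
  define E' where "E' = Max ((\<lambda>l. s * (d l - d j)) ` {i..<j})"
  have E'_le: "s * (d l - d j) \<le> E'" if "i \<le> l" "l < j" for l
    unfolding E'_def using that by (intro Max_ge) auto
  have "E' \<in> (\<lambda>l. s * (d l - d j)) ` {i..<j}" unfolding E'_def using ij by (intro Max_in) auto
  then have E': "E' < 0" using neg by auto
  have "exp_bounded (E' / 2) (\<lambda>m. w (snd (W (Suc m)) $$ (i, j) - snd (W m) $$ (i, j)))"
  proof (rule walk_increment_decay[where d = d and g = g])
    show "s * (d l - d j) < E' / 2" if "i \<le> l" "l < j" for l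
      using E'_le[OF that] E' by simp
  qed (fact assms)+
  then show ?thesis by (intro exp_decay_Cauchy[of "E' / 2"] e) (use E' in auto)
qed

end

section \<open>Convergence and approximation\<close>

text \<open>The denominator is a power of \<open>p\<close>, so the p-adic absolute value alone
  controls it.\<close>

lemma (in padic_prime) Z_inverse_scaled_Ints:
  assumes "x \<in> Z_inverse p" "v x \<le> real p ^ k"
  shows "of_nat p ^ k * x \<in> \<int>"
proof -
  obtain a l where a: "x = of_int a / of_nat p ^ l" using assms(1) unfolding Z_inverse_def by blast
  have eq: "of_int (int p ^ k * a) = of_nat p ^ l * (of_nat p ^ k * x)"
    by (simp add: a)
  have "v (of_int (int p ^ k * a)) = v x / real p ^ k / real p ^ l"
    unfolding eq v_p_power_times_le by simp
  also have "\<dots> \<le> 1 / real p ^ l" using assms(2) by (intro divide_right_mono) (auto simp: field_simps)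
  finally have "int p ^ l dvd int p ^ k * a" unfolding v_of_int_le .
  then obtain c where "int p ^ k * a = int p ^ l * c" by (auto elim: dvdE)
  then have "of_nat p ^ l * (of_nat p ^ k * x) = of_nat p ^ l * of_int c"
    unfolding eq[symmetric] by (simp only: of_int_mult of_int_power of_int_of_nat_eq)
  then have "of_nat p ^ k * x = of_int c" by simp
  then show ?thesis by simp
qed

locale padic_generated_finite = padic_generated p n S for p n S +
  assumes finite_S: "finite S"
begin

sublocale real_abs: padic_absval p n S "\<lambda>x. \<bar>real_of_rat x\<bar>" 1
proof unfold_locales
  show "\<bar>real_of_rat (of_nat p powi k)\<bar> = real p powr (1 * of_int k)" for k
  proof -
    have "real_of_rat (of_nat p powi k) = real p powi k"
      by (simp add: power_int_def of_rat_power of_rat_inverse)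
    then show ?thesis using real_p_gt_1 by (simp add: powr_real_of_int')
  qed
  show "\<bar>real_of_rat (x + y)\<bar> \<le> \<bar>real_of_rat x\<bar> + \<bar>real_of_rat y\<bar>" for x y
    unfolding of_rat_add by (rule abs_triangle_ineq)
qed (auto simp: finite_S of_rat_mult of_rat_minus abs_mult)

sublocale padic_abs: padic_absval p n S "padic_abs_rat p" "-1"
proof unfold_locales
  show "padic_abs_rat p (of_nat p powi k) = real p powr (- 1 * of_int k)" for k
  proof -
    have "real p powr (of_int (- k)) = real p powi (- k)"
      using real_p_gt_1 by (subst powr_real_of_int') auto
    then show ?thesis by (simp add: v_powi)
  qed
qed (auto simp: finite_S v_mult v_add v_minus)

text \<open>Coordinates are additive along words and change by at most \<open>Z\<close> per letter.
  This will make the coordinates of an increment integrable.\<close>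

lemma coordinate_bound:
  obtains Z where "Z \<ge> 0"
    "\<And>g i. g \<in> carrier G \<Longrightarrow> i < n \<Longrightarrow> \<bar>real_of_int (fst g $ i)\<bar> \<le> Z * real (wl g)"
proof -
  define Z where "Z = (\<Sum>t\<in>T. \<Sum>i<n. \<bar>real_of_int (fst t $ i)\<bar>)"
  have fin: "finite T" using finite_S by (simp add: symmetrize_def)
  have Z_le: "\<bar>real_of_int (fst t $ i)\<bar> \<le> Z" if "t \<in> T" "i < n" for t i
  proof -
    have "\<bar>real_of_int (fst t $ i)\<bar> \<le> (\<Sum>i<n. \<bar>real_of_int (fst t $ i)\<bar>)"
      using that by (intro member_le_sum) auto
    also have "\<dots> \<le> Z" unfolding Z_def
      using that fin by (intro member_le_sum[of t T "\<lambda>t. \<Sum>i<n. \<bar>real_of_int (fst t $ i)\<bar>"] sum_nonneg) auto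
    finally show ?thesis .
  qed
  have word: "set ws \<subseteq> T \<Longrightarrow> i < n \<Longrightarrow> \<bar>real_of_int (fst (word_prod G ws) $ i)\<bar> \<le> Z * real (length ws)" for ws i
  proof (induction ws)
    case Nil
    then show ?case by (simp add: G_one)
  next
    case (Cons t ws)
    obtain z h where t: "t = (z, h)" by (cases t)
    obtain x f where xf: "word_prod G ws = (x, f)" by (cases "word_prod G ws")
    have "(z, h) \<in> carrier G" "(x, f) \<in> carrier G"
      using Cons.prems T_subset word_prod_closed[of ws] unfolding t xf[symmetric] by auto
    then have c: "z \<in> carrier_vec n" "x \<in> carrier_vec n" "f \<in> carrier_mat n n"
      by (auto simp: G_carrier UT_carrier_mat)
    have "fst (word_prod G (t # ws)) $ i = z $ i + x $ i"
      unfolding t using c xf Cons.prems by (simp add: G_mult)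
    then have "\<bar>real_of_int (fst (word_prod G (t # ws)) $ i)\<bar> \<le> \<bar>real_of_int (z $ i)\<bar> + \<bar>real_of_int (x $ i)\<bar>"
      by simp
    also have "\<dots> \<le> Z + Z * real (length ws)"
      using Z_le[of t i] Cons xf t by (intro add_mono) auto
    finally show ?case by (simp add: distrib_left)
  qed
  show ?thesis
  proof
    show "Z \<ge> 0" unfolding Z_def by (intro sum_nonneg) auto
    fix g i assume g: "g \<in> carrier G" and i: "i < n"
    obtain ws where ws: "length ws = wl g" "set ws \<subseteq> T" "word_prod G ws = g" using wl_word[OF g] .
    show "\<bar>real_of_int (fst g $ i)\<bar> \<le> Z * real (wl g)" using word[OF ws(2) i] ws by simp
  qed
qed

end

lemma mem_strict_upper: "(i, j) \<in> strict_upper n \<longleftrightarrow> i < j \<and> j < n"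
  by (simp add: strict_upper_def)

text \<open>Collects what holds along almost every single path, so that convergence and the length
  estimate become deterministic statements.\<close>

locale drifting_walk = padic_generated_finite p n S for p n S +
  fixes \<mu> :: "elt pmf" and g W :: "nat \<Rightarrow> elt"
  assumes nonzero: "displacement_nonzero n \<mu>" and consistent: "column_consistent n \<mu>"
    and g: "\<And>m. g (Suc m) \<in> carrier (semidirect p n)"
    and W_0: "W 0 = \<one>\<^bsub>semidirect p n\<^esub>"
    and W_Suc: "\<And>m. W (Suc m) = W m \<otimes>\<^bsub>semidirect p n\<^esub> g (Suc m)"
    and drift: "\<And>i e. i < n \<Longrightarrow> e > 0 \<Longrightarrow>
      eventually (\<lambda>m. \<bar>of_int (fst (W m) $ i) - m1 (proj_law \<mu> i) * real m\<bar> \<le> e * real m) sequentially"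
    and small: "\<And>e. e > 0 \<Longrightarrow>
      eventually (\<lambda>m. real (word_length (semidirect p n) S (g (Suc m))) \<le> e * real m) sequentially"
begin

abbreviation "\<phi> \<equiv> \<lambda>m. snd (W m)"
abbreviation "disp \<equiv> displacement \<mu>"

lemma W_carrier: "W m \<in> carrier G"
  by (induction m) (auto simp: W_0 W_Suc g)

lemma \<phi>_UT: "\<phi> m \<in> UT n Zi"
  using W_carrier[of m] G_carrier by (auto simp: mem_Times_iff)

lemma disp_nonzero: "i < j \<Longrightarrow> j < n \<Longrightarrow> disp i j \<noteq> 0"
  using nonzero unfolding displacement_nonzero_def by blast

lemma disp_column: "i < j \<Longrightarrow> l < j \<Longrightarrow> j < n \<Longrightarrow> sgn (disp i j) = sgn (disp l j)"
  using consistent unfolding column_consistent_def by blast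

text \<open>Column consistency spreads the sign at \<open>(i, j)\<close> to all
  \<open>l < j\<close>, as the Cauchy criterion asks.\<close>

lemma real_convergent:
  assumes ij: "i < j" "j < n" and neg: "disp i j < 0"
  shows "convergent (\<lambda>m. real_of_rat (\<phi> m $$ (i, j)))"
proof (rule Cauchy_convergent, rule metric_CauchyI)
  fix e :: real assume e: "e > 0"
  have "1 * (m1 (proj_law \<mu> l) - m1 (proj_law \<mu> j)) < 0" if "l < j" for l
    using disp_column[OF ij(1) that ij(2)] neg unfolding displacement_def
    by (simp add: sgn_if split: if_splits)
  from real_abs.walk_entry_Cauchy[OF g W_0 W_Suc drift small ij this _ e]
  show "\<exists>M. \<forall>k\<ge>M. \<forall>l\<ge>M. dist (real_of_rat (\<phi> k $$ (i, j))) (real_of_rat (\<phi> l $$ (i, j))) < e"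
    by (simp add: dist_real_def of_rat_diff)
qed

lemma padic_convergent:
  assumes ij: "i < j" "j < n" and pos: "\<not> disp i j < 0"
  shows "(\<lambda>m. \<phi> m $$ (i, j)) \<in> padic_cauchy p"
  unfolding padic_cauchy_def
proof (intro CollectI allI impI)
  fix e :: real assume e: "e > 0"
  have "- 1 * (m1 (proj_law \<mu> l) - m1 (proj_law \<mu> j)) < 0" if "l < j" for l
    using disp_column[OF ij(1) that ij(2)] disp_nonzero[OF ij] pos unfolding displacement_def
    by (simp add: sgn_if split: if_splits)
  from padic_abs.walk_entry_Cauchy[OF g W_0 W_Suc drift small ij this _ e]
  show "\<exists>M. \<forall>k\<ge>M. \<forall>l\<ge>M. padic_abs_rat p (\<phi> k $$ (i, j) - \<phi> l $$ (i, j)) < e"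
    by simp
qed

text \<open>The explicit candidate for the definite description \<open>limit_point\<close>. A p-adic
  limit is simply the class of the sequence of entries.\<close>

definition bdry_limit :: bdry where
  "bdry_limit = (\<lambda>(i, j)\<in>strict_upper n. if disp i j < 0
     then Inl (lim (\<lambda>m. real_of_rat (\<phi> m $$ (i, j)))) else Inr (cls (\<lambda>m. \<phi> m $$ (i, j))))"

lemma bdry_limit_Gamma: "bdry_limit \<in> Gamma_bdry p n \<mu>"
  unfolding bdry_limit_def Gamma_bdry_def
  using padic_convergent by (auto simp: strict_upper_def)

lemma converges_bdry_limit: "converges_entrywise p n \<mu> \<phi> bdry_limit"
  unfolding converges_entrywise_def
proof (clarify)
  fix i j assume ij': "(i, j) \<in> strict_upper n"
  then have ij: "i < j" "j < n" by (auto simp: mem_strict_upper)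
  show "if disp i j < 0 then (\<lambda>m. real_of_rat (\<phi> m $$ (i, j))) \<longlonglongrightarrow> projl (bdry_limit (i, j))
    else padic_tendsto p (\<lambda>m. padic_of_rat p (\<phi> m $$ (i, j))) (projr (bdry_limit (i, j)))"
    using real_convergent[OF ij] padic_tendsto_cls[OF padic_convergent[OF ij]] ij'
    by (simp add: bdry_limit_def convergent_LIMSEQ_iff)
qed

text \<open>Limits are unique in each field. As \<open>projl\<close> and \<open>projr\<close> forget
  the tag, membership in \<open>Gamma_bdry\<close> has to supply it.\<close>

lemma limit_point_eq: "limit_point p n \<mu> \<phi> = bdry_limit"
  unfolding limit_point_def
proof (rule the_equality)
  show "bdry_limit \<in> Gamma_bdry p n \<mu> \<and> converges_entrywise p n \<mu> \<phi> bdry_limit"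
    using bdry_limit_Gamma converges_bdry_limit by blast
  fix b assume b: "b \<in> Gamma_bdry p n \<mu> \<and> converges_entrywise p n \<mu> \<phi> b"
  show "b = bdry_limit"
  proof (rule PiE_ext)
    show "b \<in> (\<Pi>\<^sub>E (i, j)\<in>strict_upper n. if disp i j < 0 then range Inl else Inr ` carrier (Qp p))"
      using b unfolding Gamma_bdry_def by simp
    show "bdry_limit \<in> (\<Pi>\<^sub>E (i, j)\<in>strict_upper n. if disp i j < 0 then range Inl else Inr ` carrier (Qp p))"
      using bdry_limit_Gamma unfolding Gamma_bdry_def by simp
    fix ij assume ij: "ij \<in> strict_upper n"
    obtain i j where ij_eq: "ij = (i, j)" by (cases ij)
    have *: "b (i, j) \<in> (if disp i j < 0 then range Inl else Inr ` carrier (Qp p))"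
      "bdry_limit (i, j) \<in> (if disp i j < 0 then range Inl else Inr ` carrier (Qp p))"
      using b bdry_limit_Gamma ij unfolding Gamma_bdry_def ij_eq by (auto dest!: PiE_mem)
    have c: "if disp i j < 0 then (\<lambda>m. real_of_rat (\<phi> m $$ (i, j))) \<longlonglongrightarrow> projl (b' (i, j))
        else padic_tendsto p (\<lambda>m. padic_of_rat p (\<phi> m $$ (i, j))) (projr (b' (i, j)))"
      if "converges_entrywise p n \<mu> \<phi> b'" for b'
      using that ij unfolding converges_entrywise_def ij_eq by blast
    show "b ij = bdry_limit ij"
    proof (cases "disp i j < 0")
      case True
      then have "projl (b (i, j)) = projl (bdry_limit (i, j))"
        using c[of b] c[OF converges_bdry_limit] b LIMSEQ_unique by auto
      then show ?thesis using * True unfolding ij_eq by auto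
    next
      case False
      then have "projr (b (i, j)) = projr (bdry_limit (i, j))"
        using c[of b] c[OF converges_bdry_limit] b padic_tendsto_unique by auto
      then show ?thesis using * False unfolding ij_eq by auto
    qed
  qed
qed

section \<open>Entries of the approximation as fractions over \<open>p ^ K\<close>\<close>

lemma approx_T_entry_real:
  fixes M :: int
  assumes M: "\<bar>M\<bar> < int K" and x: "\<bar>x\<bar> < real p ^ (K - 1)"
  shows "\<exists>a. of_nat p powi M * of_int \<lfloor>real p powi (- M) * x\<rfloor> = (of_int a / of_nat p ^ K :: rat) \<and>
    \<bar>a\<bar> < int p ^ (2 * K)"
proof -
  define k where "k = nat (int K + M)"
  have k: "int k = int K + M" "k \<le> 2 * K - 1" "K > 0" using M unfolding k_def by auto
  let ?c = "\<lfloor>real p powi (- M) * x\<rfloor>"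
  define a where "a = int p ^ k * ?c"
  have pw: "(of_nat p powi M :: rat) = of_nat p ^ k / of_nat p ^ K"
  proof -
    have "(of_nat p powi M :: rat) = of_nat p powi (int k - int K)" using k by simp
    also have "\<dots> = of_nat p ^ k / of_nat p ^ K" by (subst power_int_diff) auto
    finally show ?thesis .
  qed
  have pw': "real p ^ k * real p powi (- M) = real p ^ K"
  proof -
    have "real p ^ k * real p powi (- M) = real p powi (int k + - M)"
      by (subst power_int_add) auto
    also have "int k + - M = int K" using k by simp
    finally show ?thesis by simp
  qed
  \<comment> \<open>Rounding costs 1 before scaling, hence \<open>p ^ k\<close> after it. Both
    contributions are at most \<open>p ^ (2 * K - 1)\<close>, and one more factor
    \<open>p \<ge> 2\<close> absorbs their sum.\<close>
  have "\<bar>real_of_int a\<bar> = real p ^ k * \<bar>real_of_int ?c\<bar>" by (simp add: a_def abs_mult)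
  also have "\<bar>real_of_int ?c\<bar> \<le> \<bar>real p powi (- M) * x\<bar> + 1" by linarith
  also have "\<bar>real p powi (- M) * x\<bar> = real p powi (- M) * \<bar>x\<bar>" by (simp add: abs_mult)
  finally have "\<bar>real_of_int a\<bar> \<le> real p ^ k * (real p powi (- M) * \<bar>x\<bar> + 1)" by (simp add: mult_left_mono)
  also have "\<dots> = (real p ^ k * real p powi (- M)) * \<bar>x\<bar> + real p ^ k" by (simp add: algebra_simps)
  also have "\<dots> = real p ^ K * \<bar>x\<bar> + real p ^ k" unfolding pw' ..
  also have "\<dots> < real p ^ K * real p ^ (K - 1) + real p ^ (2 * K - 1)"
    using x k real_p_gt_1 by (intro add_less_le_mono mult_strict_left_mono power_increasing) auto
  also have "real p ^ K * real p ^ (K - 1) = real p ^ (2 * K - 1)"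
    using k by (simp add: power_add[symmetric] mult_2)
  also have "real p ^ (2 * K - 1) + real p ^ (2 * K - 1) \<le> real p * real p ^ (2 * K - 1)"
  proof -
    have "2 * real p ^ (2 * K - 1) \<le> real p * real p ^ (2 * K - 1)"
      using p_gt_1 by (intro mult_right_mono) auto
    then show ?thesis by simp
  qed
  also have "\<dots> = real p ^ (2 * K)" using k by (simp add: power_Suc[symmetric] del: power_Suc)
  finally have "real_of_int \<bar>a\<bar> < real_of_int (int p ^ (2 * K))" by simp
  then have "\<bar>a\<bar> < int p ^ (2 * K)" by (simp only: of_int_less_iff)
  moreover have "of_nat p powi M * of_int ?c = (of_int a / of_nat p ^ K :: rat)"
    unfolding pw a_def by simp
  ultimately show ?thesis by blast
qed

lemma approx_T_entry_padic:
  fixes M :: int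
  assumes M: "\<bar>M\<bar> < int K" and q: "q \<in> padic_cauchy p" and int: "\<And>m. of_nat p ^ \<kappa> * q m \<in> \<int>"
    and K: "\<kappa> \<le> K"
  shows "\<exists>a. of_nat p powi M * padic_frac p (padic_of_rat p (of_nat p powi (- M)) \<otimes>\<^bsub>Qp p\<^esub> cls q)
    = (of_int a / of_nat p ^ K :: rat) \<and> \<bar>a\<bar> < int p ^ (2 * K)"
proof -
  \<comment> \<open>\<open>L\<close> is the denominator exponent of \<open>p powi (- M)\<close>
    times \<open>q\<close>; truncation at 0 is harmless, as the product is then integral and its
    fractional part is 0. Over the denominator \<open>p ^ K\<close> the numerator acquires the
    factor \<open>p ^ r\<close>, whose exponent is nonnegative by \<open>\<kappa> \<le> K\<close>
    and \<open>\<bar>M\<bar> < K\<close>.\<close>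
  define L where "L = nat (int \<kappa> + M)"
  define r where "r = nat (int K + M - int L)"
  have L: "int L \<ge> int \<kappa> + M" and r: "int r = int K + M - int L" "L + r \<le> 2 * K"
    using M K unfolding L_def r_def by auto
  let ?q = "\<lambda>m. of_nat p powi (- M) * q m"
  have q': "?q \<in> padic_cauchy p" by (rule cauchy_mult[OF const_cauchy q])
  have "of_nat p ^ L * ?q m \<in> \<int>" for m
  proof -
    define l where "l = nat (int L - M - int \<kappa>)"
    have l: "int l = int L - M - int \<kappa>" using L unfolding l_def by simp
    have "of_nat p ^ L * of_nat p powi (- M) = (of_nat p powi (int L + - M) :: rat)"
      by (subst power_int_add) auto
    also have "int L + - M = int (l + \<kappa>)" using l by simp
    also have "(of_nat p powi int (l + \<kappa>) :: rat) = of_nat p ^ l * of_nat p ^ \<kappa>"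
      by (simp only: power_int_of_nat power_add)
    finally have "of_nat p ^ L * ?q m = of_nat p ^ l * (of_nat p ^ \<kappa> * q m)"
      by (simp add: mult.assoc[symmetric])
    moreover have "of_nat p ^ l \<in> (\<int> :: rat set)" by simp
    ultimately show ?thesis using Ints_mult[OF _ int] by metis
  qed
  then obtain a where a: "a < p ^ L" "padic_frac p (cls ?q) = of_nat a / of_nat p ^ L"
    using padic_frac_cls[OF q'] by blast
  have "padic_of_rat p (of_nat p powi (- M)) \<otimes>\<^bsub>Qp p\<^esub> cls q = cls ?q"
    unfolding padic_of_rat_cls by (rule cls_mult[OF const_cauchy q])
  moreover have "(of_nat p powi M :: rat) = of_nat p ^ r * of_nat p ^ L / of_nat p ^ K"
  proof -
    have "(of_nat p powi M :: rat) = of_nat p powi (int (r + L) - int K)" using r by simp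
    also have "\<dots> = of_nat p ^ (r + L) / of_nat p ^ K"
      by (simp add: power_int_diff del: of_nat_add)
    finally show ?thesis by (simp add: power_add)
  qed
  ultimately have "of_nat p powi M * padic_frac p (padic_of_rat p (of_nat p powi (- M)) \<otimes>\<^bsub>Qp p\<^esub> cls q)
    = (of_int (int (p ^ r * a)) / of_nat p ^ K :: rat)"
    using a(2) by simp
  moreover have "p ^ r * a < p ^ (2 * K)"
  proof -
    have "p ^ r * a < p ^ r * p ^ L" using a(1) by simp
    also have "\<dots> = p ^ (L + r)" by (simp add: power_add)
    also have "\<dots> \<le> p ^ (2 * K)" using r p_gt_1 by (intro power_increasing) auto
    finally show ?thesis .
  qed
  then have "\<bar>int (p ^ r * a)\<bar> < int p ^ (2 * K)" by (metis abs_of_nat of_nat_less_iff of_nat_power)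
  ultimately show ?thesis by blast
qed

text \<open>A p-adic Cauchy sequence is bounded, and for entries with only powers of
  \<open>p\<close> in the denominator this bounds all denominators at once.\<close>

lemma padic_limit_denominator:
  assumes "i < j" "j < n" "\<not> disp i j < 0"
  obtains \<kappa> where "\<And>m. of_nat p ^ \<kappa> * \<phi> m $$ (i, j) \<in> \<int>"
proof -
  obtain C where C: "\<And>m. v (\<phi> m $$ (i, j)) \<le> C"
    using cauchy_bounded[OF padic_convergent[OF assms]] by blast
  obtain \<kappa> where "C < real p ^ \<kappa>" using real_arch_pow[OF real_p_gt_1] by blast
  then have "of_nat p ^ \<kappa> * \<phi> m $$ (i, j) \<in> \<int>" for m
    using C[of m] assms by (intro Z_inverse_scaled_Ints UT_Zi[OF \<phi>_UT]) auto
  then show ?thesis by (rule that)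
qed

text \<open>The threshold \<open>B\<close> depends on the limit entry but not on \<open>M\<close>,
  so it can be fixed before \<open>m\<close>.\<close>

lemma approx_entry_bound:
  assumes ij: "i < j" "j < n"
  obtains B where "\<And>K M. B \<le> K \<Longrightarrow> \<bar>M\<bar> < int K \<Longrightarrow>
    \<exists>a. (if disp i j < 0 then of_nat p powi M * of_int \<lfloor>real p powi (- M) * projl (bdry_limit (i, j))\<rfloor>
       else of_nat p powi M * padic_frac p (padic_of_rat p (of_nat p powi (- M)) \<otimes>\<^bsub>Qp p\<^esub> projr (bdry_limit (i, j))))
     = (of_int a / of_nat p ^ K :: rat) \<and> \<bar>a\<bar> < int p ^ (2 * K)"
proof (cases "disp i j < 0")
  case True
  obtain B where B: "\<bar>projl (bdry_limit (i, j))\<bar> < real p ^ B"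
    using real_arch_pow[OF real_p_gt_1] by blast
  show ?thesis
  proof (rule that[of "Suc B"])
    fix K M assume K: "Suc B \<le> K" and M: "\<bar>M\<bar> < int K"
    have "real p ^ B \<le> real p ^ (K - 1)" using K real_p_gt_1 by (intro power_increasing) auto
    then have "\<bar>projl (bdry_limit (i, j))\<bar> < real p ^ (K - 1)" using B by simp
    from approx_T_entry_real[OF M this] True
    show "\<exists>a. (if disp i j < 0 then of_nat p powi M * of_int \<lfloor>real p powi (- M) * projl (bdry_limit (i, j))\<rfloor>
       else of_nat p powi M * padic_frac p (padic_of_rat p (of_nat p powi (- M)) \<otimes>\<^bsub>Qp p\<^esub> projr (bdry_limit (i, j))))
     = (of_int a / of_nat p ^ K :: rat) \<and> \<bar>a\<bar> < int p ^ (2 * K)" by simp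
  qed
next
  case False
  obtain \<kappa> where \<kappa>: "\<And>m. of_nat p ^ \<kappa> * \<phi> m $$ (i, j) \<in> \<int>"
    using padic_limit_denominator[OF ij False] by blast
  have b: "projr (bdry_limit (i, j)) = cls (\<lambda>m. \<phi> m $$ (i, j))"
    using False ij by (simp add: bdry_limit_def mem_strict_upper)
  show ?thesis
    using approx_T_entry_padic[OF _ padic_convergent[OF ij False] \<kappa>] False
    by (intro that[of \<kappa>]) (simp add: b)
qed

lemma approx_Pi_bound:
  obtains C where "\<And>m. approx_Pi p n \<mu> m bdry_limit \<in> carrier G"
    "\<And>m. wl (approx_Pi p n \<mu> m bdry_limit) \<le> C * Suc m"
proof -
  let ?d = "\<lambda>i. m1 (proj_law \<mu> i)"
  let ?T = "\<lambda>i j M. if disp i j < 0 then of_nat p powi M * of_int \<lfloor>real p powi (- M) * projl (bdry_limit (i, j))\<rfloor>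
       else of_nat p powi M * padic_frac p (padic_of_rat p (of_nat p powi (- M)) \<otimes>\<^bsub>Qp p\<^esub> projr (bdry_limit (i, j))) :: rat"
  have "\<forall>ij. \<exists>B. \<forall>K M. fst ij < snd ij \<longrightarrow> snd ij < n \<longrightarrow> B \<le> K \<longrightarrow> \<bar>M\<bar> < int K \<longrightarrow>
      (\<exists>a. ?T (fst ij) (snd ij) M = of_int a / of_nat p ^ K \<and> \<bar>a\<bar> < int p ^ (2 * K))"
  proof
    fix ij :: "nat \<times> nat"
    show "\<exists>B. \<forall>K M. fst ij < snd ij \<longrightarrow> snd ij < n \<longrightarrow> B \<le> K \<longrightarrow> \<bar>M\<bar> < int K \<longrightarrow>
      (\<exists>a. ?T (fst ij) (snd ij) M = of_int a / of_nat p ^ K \<and> \<bar>a\<bar> < int p ^ (2 * K))"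
    proof (cases "fst ij < snd ij \<and> snd ij < n")
      case True
      obtain B where "\<And>K M. B \<le> K \<Longrightarrow> \<bar>M\<bar> < int K \<Longrightarrow>
        \<exists>a. ?T (fst ij) (snd ij) M = of_int a / of_nat p ^ K \<and> \<bar>a\<bar> < int p ^ (2 * K)"
        using approx_entry_bound[OF conjunct1[OF True] conjunct2[OF True]] by blast
      then show ?thesis by blast
    qed blast
  qed
  from choice[OF this] obtain B where B: "\<forall>ij. \<forall>K M. fst ij < snd ij \<longrightarrow> snd ij < n \<longrightarrow> B ij \<le> K \<longrightarrow>
      \<bar>M\<bar> < int K \<longrightarrow> (\<exists>a. ?T (fst ij) (snd ij) M = of_int a / of_nat p ^ K \<and> \<bar>a\<bar> < int p ^ (2 * K))"
    by blast
  obtain A0 :: nat where A0: "(\<Sum>i<n. \<bar>?d i\<bar>) \<le> real A0" using real_arch_simple by blast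
  have d_le: "\<bar>?d i\<bar> \<le> real A0" if "i < n" for i
    using member_le_sum[of i "{..<n}" "\<lambda>i. \<bar>?d i\<bar>"] that A0 by simp
  \<comment> \<open>\<open>2 * A0 + 3\<close> covers the difference of two floors with their
    rounding errors, the last sum all thresholds \<open>B\<close>. One exponent \<open>K m\<close>,
    linear in \<open>m\<close>, then serves every entry and coordinate.\<close>
  define A where "A = 2 * A0 + 3 + (\<Sum>ij\<in>{..<n} \<times> {..<n}. B ij)"
  have B_le: "B (i, j) \<le> A" if "i < n" "j < n" for i j
    using member_le_sum[of "(i, j)" "{..<n} \<times> {..<n}" B] that unfolding A_def by simp
  \<comment> \<open>With \<open>Suc m\<close> the thresholds are met at \<open>m = 0\<close> as
    well.\<close>
  define K where "K m = A * Suc m" for m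
  have A_K: "A \<le> K m" for m unfolding K_def by simp
  define a where "a m = A0 * m + 1" for m
  have floor: "\<bar>\<lfloor>real m * ?d i\<rfloor>\<bar> \<le> int (a m)" if "i < n" for i m
  proof -
    have "\<bar>real m * ?d i\<bar> \<le> real m * real A0"
      using d_le[OF that] by (simp add: abs_mult mult_left_mono)
    then have "\<bar>real_of_int \<lfloor>real m * ?d i\<rfloor>\<bar> \<le> real m * real A0 + 1" by linarith
    also have "\<dots> = real_of_int (int (a m))" by (simp add: a_def)
    finally show ?thesis by linarith
  qed
  have K_ge: "2 * a m < K m" for m
  proof -
    have "2 * a m < (2 * A0 + 3) * Suc m" by (simp add: a_def algebra_simps)
    also have "\<dots> \<le> K m" unfolding K_def A_def by (intro mult_le_mono1) simp
    finally show ?thesis .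
  qed
  have t: "\<bar>approx_t n \<mu> m $ i\<bar> \<le> int (K m)" if "i < n" for m i
  proof -
    have "approx_t n \<mu> m $ i = \<lfloor>real m * ?d i\<rfloor>" using that by (simp add: approx_t_def)
    then show ?thesis using floor[OF that, of m] K_ge[of m] by linarith
  qed
  have M: "\<bar>approx_exponent \<mu> m i j\<bar> < int (K m)" if "i < n" "j < n" for m i j
    using floor[OF that(1), of m] floor[OF that(2), of m] K_ge[of m] unfolding approx_exponent_def by linarith
  have entry: "\<exists>a. approx_T p n \<mu> m bdry_limit $$ (i, j) = of_int a / of_nat p ^ K m \<and> \<bar>a\<bar> < int p ^ (2 * K m)"
    if ij: "i < j" "j < n" for m i j
  proof -
    have eq: "approx_T p n \<mu> m bdry_limit $$ (i, j) = ?T i j (approx_exponent \<mu> m i j)"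
      using ij by (simp add: approx_T_def Let_def)
    have i: "i < n" and BK: "B (i, j) \<le> K m" using ij order_trans[OF B_le A_K, of i j m] by auto
    show ?thesis unfolding eq
      by (rule B[rule_format, of "(i, j)" "K m" "approx_exponent \<mu> m i j",
          unfolded fst_conv snd_conv, OF ij BK M[OF i ij(2)]])
  qed
  have UT: "approx_T p n \<mu> m bdry_limit \<in> UT n Zi" for m
  proof (rule UT_I)
    fix i j assume ij: "i < n" "j < n"
    show "approx_T p n \<mu> m bdry_limit $$ (i, j) \<in> Zi"
    proof (cases "i < j")
      case True
      then show ?thesis using entry[OF True ij(2), of m] unfolding Z_inverse_def by blast
    next
      case False
      then have "approx_T p n \<mu> m bdry_limit $$ (i, j) = (if i = j then 1 else 0)"
        using ij by (simp add: approx_T_def)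
      then show ?thesis by simp
    qed
  qed (auto simp: approx_T_def)
  have car: "approx_Pi p n \<mu> m bdry_limit \<in> carrier G" for m
    unfolding approx_Pi_def G_carrier using UT by (simp add: approx_t_def)
  obtain C where C: "\<And>x f K. (x, f) \<in> carrier G \<Longrightarrow> (\<And>i. i < n \<Longrightarrow> \<bar>x $ i\<bar> \<le> int K) \<Longrightarrow>
    (\<And>i j. i < j \<Longrightarrow> j < n \<Longrightarrow> \<exists>a. f $$ (i, j) = of_int a / of_nat p ^ K \<and> \<bar>a\<bar> < int p ^ (2 * K)) \<Longrightarrow>
    wl (x, f) \<le> C * K"
    using wl_upper_bound by blast
  have "wl (approx_Pi p n \<mu> m bdry_limit) \<le> (C * A) * Suc m" for m
    using C[OF car[of m, unfolded approx_Pi_def] t entry] unfolding approx_Pi_def K_def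
    by (simp only: mult.assoc)
  with car show ?thesis by (rule that)
qed

lemma approx_Pi_distance:
  assumes lin: "eventually (\<lambda>m. real (wl (W m)) \<le> c * real m) sequentially"
  shows "(\<lambda>m. real (wl (inv\<^bsub>G\<^esub> (approx_Pi p n \<mu> m bdry_limit) \<otimes>\<^bsub>G\<^esub> W m))) \<in> O(\<lambda>m. real m)"
proof -
  obtain C where C: "\<And>m. approx_Pi p n \<mu> m bdry_limit \<in> carrier G"
    "\<And>m. wl (approx_Pi p n \<mu> m bdry_limit) \<le> C * Suc m"
    using approx_Pi_bound by blast
  show ?thesis
  proof (rule bigoI)
    show "eventually (\<lambda>m. norm (real (wl (inv\<^bsub>G\<^esub> (approx_Pi p n \<mu> m bdry_limit) \<otimes>\<^bsub>G\<^esub> W m)))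
        \<le> (2 * real C + c) * norm (real m)) sequentially"
      \<comment> \<open>For \<open>m \<ge> 1\<close> the bound \<open>Suc m \<le> 2 * m\<close>
        turns \<open>C * Suc m\<close> into a multiple of \<open>m\<close>.\<close>
      using lin eventually_ge_at_top[of 1]
    proof eventually_elim
      case (elim m)
      let ?P = "approx_Pi p n \<mu> m bdry_limit"
      have "wl (inv\<^bsub>G\<^esub> ?P \<otimes>\<^bsub>G\<^esub> W m) \<le> wl (inv\<^bsub>G\<^esub> ?P) + wl (W m)"
        using C W_carrier by (intro wl_mult) auto
      also have "\<dots> \<le> C * Suc m + wl (W m)" using wl_inv[OF C(1), of m] C(2)[of m] by simp
      finally have "wl (inv\<^bsub>G\<^esub> ?P \<otimes>\<^bsub>G\<^esub> W m) \<le> C * Suc m + wl (W m)" .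
      then have "real (wl (inv\<^bsub>G\<^esub> ?P \<otimes>\<^bsub>G\<^esub> W m)) \<le> real (C * Suc m + wl (W m))"
        by (simp only: of_nat_le_iff)
      also have "\<dots> = real C * real (Suc m) + real (wl (W m))" by (simp only: of_nat_add of_nat_mult)
      also have "\<dots> \<le> real C * (2 * real m) + c * real m"
        using elim by (intro add_mono mult_left_mono) auto
      finally show ?case by (simp add: algebra_simps)
    qed
  qed
qed

end

section \<open>The random walk\<close>

context prob_space
begin

context
  fixes \<xi> :: "nat \<Rightarrow> 'a \<Rightarrow> 'b" and \<mu> :: "'b pmf"
  assumes indep: "indep_vars (\<lambda>_. count_space UNIV) \<xi> {1..}"
    and law: "\<And>k. k \<ge> 1 \<Longrightarrow> distr M (count_space UNIV) (\<xi> k) = measure_pmf \<mu>"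
begin

lemma iid_pmf_measurable: "k \<ge> 1 \<Longrightarrow> \<xi> k \<in> measurable M (count_space UNIV)"
  using indep by (auto simp: indep_vars_def2)

lemma iid_pmf_AE_in_set_pmf: "AE \<omega> in M. \<forall>k. \<xi> (Suc k) \<omega> \<in> set_pmf \<mu>"
  unfolding AE_all_countable
proof
  fix k
  have "AE x in distr M (count_space UNIV) (\<xi> (Suc k)). x \<in> set_pmf \<mu>"
    unfolding law[of "Suc k", simplified] by (rule AE_measure_pmf)
  then show "AE \<omega> in M. \<xi> (Suc k) \<omega> \<in> set_pmf \<mu>"
    by (rule AE_distrD[OF iid_pmf_measurable, rotated]) simp
qed

lemma iid_pmf_strong_law:
  fixes f :: "'b \<Rightarrow> real"
  assumes f: "integrable (measure_pmf \<mu>) f"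
  shows "AE \<omega> in M. \<forall>e>0. eventually (\<lambda>m. \<bar>(\<Sum>k<m. f (\<xi> (Suc k) \<omega>)) -
    measure_pmf.expectation \<mu> f * real m\<bar> \<le> e * real m) sequentially"
proof -
  let ?X = "\<lambda>k \<omega>. f (\<xi> (Suc k) \<omega>)"
  have [measurable]: "\<xi> (Suc k) \<in> measurable M (count_space UNIV)" for k
    by (rule iid_pmf_measurable) simp
  have "range Suc = {1..}" by (auto simp: image_iff) (metis Suc_le_D One_nat_def)
  then have "indep_vars (\<lambda>_. count_space UNIV) (\<lambda>k. \<xi> (Suc k)) UNIV"
    using indep by (intro indep_vars_reindex_inj[where h = Suc]) auto
  then have ind: "indep_vars (\<lambda>_. borel) ?X UNIV"
    by (rule indep_vars_compose2) auto
  have dist: "distr M borel (?X k) = distr (measure_pmf \<mu>) borel f" for k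
    unfolding law[of "Suc k", symmetric, simplified]
    by (subst distr_distr) (auto simp: o_def)
  have int: "integrable M (?X 0)"
    using f unfolding law[of "Suc 0", symmetric, simplified] by (subst (asm) integrable_distr_eq) auto
  have "expectation (?X 0) = measure_pmf.expectation \<mu> f"
    unfolding law[of "Suc 0", symmetric, simplified] by (subst integral_distr) auto
  with strong_law_of_large_numbers[of ?X, OF ind _ int] show ?thesis
    by (simp add: dist)
qed

end

end

text \<open>A step is the difference of consecutive partial sums, whose linear parts cancel up to
  \<open>a\<close>. Tolerance \<open>e / 4\<close> on both sums costs about
  \<open>e * m / 2\<close>; beyond \<open>N\<close> the other half pays for
  \<open>\<bar>a\<bar>\<close> and the remainder. It is applied to the word lengths of the
  increments.\<close>

lemma small_steps:
  fixes u :: "nat \<Rightarrow> real"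
  assumes lim: "\<And>e. e > 0 \<Longrightarrow> eventually (\<lambda>m. \<bar>(\<Sum>k<m. u k) - a * real m\<bar> \<le> e * real m) sequentially"
    and e: "e > 0"
  shows "eventually (\<lambda>m. u m \<le> e * real m) sequentially"
proof -
  obtain N :: nat where N: "2 * (\<bar>a\<bar> + e) / e \<le> real N" using real_arch_simple by blast
  have e4: "e / 4 > 0" using e by simp
  have "eventually (\<lambda>m. \<bar>(\<Sum>k<Suc m. u k) - a * real (Suc m)\<bar> \<le> e / 4 * real (Suc m)) sequentially"
    using lim[OF e4] by (subst eventually_sequentially_Suc)
  then show ?thesis
    using lim[OF e4] eventually_ge_at_top[of N]
  proof eventually_elim
    case (elim m)
    have "2 * (\<bar>a\<bar> + e) / e \<le> real m" using N elim by linarith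
    then have "2 * (\<bar>a\<bar> + e) \<le> e * real m" using e by (simp add: field_simps)
    moreover have "u m \<le> a + e / 4 * real (Suc m) + e / 4 * real m"
    proof -
      have "(\<Sum>k<Suc m. u k) = (\<Sum>k<m. u k) + u m" "a * real (Suc m) = a * real m + a"
        by (simp_all add: distrib_left)
      then show ?thesis using abs_le_D1[OF elim(1)] abs_le_D2[OF elim(2)] by linarith
    qed
    moreover have "e / 4 * real (Suc m) + e / 4 * real m = e / 4 + e * real m / 2"
      by (simp add: field_simps)
    ultimately have "u m \<le> \<bar>a\<bar> + (e / 4 + e * real m / 2)" "\<bar>a\<bar> + e \<le> e * real m / 2"
      by auto
    then show ?case using e by simp
  qed
qed

theorem mainTheorem7:
  fixes p n :: nat
    and S :: "elt set"
    and \<mu> :: "elt pmf"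
    and \<Omega> :: "'w measure"
    and \<xi> :: "nat \<Rightarrow> 'w \<Rightarrow> elt"
  defines "G \<equiv> semidirect p n"
    and "\<phi>_inf \<equiv> (\<lambda>\<omega>. limit_point p n \<mu> (\<lambda>m. snd (right_walk (semidirect p n) \<xi> m \<omega>)))"
  assumes "prime p"
    and "finite S" and "S \<subseteq> carrier G" and "generate G S = carrier G"
    and "set_pmf \<mu> \<subseteq> carrier G"
    and "integrable (measure_pmf \<mu>) (\<lambda>g. real (word_length G S g))"
    and "\<not> comm_group (subgroup_generated G (set_pmf \<mu>))"
    and "displacement_nonzero n \<mu>"
    and "column_consistent n \<mu>"
    and "prob_space \<Omega>"
    and "prob_space.indep_vars \<Omega> (\<lambda>_. count_space UNIV) \<xi> {1..}"
    and "\<And>k. k \<ge> 1 \<Longrightarrow> distr \<Omega> (count_space UNIV) (\<xi> k) = measure_pmf \<mu>"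
  shows "AE \<omega> in \<Omega>.
    \<phi>_inf \<omega> \<in> Gamma_bdry p n \<mu> \<and>
    converges_entrywise p n \<mu> (\<lambda>m. snd (right_walk G \<xi> m \<omega>)) (\<phi>_inf \<omega>) \<and>
    (\<lambda>m. real (word_length G S
       (inv\<^bsub>G\<^esub> (approx_Pi p n \<mu> m (\<phi>_inf \<omega>)) \<otimes>\<^bsub>G\<^esub> right_walk G \<xi> m \<omega>)))
      \<in> O(\<lambda>m. real m)"
proof -
  interpret grp: padic_group p n by unfold_locales fact
  interpret grp: padic_generated_finite p n S
    by unfold_locales (use assms in \<open>auto simp: G_def\<close>)
  interpret prob_space \<Omega> by fact
  note indep = assms(13) and law = assms(14)
  let ?wl = "word_length G S"
  let ?a = "measure_pmf.expectation \<mu> (\<lambda>g. real (?wl g))"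
  let ?W = "\<lambda>\<omega> m. right_walk G \<xi> m \<omega>"
  \<comment> \<open>The first moment of the word length dominates that of each coordinate, so the
    strong law also gives the drift of the walk.\<close>
  have coord_int: "integrable (measure_pmf \<mu>) (\<lambda>g. real_of_int (fst g $ i))" if "i < n" for i
  proof -
    obtain Z where Z: "Z \<ge> 0" "\<And>g i. g \<in> carrier G \<Longrightarrow> i < n \<Longrightarrow> \<bar>real_of_int (fst g $ i)\<bar> \<le> Z * real (?wl g)"
      using grp.coordinate_bound unfolding G_def by blast
    show ?thesis
    proof (rule Bochner_Integration.integrable_bound)
      show "integrable (measure_pmf \<mu>) (\<lambda>g. Z * real (?wl g))" using assms(8) by simp
      show "AE g in measure_pmf \<mu>. norm (real_of_int (fst g $ i)) \<le> norm (Z * real (?wl g))"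
        using Z that assms(7) by (auto simp: AE_measure_pmf_iff)
    qed simp
  qed
  have m1_eq: "m1 (proj_law \<mu> i) = measure_pmf.expectation \<mu> (\<lambda>g. real_of_int (fst g $ i))" for i
    unfolding m1_def proj_law_def by (simp add: case_prod_unfold)
  have "AE \<omega> in \<Omega>. \<forall>i\<in>{..<n}. \<forall>e>0. eventually (\<lambda>m. \<bar>(\<Sum>k<m. real_of_int (fst (\<xi> (Suc k) \<omega>) $ i)) -
      m1 (proj_law \<mu> i) * real m\<bar> \<le> e * real m) sequentially"
    unfolding m1_eq
    by (intro AE_finite_allI iid_pmf_strong_law[OF indep law]) (auto intro: coord_int)
  moreover have "AE \<omega> in \<Omega>. \<forall>e>0. eventually (\<lambda>m. \<bar>(\<Sum>k<m. real (?wl (\<xi> (Suc k) \<omega>))) - ?a * real m\<bar> \<le> e * real m) sequentially"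
    by (rule iid_pmf_strong_law[OF indep law assms(8)])
  moreover have "AE \<omega> in \<Omega>. \<forall>k. \<xi> (Suc k) \<omega> \<in> set_pmf \<mu>"
    by (rule iid_pmf_AE_in_set_pmf[OF indep law])
  ultimately show ?thesis
  proof eventually_elim
    case (elim \<omega>)
    have car: "\<xi> (Suc k) \<omega> \<in> carrier G" for k using elim(3) assms(7) by blast
    have W_car: "?W \<omega> m \<in> carrier G" for m
      by (induction m) (use car grp.G.m_closed grp.G.one_closed in \<open>auto simp: G_def\<close>)
    have coord: "real_of_int (fst (?W \<omega> m) $ i) = (\<Sum>k<m. real_of_int (fst (\<xi> (Suc k) \<omega>) $ i))"
      if "i < n" for i m
    proof (induction m)
      case 0
      then show ?case using that by (simp add: G_def grp.G_one)
    next
      case (Suc m)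
      obtain x f y u where xy: "?W \<omega> m = (x, f)" "\<xi> (Suc m) \<omega> = (y, u)"
        by (metis surj_pair)
      have "x \<in> carrier_vec n" "y \<in> carrier_vec n" "u \<in> carrier_mat n n"
        using W_car[of m, unfolded xy] car[of m, unfolded xy]
        by (auto simp: G_def grp.G_carrier grp.UT_carrier_mat)
      then have "fst (?W \<omega> (Suc m)) $ i = x $ i + y $ i"
        using that by (simp add: xy) (simp add: G_def grp.G_mult)
      then show ?case using Suc xy by simp
    qed
    have wl_sum: "real (?wl (?W \<omega> m)) \<le> (\<Sum>k<m. real (?wl (\<xi> (Suc k) \<omega>)))" for m
    proof (induction m)
      case 0
      then show ?case using grp.wl_one by (simp add: G_def)
    next
      case (Suc m)
      have "?wl (?W \<omega> (Suc m)) \<le> ?wl (?W \<omega> m) + ?wl (\<xi> (Suc m) \<omega>)"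
        using grp.wl_mult[of "?W \<omega> m" "\<xi> (Suc m) \<omega>"] W_car[of m] car[of m] by (simp add: G_def)
      then show ?case using Suc by simp
    qed
    have walk: "drifting_walk p n S \<mu> (\<lambda>m. \<xi> m \<omega>) (?W \<omega>)"
    proof unfold_locales
      show "displacement_nonzero n \<mu>" "column_consistent n \<mu>" by fact+
      show "eventually (\<lambda>m. \<bar>of_int (fst (?W \<omega> m) $ i) - m1 (proj_law \<mu> i) * real m\<bar> \<le> e * real m) sequentially"
        if "i < n" "e > 0" for i e
        using elim(1) that by (simp add: coord)
      show "eventually (\<lambda>m. real (word_length (semidirect p n) S (\<xi> (Suc m) \<omega>)) \<le> e * real m) sequentially"
        if "e > 0" for e
        using small_steps[of "\<lambda>k. real (?wl (\<xi> (Suc k) \<omega>))" ?a, OF _ that] elim(2) by (simp add: G_def)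
      show "\<xi> (Suc m) \<omega> \<in> carrier (semidirect p n)" for m
        using car[of m] by (simp add: G_def)
      show "?W \<omega> 0 = \<one>\<^bsub>semidirect p n\<^esub>" by (simp add: G_def)
      show "?W \<omega> (Suc m) = ?W \<omega> m \<otimes>\<^bsub>semidirect p n\<^esub> \<xi> (Suc m) \<omega>" for m
        by (simp add: G_def)
    qed
    have "eventually (\<lambda>m. \<bar>(\<Sum>k<m. real (?wl (\<xi> (Suc k) \<omega>))) - ?a * real m\<bar> \<le> 1 * real m) sequentially"
      by (rule elim(2)[rule_format]) simp
    then have lin: "eventually (\<lambda>m. real (?wl (?W \<omega> m)) \<le> (?a + 1) * real m) sequentially"
    proof eventually_elim
      case (elim m)
      then show ?case using wl_sum[of m] by (simp add: algebra_simps abs_le_iff)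
    qed
    have "\<phi>_inf \<omega> = drifting_walk.bdry_limit p n \<mu> (?W \<omega>)"
      using drifting_walk.limit_point_eq[OF walk] by (simp add: \<phi>_inf_def G_def)
    then show ?case
      using drifting_walk.bdry_limit_Gamma[OF walk] drifting_walk.converges_bdry_limit[OF walk]
        drifting_walk.approx_Pi_distance[OF walk[unfolded G_def] lin[unfolded G_def]] by (simp add: G_def)
  qed
qed

end
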